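(* Let $\kappa$ be a nonzero real number. Let $R_+$ be the right ideal of $SU_\mu(2)$ generated by $$\rho^2,\quad \rho(\sigma-\sigma^* ),\quad \sigma^2+\mu^2(\sigma^* )^2+(1+\mu^2)^2\rho\rho^*-(1+\mu^2)I,\quad (\rho^* )^2,\quad \rho^*(\sigma-\sigma^* ),$$ $$t\rho,\quad t\rho^*,\quad t(\sigma-\sigma^* ),\quad t\left(\mu^2\sigma+\sigma^*-(1+\mu^2)I\right),\qquad\text{where } t=\mu^2\sigma+\sigma^*-\tfrac{1+\mu^4}{\mu}I$$ (the ideal defining the $4D_+$ bicovariant calculus), and let $\tilde R_{0+}\subset\tilde E_\kappa(2)$ be its contraction, in the sense of the context. Then $\tilde R_{0+}$ is the right ideal of $\tilde E_\kappa(2)$ generated by the following elements: $$a_0+a_0^*-2I;\quad (a_0-I)w_0;\quad (a_0^*-I)w_0;\quad (a_0-I)w_0^*;\quad (a_0^*-I)w_0^*;\quad w_0^2+\tfrac1\kappa w_0;\quad (w_0^* )^2-\tfrac1\kappa w_0^*.$$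
   Context: $[x,y]=xy-yx$ and $I$ is the unit. The quantum group $SU_\mu(2)$: the unital $*$-algebra generated by $\sigma,\rho$ with relations $\rho\rho^*=\rho^*\rho$, $\mu(\rho-\rho^* )\sigma=\sigma(\rho-\rho^* )$, $\mu(\rho+\rho^* )\sigma=\sigma(\rho+\rho^* )$, $\sigma\sigma^*+\mu^2\rho\rho^*=I$, $\sigma^*\sigma+\rho\rho^*=I$ (and their adjoints). Contraction: put $\mu=e^{1/(\kappa R)}$, where $R$ is the contraction parameter, and write $h=1/R$ (formal, $h^*=h$). Consider $SU_\mu(2)$ over the field $\mathbb C((h))$ with $\mu=e^{h/\kappa}$. Define $a$ and $w$ by $$a=\tfrac12(\sigma+\rho-\mu\rho^*+\sigma^* ),\qquad \tfrac{1}{R}\,w=\tfrac12(-\sigma-\rho-\mu\rho^*+\sigma^* ),$$ equivalently $$\sigma=\tfrac{1}{1+\mu}\left(\mu a+a^*+\tfrac1R(w^*-\mu w)\right),\qquad \rho=\tfrac{1}{1+\mu}\left(a-a^*-\tfrac1R(w+w^* )\right).$$ Let $\mathcal L$ be the $\mathbb C[[h]]$-subalgebra generated by $a,a^*,w,w^*$. The limit $R\to\infty$ of $SU_\mu(2)$ is $\tilde E_\kappa(2)=\mathcal L/h\mathcal L$, and $a_0,a_0^*,w_0,w_0^*$ are the images of $a,a^*,w,w^*$. As an algebra $\tilde E_\kappa(2)$ is generated by $a_0,a_0^*,w_0,w_0^*$ with relations $a_0a_0^*=a_0^*a_0=I$, $[a_0,w_0]=-[a_0,w_0^*]=\frac1{2\kappa}(a_0^2-I)$,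 $[a_0^*,w_0]=-[a_0^*,w_0^*]=\frac1{2\kappa}((a_0^* )^2-I)$, $[w_0,w_0^*]=-\frac1{2\kappa}(a_0+a_0^* )(w_0+w_0^* )$. The contraction of a right ideal $\mathcal I$ of $SU_\mu(2)$ is the set of limits as $R\to\infty$ of elements of $\mathcal I$, i.e. the image of $\mathcal I\cap\mathcal L$ in $\mathcal L/h\mathcal L=\tilde E_\kappa(2)$; it is a right ideal of $\tilde E_\kappa(2)$. *)

theory Defs
  imports
    "HOL-Algebra.Algebra"
    "HOL-Algebra.Algebraic_Closure_Type"
    "HOL-Library.Poly_Mapping"
    "HOL-Computational_Algebra.Formal_Laurent_Series"
begin

section \<open>The free \<open>*\<close>-algebra on \<open>\<sigma>\<close> and \<open>\<rho>\<close> over \<open>\<complex>((h))\<close>\<close>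

text \<open>\<open>Sigma'\<close> and \<open>Rho'\<close> are the adjoints. The free algebra is the monoid algebra
  of the words; in class \<open>monoid_add\<close> the sum of two words is their concatenation.\<close>

datatype letter = Sigma | Sigma' | Rho | Rho'

fun letter_star :: "letter \<Rightarrow> letter" where
  "letter_star Sigma = Sigma'"
| "letter_star Sigma' = Sigma"
| "letter_star Rho = Rho'"
| "letter_star Rho' = Rho"

datatype word = Word (letters: "letter list")

instantiation word :: monoid_add
begin
definition zero_word :: word where "0 = Word []"
definition plus_word :: "word \<Rightarrow> word \<Rightarrow> word" where "u + v = Word (letters u @ letters v)"
instance by standard (auto simp: zero_word_def plus_word_def)
end

definition word_star :: "word \<Rightarrow> word" where
  "word_star u = Word (rev (map letter_star (letters u)))"

type_synonym free_alg = "word \<Rightarrow>\<^sub>0 complex fls"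

definition scal :: "complex fls \<Rightarrow> free_alg" where
  "scal c = Poly_Mapping.single 0 c"

definition gen :: "letter \<Rightarrow> free_alg" where
  "gen x = Poly_Mapping.single (Word [x]) 1"

text \<open>Conjugation on \<open>\<complex>((h))\<close> with \<open>h\<^sup>* = h\<close>.\<close>

lift_definition fls_cnj :: "complex fls \<Rightarrow> complex fls" is "\<lambda>f n. cnj (f n)"
  by simp

text \<open>The unique conjugate-linear anti-automorphism extending \<open>letter_star\<close>.\<close>

definition free_star :: "free_alg \<Rightarrow> free_alg" where
  "free_star p = (\<Sum>u\<in>Poly_Mapping.keys p.
     Poly_Mapping.single (word_star u) (fls_cnj (Poly_Mapping.lookup p u)))"

lemma fls_cnj_simps [simp]:
  "fls_cnj 0 = 0" "fls_cnj 1 = 1" "fls_cnj (fls_cnj f) = f"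
  "fls_cnj (f + g) = fls_cnj f + fls_cnj g" "fls_cnj (f - g) = fls_cnj f - fls_cnj g"
  by (auto simp: fls_eq_iff fls_cnj.rep_eq)

lemma fls_subdegree_cnj [simp]: "fls_subdegree (fls_cnj f) = fls_subdegree f"
proof (cases "f = 0")
  case False
  then show ?thesis
    by (intro fls_subdegree_eqI) (auto simp: fls_cnj.rep_eq)
qed simp

lemma fls_cnj_mult [simp]: "fls_cnj (f * g) = fls_cnj f * fls_cnj g"
  by (rule fls_eqI) (simp add: fls_cnj.rep_eq fls_times_nth(2))

lemma letter_star_star [simp]: "letter_star (letter_star x) = x"
  by (cases x) auto

lemma word_star_star [simp]: "word_star (word_star u) = u"
  by (cases u) (simp add: word_star_def rev_map o_def)

lemma word_star_add: "word_star (u + v) = word_star v + word_star u"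
  by (simp add: word_star_def plus_word_def)

lemma lookup_free_star:
  "Poly_Mapping.lookup (free_star p) u = fls_cnj (Poly_Mapping.lookup p (word_star u))"
proof -
  have eq: "word_star v = u \<longleftrightarrow> v = word_star u" for v
    by (metis word_star_star)
  have "Poly_Mapping.lookup (free_star p) u =
      (\<Sum>v\<in>Poly_Mapping.keys p. if v = word_star u then fls_cnj (Poly_Mapping.lookup p v) else 0)"
    unfolding free_star_def lookup_sum lookup_single when_def by (simp add: eq)
  then show ?thesis
    by (auto simp: in_keys_iff)
qed

lemma free_star_add: "free_star (p + q) = free_star p + free_star q"
  by (rule poly_mapping_eqI) (simp add: lookup_free_star lookup_add)

lemma free_star_diff: "free_star (p - q) = free_star p - free_star q"
  by (rule poly_mapping_eqI) (simp add: lookup_free_star lookup_minus)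

lemma free_star_zero [simp]: "free_star 0 = 0"
  by (rule poly_mapping_eqI) (simp add: lookup_free_star)

lemma free_star_star [simp]: "free_star (free_star p) = p"
  by (rule poly_mapping_eqI) (simp add: lookup_free_star)

lemma free_star_single:
  "free_star (Poly_Mapping.single u c) = Poly_Mapping.single (word_star u) (fls_cnj c)"
  by (auto simp: free_star_def)

lemma poly_mapping_sum_single:
  "p = (\<Sum>u\<in>Poly_Mapping.keys p. Poly_Mapping.single u (Poly_Mapping.lookup p u))"
  by (rule poly_mapping_eqI) (simp add: lookup_sum lookup_single when_def in_keys_iff)

lemma free_star_sum: "free_star (sum f S) = (\<Sum>x\<in>S. free_star (f x))"
  by (induction S rule: infinite_finite_induct) (auto simp: free_star_add)

lemma free_star_mult: "free_star (p * q) = free_star q * free_star p"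
proof -
  let ?m = "\<lambda>p u. Poly_Mapping.single u (Poly_Mapping.lookup p u)"
  have "p * q = (\<Sum>u\<in>Poly_Mapping.keys p. \<Sum>v\<in>Poly_Mapping.keys q. ?m p u * ?m q v)"
    by (subst poly_mapping_sum_single[of p], subst poly_mapping_sum_single[of q])
       (simp add: sum_product)
  then have "free_star (p * q) =
      (\<Sum>u\<in>Poly_Mapping.keys p. \<Sum>v\<in>Poly_Mapping.keys q. free_star (?m q v) * free_star (?m p u))"
    by (simp add: free_star_sum free_star_single mult_single word_star_add mult.commute)
  also have "\<dots> = free_star (\<Sum>v\<in>Poly_Mapping.keys q. ?m q v) * free_star (\<Sum>u\<in>Poly_Mapping.keys p. ?m p u)"
    by (simp add: free_star_sum sum_product) (rule sum.swap)
  finally show ?thesis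
    by (simp flip: poly_mapping_sum_single)
qed

abbreviation free_ring :: "free_alg ring" where
  "free_ring \<equiv> ring_of_type_algebra"

lemma ring_free_ring: "ring free_ring"
proof -
  have "\<exists>y. x + y = 0" for x :: free_alg
    using add.right_inverse by blast
  then show ?thesis
    unfolding ring_of_type_algebra_def using add.right_inverse
    by unfold_locales (auto simp: algebra_simps Units_def)
qed


section \<open>Right ideals\<close>

definition right_ideal :: "'a set \<Rightarrow> ('a, 'm) ring_scheme \<Rightarrow> bool" where
  "right_ideal I R \<longleftrightarrow> additive_subgroup I R \<and> (\<forall>x\<in>I. \<forall>r\<in>carrier R. x \<otimes>\<^bsub>R\<^esub> r \<in> I)"

definition right_ideal_gen :: "('a, 'm) ring_scheme \<Rightarrow> 'a set \<Rightarrow> 'a set" where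
  "right_ideal_gen R S = \<Inter>{I. right_ideal I R \<and> S \<subseteq> I}"


section \<open>The quantum group \<open>SU\<^sub>\<mu>(2)\<close> with \<open>\<mu> = exp (h/\<kappa>)\<close>\<close>

definition mu :: "real \<Rightarrow> complex fls" where
  "mu \<kappa> = fps_to_fls (fps_exp (complex_of_real (1 / \<kappa>)))"

text \<open>Differences of the two sides of the defining relations.\<close>

definition SU_relators :: "real \<Rightarrow> free_alg set" where
  "SU_relators \<kappa> = (let \<mu> = scal (mu \<kappa>);
       \<sigma> = gen Sigma; \<sigma>' = gen Sigma'; \<rho> = gen Rho; \<rho>' = gen Rho' in
     {\<rho> * \<rho>' - \<rho>' * \<rho>,
      \<mu> * (\<rho> - \<rho>') * \<sigma> - \<sigma> * (\<rho> - \<rho>'),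
      \<mu> * (\<rho> + \<rho>') * \<sigma> - \<sigma> * (\<rho> + \<rho>'),
      \<sigma> * \<sigma>' + \<mu>^2 * \<rho> * \<rho>' - 1,
      \<sigma>' * \<sigma> + \<rho> * \<rho>' - 1})"

definition SU_ideal :: "real \<Rightarrow> free_alg set" where
  "SU_ideal \<kappa> = Idl\<^bsub>free_ring\<^esub> (SU_relators \<kappa> \<union> free_star ` SU_relators \<kappa>)"

definition SU :: "real \<Rightarrow> free_alg set ring" where
  "SU \<kappa> = free_ring Quot SU_ideal \<kappa>"

definition su :: "real \<Rightarrow> free_alg \<Rightarrow> free_alg set" where
  "su \<kappa> x = SU_ideal \<kappa> +>\<^bsub>free_ring\<^esub> x"

text \<open>The involution on cosets; see \<open>su_star_su\<close> below.\<close>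

definition su_star :: "free_alg set \<Rightarrow> free_alg set" where
  "su_star C = free_star ` C"

lemma ideal_SU_ideal: "ideal (SU_ideal \<kappa>) free_ring"
  unfolding SU_ideal_def
  by (rule ring.genideal_ideal[OF ring_free_ring]) (auto simp: ring_of_type_algebra_def)

lemma ring_SU: "ring (SU \<kappa>)"
  unfolding SU_def by (rule ideal.quotient_is_ring[OF ideal_SU_ideal])

lemma free_star_SU_ideal:
  assumes "x \<in> SU_ideal \<kappa>"
  shows "free_star x \<in> SU_ideal \<kappa>"
proof -
  let ?G = "SU_relators \<kappa> \<union> free_star ` SU_relators \<kappa>"
  let ?K = "{x. free_star x \<in> SU_ideal \<kappa>}"
  interpret J: ideal "SU_ideal \<kappa>" free_ring by (rule ideal_SU_ideal)
  have G: "?G \<subseteq> SU_ideal \<kappa>"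
    unfolding SU_ideal_def
    by (rule ring.genideal_self[OF ring_free_ring]) (auto simp: ring_of_type_algebra_def)
  have minus: "\<ominus>\<^bsub>free_ring\<^esub> y = - y" for y :: free_alg
    by (rule J.minus_equality) (auto simp: ring_of_type_algebra_def)
  have neg: "- y \<in> SU_ideal \<kappa>" if "y \<in> SU_ideal \<kappa>" for y
    using J.I_l_closed[OF that, of "-1"] by (simp add: ring_of_type_algebra_def)
  have add: "y + z \<in> SU_ideal \<kappa>" if "y \<in> SU_ideal \<kappa>" "z \<in> SU_ideal \<kappa>" for y z
    using additive_subgroup.a_closed[OF J.additive_subgroup_axioms that] by (simp add: ring_of_type_algebra_def)
  have zero: "0 \<in> SU_ideal \<kappa>"
    using additive_subgroup.zero_closed[OF J.additive_subgroup_axioms] by (simp add: ring_of_type_algebra_def)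
  have mult: "y * z \<in> SU_ideal \<kappa>" "z * y \<in> SU_ideal \<kappa>" if "y \<in> SU_ideal \<kappa>" for y z
    using J.I_r_closed[OF that, of z] J.I_l_closed[OF that, of z]
    by (auto simp: ring_of_type_algebra_def)
  have star_neg: "free_star (- y) = - free_star y" for y
    using free_star_diff[of 0 y] by simp
  have "ideal ?K free_ring"
  proof (rule idealI[OF ring_free_ring])
    show "subgroup ?K (add_monoid free_ring)"
    proof (unfold_locales, goal_cases)
      case (4 y)
      then show ?case
        using neg[of "free_star y"] minus[of y] by (simp add: star_neg a_inv_def)
    qed (auto simp: ring_of_type_algebra_def free_star_add add zero)
  qed (auto simp: ring_of_type_algebra_def free_star_mult mult)
  moreover have "?G \<subseteq> ?K"
    using G by auto
  ultimately have "SU_ideal \<kappa> \<subseteq> ?K"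
    unfolding SU_ideal_def by (intro ring.genideal_minimal[OF ring_free_ring]) auto
  with assms show ?thesis by auto
qed

lemma su_eq: "su \<kappa> x = {j + x | j. j \<in> SU_ideal \<kappa>}"
  by (auto simp: su_def a_r_coset_def' ring_of_type_algebra_def)

lemma su_star_su: "su_star (su \<kappa> x) = su \<kappa> (free_star x)"
proof -
  have "j + free_star x \<in> free_star ` {j + x | j. j \<in> SU_ideal \<kappa>}" if "j \<in> SU_ideal \<kappa>" for j
    using free_star_SU_ideal[OF that]
    by (intro image_eqI[of _ _ "free_star j + x"]) (auto simp: free_star_add)
  then show ?thesis
    by (auto simp: su_star_def su_eq free_star_add free_star_SU_ideal)
qed

definition R_plus :: "real \<Rightarrow> free_alg set set" where
  "R_plus \<kappa> = (let \<mu> = scal (mu \<kappa>);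
       \<sigma> = gen Sigma; \<sigma>' = gen Sigma'; \<rho> = gen Rho; \<rho>' = gen Rho';
       t = \<mu>^2 * \<sigma> + \<sigma>' - scal ((1 + mu \<kappa> ^ 4) / mu \<kappa>)
     in right_ideal_gen (SU \<kappa>) (su \<kappa> `
     {\<rho>^2,
      \<rho> * (\<sigma> - \<sigma>'),
      \<sigma>^2 + \<mu>^2 * \<sigma>'^2 + (1 + \<mu>^2)^2 * \<rho> * \<rho>' - (1 + \<mu>^2),
      \<rho>'^2,
      \<rho>' * (\<sigma> - \<sigma>'),
      t * \<rho>,
      t * \<rho>',
      t * (\<sigma> - \<sigma>'),
      t * (\<mu>^2 * \<sigma> + \<sigma>' - (1 + \<mu>^2))}))"


section \<open>The contraction\<close>

definition a_elt :: "real \<Rightarrow> free_alg set" where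
  "a_elt \<kappa> = su \<kappa> (scal (1 / 2) *
     (gen Sigma + gen Rho - scal (mu \<kappa>) * gen Rho' + gen Sigma'))"

text \<open>\<open>fls_X\<close> is \<open>h = 1/R\<close>.\<close>

definition w_elt :: "real \<Rightarrow> free_alg set" where
  "w_elt \<kappa> = su \<kappa> (scal (1 / (2 * fls_X)) *
     (- gen Sigma - gen Rho - scal (mu \<kappa>) * gen Rho' + gen Sigma'))"

text \<open>The \<open>\<complex>[[h]]\<close>-subalgebra \<open>\<L>\<close>: scalars are central, so it is the subring generated by
  the four elements together with \<open>\<complex>[[h]] \<cdot> I\<close>.\<close>

definition L_alg :: "real \<Rightarrow> free_alg set set" where
  "L_alg \<kappa> = generate_ring (SU \<kappa>)
     ({a_elt \<kappa>, su_star (a_elt \<kappa>), w_elt \<kappa>, su_star (w_elt \<kappa>)} \<union>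
      range (\<lambda>f. su \<kappa> (scal (fps_to_fls f))))"

definition L_ring :: "real \<Rightarrow> free_alg set ring" where
  "L_ring \<kappa> = (SU \<kappa>)\<lparr>carrier := L_alg \<kappa>\<rparr>"

definition hL :: "real \<Rightarrow> free_alg set set" where
  "hL \<kappa> = (\<lambda>x. su \<kappa> (scal fls_X) \<otimes>\<^bsub>SU \<kappa>\<^esub> x) ` L_alg \<kappa>"

lemma su_closed: "su \<kappa> x \<in> carrier (SU \<kappa>)"
  by (auto simp: SU_def FactRing_def su_def A_RCOSETS_def' ring_of_type_algebra_def)

lemma su_mult: "su \<kappa> x \<otimes>\<^bsub>SU \<kappa>\<^esub> su \<kappa> y = su \<kappa> (x * y)"
  using ideal.rcoset_mult_add[OF ideal_SU_ideal, of x y]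
  by (simp add: SU_def FactRing_def su_def ring_of_type_algebra_def)

lemma carrier_SU: "carrier (SU \<kappa>) = range (su \<kappa>)"
  by (auto simp: SU_def FactRing_def su_def A_RCOSETS_def' ring_of_type_algebra_def)

lemma scal_central: "scal c * x = x * scal c"
proof -
  have "scal c * x = (\<Sum>u\<in>Poly_Mapping.keys x. scal c * Poly_Mapping.single u (Poly_Mapping.lookup x u))"
    by (subst poly_mapping_sum_single[of x]) (simp add: sum_distrib_left)
  also have "\<dots> = (\<Sum>u\<in>Poly_Mapping.keys x. Poly_Mapping.single u (Poly_Mapping.lookup x u) * scal c)"
    by (simp add: scal_def mult_single mult.commute)
  also have "\<dots> = x * scal c"
    by (subst (2) poly_mapping_sum_single[of x]) (simp add: sum_distrib_right)
  finally show ?thesis .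
qed

lemma subring_L_alg: "subring (L_alg \<kappa>) (SU \<kappa>)"
  unfolding L_alg_def
  by (rule ring.generate_ring_is_subring[OF ring_SU])
     (auto simp: a_elt_def w_elt_def su_star_su su_closed)

lemma ring_L_ring: "ring (L_ring \<kappa>)"
  unfolding L_ring_def by (rule ring.subring_is_ring[OF ring_SU subring_L_alg])

lemma ideal_hL: "ideal (hL \<kappa>) (L_ring \<kappa>)"
proof -
  interpret S: ring "SU \<kappa>" by (rule ring_SU)
  interpret L: ring "L_ring \<kappa>" by (rule ring_L_ring)
  note sub = subringE[OF subring_L_alg[of \<kappa>]]
  let ?h = "su \<kappa> (scal fls_X)"
  have h: "?h \<in> L_alg \<kappa>"
    using generate_ring.incl[of "?h"] unfolding L_alg_def
    by (metis (no_types, lifting) UnI2 fps_X_to_fls rangeI generate_ring.incl)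
  have hC: "?h \<in> carrier (SU \<kappa>)" by (rule su_closed)
  have central: "?h \<otimes>\<^bsub>SU \<kappa>\<^esub> x = x \<otimes>\<^bsub>SU \<kappa>\<^esub> ?h" if "x \<in> carrier (SU \<kappa>)" for x
    using that by (auto simp: carrier_SU su_mult scal_central)
  have C: "x \<in> carrier (SU \<kappa>)" if "x \<in> L_alg \<kappa>" for x
    using sub(1) that by auto
  have inv: "\<ominus>\<^bsub>L_ring \<kappa>\<^esub> x = \<ominus>\<^bsub>SU \<kappa>\<^esub> x" if "x \<in> L_alg \<kappa>" for x
    using that sub by (intro L.minus_equality) (auto simp: L_ring_def C S.l_neg)
  show ?thesis
  proof (rule idealI[OF ring_L_ring])
    show "subgroup (hL \<kappa>) (add_monoid (L_ring \<kappa>))"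
    proof (rule group.subgroupI)
      show "group (add_monoid (L_ring \<kappa>))"
        using L.add.group_axioms by simp
      show "hL \<kappa> \<subseteq> carrier (add_monoid (L_ring \<kappa>))"
        using sub(6)[OF h] by (auto simp: hL_def L_ring_def)
      show "hL \<kappa> \<noteq> {}"
        using h by (auto simp: hL_def)
      fix x assume "x \<in> hL \<kappa>"
      then obtain y where y: "y \<in> L_alg \<kappa>" "x = ?h \<otimes>\<^bsub>SU \<kappa>\<^esub> y" by (auto simp: hL_def)
      have "inv\<^bsub>add_monoid (L_ring \<kappa>)\<^esub> x = \<ominus>\<^bsub>SU \<kappa>\<^esub> x"
        using inv[of x] y h sub(6) by (simp add: a_inv_def)
      also have "\<dots> = ?h \<otimes>\<^bsub>SU \<kappa>\<^esub> (\<ominus>\<^bsub>SU \<kappa>\<^esub> y)"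
        using y C hC by (simp add: S.r_minus)
      finally show "inv\<^bsub>add_monoid (L_ring \<kappa>)\<^esub> x \<in> hL \<kappa>"
        using y sub(5) by (auto simp: hL_def)
      fix x' assume "x' \<in> hL \<kappa>"
      then obtain y' where y': "y' \<in> L_alg \<kappa>" "x' = ?h \<otimes>\<^bsub>SU \<kappa>\<^esub> y'" by (auto simp: hL_def)
      have "x \<oplus>\<^bsub>SU \<kappa>\<^esub> x' = ?h \<otimes>\<^bsub>SU \<kappa>\<^esub> (y \<oplus>\<^bsub>SU \<kappa>\<^esub> y')"
        using y y' C hC by (simp add: S.r_distr)
      then show "x \<otimes>\<^bsub>add_monoid (L_ring \<kappa>)\<^esub> x' \<in> hL \<kappa>"
        using y y' sub(7) by (auto simp: hL_def L_ring_def)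
    qed
  next
    fix x r assume "x \<in> hL \<kappa>" and r: "r \<in> carrier (L_ring \<kappa>)"
    then obtain y where y: "y \<in> L_alg \<kappa>" "x = ?h \<otimes>\<^bsub>SU \<kappa>\<^esub> y" by (auto simp: hL_def)
    have r': "r \<in> L_alg \<kappa>" using r by (simp add: L_ring_def)
    have "x \<otimes>\<^bsub>SU \<kappa>\<^esub> r = ?h \<otimes>\<^bsub>SU \<kappa>\<^esub> (y \<otimes>\<^bsub>SU \<kappa>\<^esub> r)"
      using y r' C hC by (simp add: S.m_assoc)
    then show "x \<otimes>\<^bsub>L_ring \<kappa>\<^esub> r \<in> hL \<kappa>"
      using y r' sub(6) by (auto simp: hL_def L_ring_def)
    have "r \<otimes>\<^bsub>SU \<kappa>\<^esub> x = ?h \<otimes>\<^bsub>SU \<kappa>\<^esub> (r \<otimes>\<^bsub>SU \<kappa>\<^esub> y)"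
      using y r' C hC central[of r] by (simp flip: S.m_assoc)
    then show "r \<otimes>\<^bsub>L_ring \<kappa>\<^esub> x \<in> hL \<kappa>"
      using y r' sub(6) by (auto simp: hL_def L_ring_def)
  qed
qed

definition E_tilde :: "real \<Rightarrow> free_alg set set ring" where
  "E_tilde \<kappa> = L_ring \<kappa> Quot hL \<kappa>"

definition lim_map :: "real \<Rightarrow> free_alg set \<Rightarrow> free_alg set set" where
  "lim_map \<kappa> x = hL \<kappa> +>\<^bsub>L_ring \<kappa>\<^esub> x"

text \<open>The multiple \<open>c I\<close> of the unit of \<open>E_tilde \<kappa>\<close>, for \<open>c \<in> \<complex>\<close>.\<close>

definition E_scal :: "real \<Rightarrow> complex \<Rightarrow> free_alg set set" where
  "E_scal \<kappa> c = lim_map \<kappa> (su \<kappa> (scal (fls_const c)))"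

definition contraction :: "real \<Rightarrow> free_alg set set \<Rightarrow> free_alg set set set" where
  "contraction \<kappa> I = lim_map \<kappa> ` (I \<inter> L_alg \<kappa>)"

end

theory Submission
  imports Defs
begin

text \<open>
  Put \<open>T = \<sigma> + \<sigma>\<^sup>*\<close>, \<open>D = \<rho> - \<rho>\<^sup>*\<close>, \<open>N = (\<sigma> - \<sigma>\<^sup>*) / h\<close> and \<open>S = (\<rho> + \<rho>\<^sup>*) / h\<close>. These four elements
  generate \<open>\<L>\<close> over \<open>\<complex>[[h]]\<close> (\<open>TDSN_in_L_rep\<close>, \<open>L_rep_induct\<close>), and modulo \<open>h\<close> the relations become
  transparent (\<open>hL_rep_rels\<close>): \<open>T\<close>, \<open>D\<close>, \<open>S\<close> commute, \<open>T\<^sup>2 - D\<^sup>2 = 4\<close>, and \<open>[N, D] = T D / \<kappa>\<close>,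
  \<open>[N, S] = T S / \<kappa>\<close>, \<open>[N, T] = D\<^sup>2 / \<kappa>\<close>. The limit of \<open>a\<close> is \<open>(T + D) / 2\<close>, that of \<open>w\<close> is
  \<open>(D / \<kappa> - 2 N - 2 S) / 4\<close>. In these terms the seven generators of the claim generate the same right
  ideal \<open>J\<close> as \<open>T - 2\<close>, \<open>D S\<close>, \<open>D N\<close>, \<open>S N\<close>, \<open>S\<^sup>2 + N\<^sup>2 - 2 N / \<kappa>\<close> (\<open>contraction_gens_iff\<close>), and a short
  computation shows that \<open>1\<close>, \<open>D\<close>, \<open>S\<close>, \<open>N\<close>, \<open>S\<^sup>2\<close> span the contracted algebra modulo \<open>J\<close>
  (\<open>L_rep_subset_span\<close>).

  On the other side, the quotient of \<open>SU\<^sub>\<mu>(2)\<close> by \<open>R\<^sub>+\<close> has dimension five over \<open>\<complex>((h))\<close>. It is realised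
  by an explicit right module with a vector \<open>v0\<close> whose annihilator is exactly \<open>R\<^sub>+\<close> (\<open>R_plus_rep_iff\<close>):
  the generators of \<open>R\<^sub>+\<close> kill \<open>v0\<close>, modulo \<open>R\<^sub>+\<close> every element is a combination of \<open>1\<close>, \<open>\<sigma>\<close>, \<open>\<sigma>\<^sup>*\<close>,
  \<open>\<rho>\<close>, \<open>\<rho>\<^sup>*\<close> (\<open>letter_span_UNIV\<close>), and these five move \<open>v0\<close> to linearly independent vectors
  (\<open>affine_kernel\<close>).

  The coordinates are chosen so that \<open>v0 \<L> = \<complex>[[h]]\<^sup>5\<close> (\<open>act_int_vec\<close>, \<open>int_vec_image\<close>). Hence the
  contraction of \<open>R\<^sub>+\<close> consists of the classes of those \<open>x\<close> in \<open>\<L>\<close> with \<open>v0 x \<in> h \<complex>[[h]]\<^sup>5\<close>: if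
  \<open>v0 x = h v0 y\<close> with \<open>y\<close> in \<open>\<L>\<close>, then \<open>x - h y\<close> lies in \<open>R\<^sub>+\<close> and has the same limit as \<open>x\<close>
  (\<open>contraction_R_plus\<close>). This right ideal contains \<open>J\<close> (\<open>simple_gens_lim_ker\<close>), and it is not larger,
  because \<open>1\<close>, \<open>D\<close>, \<open>S\<close>, \<open>N\<close>, \<open>S\<^sup>2\<close> move \<open>v0\<close> to vectors that are independent modulo \<open>h\<close>
  (\<open>lin_comb_lim_ker\<close>, \<open>lim_ker_minimal\<close>).

  All computations take place in the free algebra. A subset of \<open>SU\<^sub>\<mu>(2)\<close> is represented by its preimage
  there, and identities between noncommutative polynomials are checked coefficientwise.
\<close>

section \<open>Scalars and the involution\<close>

lemma scal_add: "scal (c + d) = scal c + scal d" by (simp add: scal_def single_add)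
lemma scal_uminus: "scal (- c) = - scal c" by (simp add: scal_def single_uminus)
lemma scal_mult: "scal c * scal d = scal (c * d)" by (simp add: scal_def mult_single)
lemma scal_0 [simp]: "scal 0 = 0" by (simp add: scal_def)
lemma scal_1 [simp]: "scal 1 = 1" by (simp add: scal_def)
lemma scal_power: "scal c ^ n = scal (c ^ n)" by (induction n) (simp_all add: scal_mult)
lemma scal_numeral: "scal (numeral n) = numeral n"
  by (simp add: scal_def)
lemma scal_mult_left: "scal c * (scal d * x) = scal (c * d) * x"
  by (simp add: scal_mult flip: mult.assoc)
lemma lookup_scal_mult:
  "Poly_Mapping.lookup (scal c * x) u = c * Poly_Mapping.lookup x u"
proof -
  have "scal c * x = (\<Sum>v\<in>Poly_Mapping.keys x. Poly_Mapping.single v (c * Poly_Mapping.lookup x v))"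
    by (subst poly_mapping_sum_single[of x]) (simp add: sum_distrib_left scal_def mult_single)
  then show ?thesis
    by (simp add: lookup_sum lookup_single when_def in_keys_iff)
qed

text \<open>The formal parameter \<open>h\<close>. A constant of its own keeps the simplifier from turning products with
  \<open>fls_X\<close> into shifts of coefficients.\<close>

definition hp :: "complex fls" where "hp = fls_X"

lemma hp_nonzero [simp]: "hp \<noteq> 0"
  by (simp add: hp_def)

lemma scal_gen: "gen x * scal c = scal c * gen x" "gen x * (scal c * y) = scal c * (gen x * y)"
  using scal_central[of c "gen x"] by (simp_all flip: mult.assoc)

lemma free_star_scal: "free_star (scal c) = scal (fls_cnj c)"
  by (simp add: scal_def free_star_single word_star_def zero_word_def)
lemma free_star_gen: "free_star (gen x) = gen (letter_star x)"
  by (simp add: gen_def free_star_single word_star_def)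
lemma free_star_one: "free_star 1 = 1"
  using free_star_scal[of 1] by simp
lemma free_star_power: "free_star (x ^ n) = free_star x ^ n"
  by (induction n) (simp_all add: free_star_one free_star_mult power_commutes)

lemma fls_cnj_fps_to_fls: "fls_cnj (fps_to_fls f) = fps_to_fls (Abs_fps (\<lambda>n. cnj (fps_nth f n)))"
  by (rule fls_eqI) (simp add: fls_cnj.rep_eq)

lemma fls_cnj_mu [simp]: "fls_cnj (mu \<kappa>) = mu \<kappa>"
  unfolding mu_def fls_cnj_fps_to_fls by (auto simp: fps_eq_iff)

lemma fls_cnj_power [simp]: "fls_cnj (x ^ n) = fls_cnj x ^ n"
  by (induction n) simp_all

lemma fls_cnj_hp [simp]: "fls_cnj hp = hp"
  unfolding hp_def by (rule fls_eqI) (simp add: fls_cnj.rep_eq)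

lemma fls_cnj_numeral [simp]: "fls_cnj (numeral n) = numeral n"
  by (rule fls_eqI) (simp add: fls_cnj.rep_eq flip: fls_const_numeral)

lemma fls_cnj_0_iff [simp]: "fls_cnj x = 0 \<longleftrightarrow> x = 0"
  by (metis fls_cnj_simps(1,3))

lemma fls_cnj_divide [simp]: "fls_cnj (x / y) = fls_cnj x / fls_cnj y"
proof (cases "y = 0")
  case False
  then have "fls_cnj (x / y) * fls_cnj y = fls_cnj x" by (simp flip: fls_cnj_mult)
  with False show ?thesis by (simp add: field_simps)
qed simp

lemma mu_nonzero: "mu \<kappa> \<noteq> 0"
  unfolding mu_def by (simp add: fps_eq_iff exI[of _ 0])

section \<open>A five-dimensional right module\<close>

text \<open>Coordinates of the module. It is the direct sum of a trivial module (coordinate \<open>IE\<close>) and of a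
  four-dimensional one, which is generated by the basis vector of \<open>IW\<close>: \<open>D\<close> and \<open>S\<close> carry it to those of
  \<open>ID\<close> and \<open>IS\<close>, and these to multiples of that of \<open>IZ\<close>. The letters act from the right.\<close>

datatype idx = IW | ID | IS | IE | IZ

type_synonym 'a vec5 = "idx \<Rightarrow> 'a"

fun letter_act :: "'a::field \<Rightarrow> 'a \<Rightarrow> letter \<Rightarrow> 'a vec5 \<Rightarrow> 'a vec5" where
  "letter_act m h Sigma u = (\<lambda>i. case i of IW \<Rightarrow> m * u IW | IZ \<Rightarrow> u IZ / m - h^2 * m / 2 * u IW | _ \<Rightarrow> u i)"
| "letter_act m h Sigma' u = (\<lambda>i. case i of IW \<Rightarrow> u IW / m | IZ \<Rightarrow> m * u IZ - h^2 * m / 2 * u IW | _ \<Rightarrow> u i)"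
| "letter_act m h Rho u = (\<lambda>i. case i of ID \<Rightarrow> u IW / 2 | IS \<Rightarrow> h / 2 * u IW
     | IZ \<Rightarrow> h * u IS - h^2 * u ID | _ \<Rightarrow> 0)"
| "letter_act m h Rho' u = (\<lambda>i. case i of ID \<Rightarrow> - u IW / 2 | IS \<Rightarrow> h / 2 * u IW
     | IZ \<Rightarrow> h * u IS + h^2 * u ID | _ \<Rightarrow> 0)"

lemma letter_act_lin:
  "letter_act m h x (\<lambda>i. c * u i + u' i) j = c * letter_act m h x u j + letter_act m h x u' j"
  by (cases x; cases j; simp add: algebra_simps add_divide_distrib diff_divide_distrib)

lemma letter_act_sum:
  "letter_act m h x (\<lambda>i. \<Sum>k\<in>K. c k * f k i) j = (\<Sum>k\<in>K. c k * letter_act m h x (f k) j)"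
proof (induction K rule: infinite_finite_induct)
  case (insert k K)
  then show ?case
    using letter_act_lin[of m h x "c k" "f k" "\<lambda>i. \<Sum>k\<in>K. c k * f k i" j] by simp
qed (cases x; cases j; simp)+

text \<open>The letters satisfy the relations of \<open>SU\<^sub>m(2)\<close> for an arbitrary invertible parameter \<open>m\<close>. As the
  action is a right action, the leftmost letter of a monomial is applied first.\<close>

lemma relators_act:
  fixes m h :: "'a::field_char_0" and u :: "'a vec5"
  assumes "m \<noteq> 0"
  defines "L \<equiv> letter_act m h"
  shows "L Rho' (L Rho u) i = L Rho (L Rho' u) i"
    "m * L Sigma (L Rho u) i = L Rho (L Sigma u) i"
    "m * L Sigma (L Rho' u) i = L Rho' (L Sigma u) i"
    "L Sigma' (L Rho u) i = m * L Rho (L Sigma' u) i"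
    "L Sigma' (L Rho' u) i = m * L Rho' (L Sigma' u) i"
    "L Sigma' (L Sigma u) i + m^2 * L Rho' (L Rho u) i = u i"
    "L Sigma (L Sigma' u) i + L Rho' (L Rho u) i = u i"
  using assms(1) unfolding L_def
  by (cases i; simp add: field_simps power2_eq_square)+

text \<open>The action of a word, one letter after the other from the left.\<close>

definition word_act :: "'a::field \<Rightarrow> 'a \<Rightarrow> word \<Rightarrow> 'a vec5 \<Rightarrow> 'a vec5" where
  "word_act m h w u = fold (letter_act m h) (letters w) u"

lemma word_act_zero: "word_act m h 0 u = u"
  by (simp add: word_act_def zero_word_def)

lemma word_act_plus: "word_act m h (v + w) u = word_act m h w (word_act m h v u)"
  by (simp add: word_act_def plus_word_def)

lemma word_act_sum:
  "word_act m h w (\<lambda>i. \<Sum>k\<in>K. c k * f k i) = (\<lambda>j. \<Sum>k\<in>K. c k * word_act m h w (f k) j)"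
proof -
  have "fold (letter_act m h) xs (\<lambda>i. \<Sum>k\<in>K. c k * f k i)
      = (\<lambda>j. \<Sum>k\<in>K. c k * fold (letter_act m h) xs (f k) j)" for xs
    by (induction xs arbitrary: f) (simp_all add: letter_act_sum[abs_def])
  then show ?thesis by (simp add: word_act_def)
qed

text \<open>The linear extension of the action to the free algebra, with \<open>m = \<mu>\<close>.\<close>

definition act :: "real \<Rightarrow> free_alg \<Rightarrow> complex fls vec5 \<Rightarrow> complex fls vec5" where
  "act \<kappa> p u i = (\<Sum>w\<in>Poly_Mapping.keys p. Poly_Mapping.lookup p w * word_act (mu \<kappa>) hp w u i)"

lemma act_superset:
  assumes "finite K" "Poly_Mapping.keys p \<subseteq> K"
  shows "act \<kappa> p u i = (\<Sum>w\<in>K. Poly_Mapping.lookup p w * word_act (mu \<kappa>) hp w u i)"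
  unfolding act_def using assms by (intro sum.mono_neutral_left) (auto simp: in_keys_iff)

lemma act_add: "act \<kappa> (p + q) u i = act \<kappa> p u i + act \<kappa> q u i"
proof -
  let ?K = "Poly_Mapping.keys p \<union> Poly_Mapping.keys q"
  have "Poly_Mapping.keys (p + q) \<subseteq> ?K" by (rule Poly_Mapping.keys_add)
  then show ?thesis
    by (simp add: act_superset[of ?K] lookup_add distrib_right sum.distrib)
qed

lemma act_single: "act \<kappa> (Poly_Mapping.single w c) u i = c * word_act (mu \<kappa>) hp w u i"
  by (cases "c = 0") (simp_all add: act_def)

lemma act_zero: "act \<kappa> 0 u i = 0"
  by (simp add: act_def)

lemma act_sum: "act \<kappa> (sum f K) u i = (\<Sum>k\<in>K. act \<kappa> (f k) u i)"
  by (induction K rule: infinite_finite_induct) (simp_all add: act_zero act_add)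

lemma act_scal_mult: "act \<kappa> (scal c * p) u i = c * act \<kappa> p u i"
proof -
  have "Poly_Mapping.keys (scal c * p) \<subseteq> Poly_Mapping.keys p"
    by (auto simp: in_keys_iff lookup_scal_mult)
  then show ?thesis
    by (simp add: act_superset[of "Poly_Mapping.keys p"] lookup_scal_mult sum_distrib_left mult.assoc)
qed

lemma act_uminus: "act \<kappa> (- p) u i = - act \<kappa> p u i"
  using act_add[of \<kappa> p "- p" u i] by (simp add: act_zero eq_neg_iff_add_eq_0 add.commute)

lemma act_diff: "act \<kappa> (p - q) u i = act \<kappa> p u i - act \<kappa> q u i"
  using act_add[of \<kappa> p "- q" u i] by (simp add: act_uminus)

lemma act_one: "act \<kappa> 1 u i = u i"
  by (simp add: act_single word_act_zero flip: single_one)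

lemma act_scal: "act \<kappa> (scal c) u i = c * u i"
  by (simp add: scal_def act_single word_act_zero)

lemma act_gen: "act \<kappa> (gen x) u i = letter_act (mu \<kappa>) hp x u i"
  by (simp add: gen_def act_single word_act_def)

lemma act_mult: "act \<kappa> (p * q) u i = act \<kappa> q (act \<kappa> p u) i"
proof -
  let ?m = "\<lambda>p u. Poly_Mapping.single u (Poly_Mapping.lookup p u)"
  let ?a = "word_act (mu \<kappa>) hp"
  have "p * q = (\<Sum>w\<in>Poly_Mapping.keys q. \<Sum>v\<in>Poly_Mapping.keys p. ?m p v * ?m q w)"
    by (subst poly_mapping_sum_single[of p], subst poly_mapping_sum_single[of q])
       (simp add: sum_product sum.swap[of _ "Poly_Mapping.keys q"])
  then have "act \<kappa> (p * q) u i = (\<Sum>w\<in>Poly_Mapping.keys q. \<Sum>v\<in>Poly_Mapping.keys p.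
      Poly_Mapping.lookup q w * (Poly_Mapping.lookup p v * ?a w (?a v u) i))"
    by (simp add: act_sum mult_single act_single word_act_plus algebra_simps)
  also have "\<dots> = (\<Sum>w\<in>Poly_Mapping.keys q. Poly_Mapping.lookup q w *
      ?a w (\<lambda>j. \<Sum>v\<in>Poly_Mapping.keys p. Poly_Mapping.lookup p v * ?a v u j) i)"
    by (simp add: word_act_sum sum_distrib_left)
  also have "\<dots> = act \<kappa> q (act \<kappa> p u) i"
    by (simp add: act_def[abs_def])
  finally show ?thesis .
qed

lemma act_zero_vec: "act \<kappa> p (\<lambda>i. 0) i = 0"
proof -
  have "word_act (mu \<kappa>) hp w (\<lambda>i. 0) = (\<lambda>i. 0)" for w
    using word_act_sum[of "mu \<kappa>" hp w "\<lambda>_. 0" "\<lambda>_ _. 0" "{}"] by simp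
  then show ?thesis by (simp add: act_def)
qed

lemma act_vec_scale: "act \<kappa> p (\<lambda>i. c * u i) i = c * act \<kappa> p u i"
proof -
  have "act \<kappa> p (act \<kappa> (scal c) u) i = act \<kappa> (scal c * p) u i"
    by (simp add: act_mult)
  then show ?thesis by (simp add: act_scal_mult act_scal[abs_def])
qed

lemma act_gen_mult: "act \<kappa> (gen x * q) u i = act \<kappa> q (letter_act (mu \<kappa>) hp x u) i"
  by (simp add: act_mult act_gen[abs_def])

lemma act_mult_eq_0:
  assumes "\<And>i. act \<kappa> x u i = 0"
  shows "act \<kappa> (x * y) u i = 0"
proof -
  have "act \<kappa> x u = (\<lambda>_. 0)" using assms by (rule ext)
  then show ?thesis by (simp add: act_mult act_zero_vec)
qed

lemmas act_simps = act_zero act_add act_diff act_uminus act_one act_scal act_scal_mult act_gen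
  act_mult[abs_def] act_gen[abs_def]

text \<open>The elements \<open>T\<close>, \<open>D\<close>, \<open>S\<close>, \<open>N\<close>.\<close>

definition TT :: free_alg where "TT = gen Sigma + gen Sigma'"
definition DD :: free_alg where "DD = gen Rho - gen Rho'"
definition SS :: free_alg where "SS = scal (1 / hp) * (gen Rho + gen Rho')"
definition NN :: free_alg where "NN = scal (1 / hp) * (gen Sigma - gen Sigma')"

text \<open>The action of \<open>T\<close>, \<open>D\<close>, \<open>S\<close>, \<open>N\<close>. No negative power of \<open>h\<close> survives, since \<open>m - 1 / m\<close> is
  divisible by \<open>h\<close> for \<open>m = \<mu>\<close>.\<close>

lemma letter_act_comb:
  fixes m h :: "'a::field_char_0"
  assumes "m \<noteq> 0" "h \<noteq> 0"
  shows "letter_act m h Sigma u i + letter_act m h Sigma' u i = (case i of IW \<Rightarrow> (m + 1 / m) * u IW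
     | IZ \<Rightarrow> (m + 1 / m) * u IZ - h^2 * m * u IW | _ \<Rightarrow> 2 * u i)"
   "letter_act m h Rho u i - letter_act m h Rho' u i = (case i of ID \<Rightarrow> u IW | IZ \<Rightarrow> - 2 * h^2 * u ID | _ \<Rightarrow> 0)"
   "1 / h * (letter_act m h Rho u i + letter_act m h Rho' u i) = (case i of IS \<Rightarrow> u IW | IZ \<Rightarrow> 2 * u IS | _ \<Rightarrow> 0)"
   "1 / h * (letter_act m h Sigma u i - letter_act m h Sigma' u i) = (case i of IW \<Rightarrow> (m - 1 / m) / h * u IW
     | IZ \<Rightarrow> - ((m - 1 / m) / h) * u IZ | _ \<Rightarrow> 0)"
  using assms by (cases i; simp add: field_simps power2_eq_square)+

lemmas act_TT = letter_act_comb(1)[OF mu_nonzero hp_nonzero, folded act_gen, folded act_add, folded TT_def]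
lemmas act_DD = letter_act_comb(2)[OF mu_nonzero hp_nonzero, folded act_gen, folded act_diff, folded DD_def]
lemmas act_SS = letter_act_comb(3)[OF mu_nonzero hp_nonzero, folded act_gen, folded act_add, folded act_scal_mult, folded SS_def]
lemmas act_NN = letter_act_comb(4)[OF mu_nonzero hp_nonzero, folded act_gen, folded act_diff, folded act_scal_mult, folded NN_def]

declare letter_act.simps [simp del]

section \<open>The relations of the quantum group\<close>

lemma SU_ideal_add: "x \<in> SU_ideal \<kappa> \<Longrightarrow> y \<in> SU_ideal \<kappa> \<Longrightarrow> x + y \<in> SU_ideal \<kappa>"
  using additive_subgroup.a_closed[OF ideal.axioms(1)[OF ideal_SU_ideal]]
  by (force simp: ring_of_type_algebra_def)

lemma SU_ideal_mult:
  assumes "x \<in> SU_ideal \<kappa>"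
  shows "x * y \<in> SU_ideal \<kappa>" "y * x \<in> SU_ideal \<kappa>"
  using ideal.I_r_closed[OF ideal_SU_ideal assms, of y] ideal.I_l_closed[OF ideal_SU_ideal assms, of y]
  by (auto simp: ring_of_type_algebra_def)

lemma SU_ideal_0: "0 \<in> SU_ideal \<kappa>"
  using additive_subgroup.zero_closed[OF ideal.axioms(1)[OF ideal_SU_ideal, of \<kappa>]]
  by (simp add: ring_of_type_algebra_def)

lemma SU_ideal_uminus: "x \<in> SU_ideal \<kappa> \<Longrightarrow> - x \<in> SU_ideal \<kappa>"
  using SU_ideal_mult(2)[of x \<kappa> "-1"] by simp

lemma SU_ideal_diff: "x \<in> SU_ideal \<kappa> \<Longrightarrow> y \<in> SU_ideal \<kappa> \<Longrightarrow> x - y \<in> SU_ideal \<kappa>"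
  using SU_ideal_add[of x \<kappa> "- y"] SU_ideal_uminus[of y \<kappa>] by simp

lemmas SU_ideal_closed = SU_ideal_add SU_ideal_mult SU_ideal_diff SU_ideal_uminus

lemma SU_ideal_relators: "x \<in> SU_relators \<kappa> \<Longrightarrow> x \<in> SU_ideal \<kappa>"
  using ring.genideal_self[OF ring_free_ring, of "SU_relators \<kappa> \<union> free_star ` SU_relators \<kappa>"]
  unfolding SU_ideal_def by (auto simp: ring_of_type_algebra_def)

text \<open>The action factors through \<open>SU\<^sub>\<mu>(2)\<close>.\<close>

lemma act_SU_ideal:
  assumes "x \<in> SU_ideal \<kappa>"
  shows "act \<kappa> x u i = 0"
proof -
  let ?K = "{x. \<forall>u i. act \<kappa> x u i = 0}"
  have rel: "x \<in> ?K" if "x \<in> SU_relators \<kappa> \<union> free_star ` SU_relators \<kappa>" for x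
    using that
    apply (simp add: SU_relators_def Let_def free_star_add free_star_diff free_star_mult free_star_gen
        free_star_scal free_star_one free_star_power ring_distribs mult.assoc scal_gen scal_power)
    using relators_act[OF mu_nonzero, of \<kappa> hp]
    by (auto simp: act_zero act_add act_diff act_uminus act_one act_scal act_scal_mult act_gen act_gen_mult)
  have "ideal ?K free_ring"
  proof (rule idealI[OF ring_free_ring])
    show "subgroup ?K (add_monoid free_ring)"
    proof (unfold_locales, goal_cases)
      case (4 y)
      have "\<ominus>\<^bsub>free_ring\<^esub> y = - y"
        using ring_free_ring abelian_group.minus_equality[of free_ring "-y" y]
        by (auto simp: ring_of_type_algebra_def ring_def)
      with 4 show ?case by (simp add: a_inv_def act_simps)
    qed (auto simp: ring_of_type_algebra_def act_simps)
  qed (auto simp: ring_of_type_algebra_def act_mult_eq_0, simp add: act_mult)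
  then show ?thesis
    using ring.genideal_minimal[OF ring_free_ring, of ?K] rel assms
    unfolding SU_ideal_def by blast
qed

lemma su_eq_iff: "su \<kappa> x = su \<kappa> y \<longleftrightarrow> x - y \<in> SU_ideal \<kappa>"
proof
  assume "su \<kappa> x = su \<kappa> y"
  moreover have "x \<in> su \<kappa> x" using SU_ideal_0[of \<kappa>] by (force simp: su_eq)
  ultimately show "x - y \<in> SU_ideal \<kappa>" by (auto simp: su_eq)
next
  assume *: "x - y \<in> SU_ideal \<kappa>"
  have "\<exists>j'. j + x = j' + y \<and> j' \<in> SU_ideal \<kappa>" if "j \<in> SU_ideal \<kappa>" for j
    using SU_ideal_add[OF that *] by (intro exI[of _ "j + (x - y)"]) auto
  moreover have "\<exists>j'. j + y = j' + x \<and> j' \<in> SU_ideal \<kappa>" if "j \<in> SU_ideal \<kappa>" for j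
    using SU_ideal_diff[OF that *] by (intro exI[of _ "j - (x - y)"]) auto
  ultimately show "su \<kappa> x = su \<kappa> y" by (auto simp: su_eq)
qed

lemma su_add: "su \<kappa> x \<oplus>\<^bsub>SU \<kappa>\<^esub> su \<kappa> y = su \<kappa> (x + y)"
  using abelian_subgroup.a_rcos_sum[OF abelian_subgroupI3[OF ideal.axioms(1)[OF ideal_SU_ideal] ring.is_abelian_group[OF ring_free_ring]], of x y]
  by (simp add: SU_def FactRing_def su_def ring_of_type_algebra_def)

lemma su_one: "\<one>\<^bsub>SU \<kappa>\<^esub> = su \<kappa> 1"
  by (simp add: SU_def FactRing_def su_def ring_of_type_algebra_def)

lemma su_zero: "\<zero>\<^bsub>SU \<kappa>\<^esub> = su \<kappa> 0"
  by (simp add: SU_def FactRing_def su_eq)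

lemma su_uminus: "\<ominus>\<^bsub>SU \<kappa>\<^esub> su \<kappa> x = su \<kappa> (- x)"
  by (rule abelian_group.minus_equality[OF ring.is_abelian_group[OF ring_SU]])
     (simp_all add: su_closed su_add su_zero)

lemma SU_rels:
  shows "gen Rho * gen Rho' - gen Rho' * gen Rho \<in> SU_ideal \<kappa>"
    and "scal (mu \<kappa>) * ((gen Rho - gen Rho') * gen Sigma) - gen Sigma * (gen Rho - gen Rho') \<in> SU_ideal \<kappa>"
    and "scal (mu \<kappa>) * ((gen Rho + gen Rho') * gen Sigma) - gen Sigma * (gen Rho + gen Rho') \<in> SU_ideal \<kappa>"
    and "gen Sigma * gen Sigma' + scal (mu \<kappa> ^ 2) * (gen Rho * gen Rho') - 1 \<in> SU_ideal \<kappa>"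
    and "gen Sigma' * gen Sigma + gen Rho * gen Rho' - 1 \<in> SU_ideal \<kappa>"
  by (rule SU_ideal_relators, simp add: SU_relators_def Let_def scal_power mult.assoc)+

text \<open>The adjoints of the second and the third relation.\<close>

lemma SU_rels':
  shows "scal (mu \<kappa>) * (gen Sigma' * (gen Rho - gen Rho')) - (gen Rho - gen Rho') * gen Sigma' \<in> SU_ideal \<kappa>"
      (is "?x \<in> _")
    and "scal (mu \<kappa>) * (gen Sigma' * (gen Rho + gen Rho')) - (gen Rho + gen Rho') * gen Sigma' \<in> SU_ideal \<kappa>"
      (is "?y \<in> _")
proof -
  note s = free_star_add free_star_diff free_star_mult free_star_gen free_star_scal scal_gen
  have "?x = - free_star (scal (mu \<kappa>) * ((gen Rho - gen Rho') * gen Sigma) - gen Sigma * (gen Rho - gen Rho'))"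
    by (simp add: s algebra_simps)
  then show "?x \<in> SU_ideal \<kappa>"
    using SU_ideal_uminus[OF free_star_SU_ideal[OF SU_rels(2)[of \<kappa>]]] by (simp only:)
  have "?y = free_star (scal (mu \<kappa>) * ((gen Rho + gen Rho') * gen Sigma) - gen Sigma * (gen Rho + gen Rho'))"
    by (simp add: s algebra_simps)
  then show "?y \<in> SU_ideal \<kappa>"
    using free_star_SU_ideal[OF SU_rels(3)[of \<kappa>]] by (simp only:)
qed

lemma gen_TDSN:
  "gen Sigma = scal (1/2) * TT + scal (hp/2) * NN"
  "gen Sigma' = scal (1/2) * TT - scal (hp/2) * NN"
  "gen Rho = scal (1/2) * DD + scal (hp/2) * SS"
  "gen Rho' = scal (hp/2) * SS - scal (1/2) * DD"
  by (rule poly_mapping_eqI; simp add: TT_def DD_def SS_def NN_def lookup_add lookup_minus lookup_scal_mult;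
      simp add: ring_distribs add_divide_distrib diff_divide_distrib)+

lemma scal_TDSN:
  "TT * scal c = scal c * TT" "TT * (scal c * y) = scal c * (TT * y)"
  "DD * scal c = scal c * DD" "DD * (scal c * y) = scal c * (DD * y)"
  "SS * scal c = scal c * SS" "SS * (scal c * y) = scal c * (SS * y)"
  "NN * scal c = scal c * NN" "NN * (scal c * y) = scal c * (NN * y)"
  using scal_central[of c TT] scal_central[of c DD] scal_central[of c SS] scal_central[of c NN]
  by (simp_all flip: mult.assoc)

lemma lookup_scal: "Poly_Mapping.lookup (scal c) u = c * Poly_Mapping.lookup 1 u"
  using lookup_scal_mult[of c 1 u] by simp

text \<open>Rules for comparing two noncommutative polynomials in the letters, or in \<open>T\<close>, \<open>D\<close>, \<open>S\<close>, \<open>N\<close>: after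
  expansion, the coefficient at a word is a linear combination of the coefficients of the monomials, and
  an identity of polynomials becomes an identity over the field of scalars.\<close>

lemmas nc_simps = scal_TDSN scal_gen ring_distribs mult.assoc scal_mult scal_mult_left
  lookup_add lookup_minus lookup_uminus lookup_scal_mult lookup_scal

lemma mu_plus_1: "1 + mu \<kappa> \<noteq> 0"
proof
  assume "1 + mu \<kappa> = 0"
  then have "fls_nth (1 + mu \<kappa>) 0 = 0" by simp
  then show False by (simp add: mu_def)
qed

text \<open>The defining relations in terms of \<open>T\<close>, \<open>D\<close>, \<open>S\<close>, \<open>N\<close>. Every relation is divided by the power of \<open>h\<close> that
  it contains, so that the coefficients are power series and can be reduced modulo \<open>h\<close>.\<close>

lemma TDSN_rels:
  fixes \<kappa> :: real
  defines "m \<equiv> mu \<kappa>" and "h \<equiv> hp :: complex fls"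
  shows "DD * SS - SS * DD \<in> SU_ideal \<kappa>" (is ?g1)
    and "DD * TT - TT * DD - scal h * (NN * DD - scal m * (DD * NN) - scal ((m - 1) / h) * (DD * TT)) \<in> SU_ideal \<kappa>" (is ?g2)
    and "SS * TT - TT * SS - scal h * (NN * SS - scal m * (SS * NN) - scal ((m - 1) / h) * (SS * TT)) \<in> SU_ideal \<kappa>" (is ?g3)
    and "NN * DD - DD * NN - scal ((m - 1) / h / (1 + m)) * (DD * TT + TT * DD) \<in> SU_ideal \<kappa>" (is ?g4)
    and "NN * SS - SS * NN - scal ((m - 1) / h / (1 + m)) * (SS * TT + TT * SS) \<in> SU_ideal \<kappa>" (is ?g5)
    and "NN * TT - TT * NN - scal ((m - 1) / h * (1 + m) / 2) * (DD * DD - scal (h^2) * (SS * SS)) \<in> SU_ideal \<kappa>" (is ?g6)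
    and "TT * TT - scal (h^2) * (NN * NN) - scal ((1 + m^2) / 2) * (DD * DD - scal (h^2) * (SS * SS)) - scal 4 \<in> SU_ideal \<kappa>" (is ?g7)
proof -
  have m: "m \<noteq> 0" "1 + m \<noteq> 0" and h: "h \<noteq> 0"
    using mu_nonzero mu_plus_1 by (simp_all add: m_def h_def)
  let ?\<sigma> = "scal (1/2) * TT + scal (h/2) * NN" and ?\<sigma>' = "scal (1/2) * TT - scal (h/2) * NN"
  let ?\<rho> = "scal (1/2) * DD + scal (h/2) * SS" and ?\<rho>' = "scal (h/2) * SS - scal (1/2) * DD"
  note r = SU_rels[of \<kappa>, folded m_def, unfolded gen_TDSN, folded h_def]
  note r' = SU_rels'[of \<kappa>, folded m_def, unfolded gen_TDSN, folded h_def]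
  note I = SU_ideal_closed
  have "DD * SS - SS * DD = scal (2 / h) * (?\<rho> * ?\<rho>' - ?\<rho>' * ?\<rho>)"
    by (rule poly_mapping_eqI; simp add: nc_simps; use h in \<open>simp add: field_simps\<close>)
  then show ?g1 using I(2-3)[OF r(1)] by simp
  \<comment> \<open>The commutation relations of \<open>D\<close> and \<open>S\<close> with \<open>\<sigma>\<close> and \<open>\<sigma>\<^sup>*\<close>. One of them gives the commutator with \<open>T\<close>, the sum of two the commutator with \<open>N\<close>.\<close>
  let ?a = "scal m * ((?\<rho> - ?\<rho>') * ?\<sigma>) - ?\<sigma> * (?\<rho> - ?\<rho>')" and ?a' = "scal m * (?\<sigma>' * (?\<rho> - ?\<rho>')) - (?\<rho> - ?\<rho>') * ?\<sigma>'"
  let ?b = "scal m * ((?\<rho> + ?\<rho>') * ?\<sigma>) - ?\<sigma> * (?\<rho> + ?\<rho>')" and ?b' = "scal m * (?\<sigma>' * (?\<rho> + ?\<rho>')) - (?\<rho> + ?\<rho>') * ?\<sigma>'"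
  have "DD * TT - TT * DD - scal h * (NN * DD - scal m * (DD * NN) - scal ((m - 1) / h) * (DD * TT))
      = scal 2 * ?a"
    by (rule poly_mapping_eqI; simp add: nc_simps; use h in \<open>simp add: field_simps\<close>)
  then show ?g2 using I(2-3)[OF r(2)] by simp
  have "SS * TT - TT * SS - scal h * (NN * SS - scal m * (SS * NN) - scal ((m - 1) / h) * (SS * TT))
      = scal (2 / h) * ?b"
    by (rule poly_mapping_eqI; simp add: nc_simps; use h in \<open>simp add: field_simps\<close>)
  then show ?g3 using I(2-3)[OF r(3)] by simp
  have "scal (1 + m) * (NN * DD - DD * NN) - scal ((m - 1) / h) * (DD * TT + TT * DD)
      = scal (- 2 / h) * (?a + ?a')"
    by (rule poly_mapping_eqI; simp add: nc_simps; use h in \<open>simp add: field_simps power2_eq_square\<close>)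
  then have "scal (1 / (1 + m)) * (scal (1 + m) * (NN * DD - DD * NN) - scal ((m - 1) / h) * (DD * TT + TT * DD))
      \<in> SU_ideal \<kappa>"
    using I(3)[OF I(3)[OF I(1)[OF r(2) r'(1)]]] by (simp only:)
  moreover have "scal (1 / (1 + m)) * (scal (1 + m) * x - scal ((m - 1) / h) * y) = x - scal ((m - 1) / h / (1 + m)) * y" for x y
    using m by (simp add: right_diff_distrib[of "scal _"] scal_mult_left mult.commute)
  ultimately show ?g4 by (simp only:)
  have "scal (1 + m) * (NN * SS - SS * NN) - scal ((m - 1) / h) * (SS * TT + TT * SS)
      = scal (- 2 / h^2) * (?b + ?b')"
    by (rule poly_mapping_eqI; simp add: nc_simps; use h in \<open>simp add: field_simps power2_eq_square\<close>)
  then have "scal (1 / (1 + m)) * (scal (1 + m) * (NN * SS - SS * NN) - scal ((m - 1) / h) * (SS * TT + TT * SS))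
      \<in> SU_ideal \<kappa>"
    using I(3)[OF I(3)[OF I(1)[OF r(3) r'(2)]]] by (simp only:)
  moreover have "scal (1 / (1 + m)) * (scal (1 + m) * x - scal ((m - 1) / h) * y) = x - scal ((m - 1) / h / (1 + m)) * y" for x y
    using m by (simp add: right_diff_distrib[of "scal _"] scal_mult_left mult.commute)
  ultimately show ?g5 by (simp only:)
  \<comment> \<open>The difference of the two sphere relations gives \<open>[N, T]\<close>, their sum gives \<open>T\<^sup>2\<close>.\<close>
  let ?c = "?\<sigma> * ?\<sigma>' + scal (m^2) * (?\<rho> * ?\<rho>') - 1" and ?c' = "?\<sigma>' * ?\<sigma> + ?\<rho> * ?\<rho>' - 1"
  have "NN * TT - TT * NN - scal ((m - 1) / h * (1 + m) / 2) * (DD * DD - scal (h^2) * (SS * SS))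
      = scal (2 / h) * (?c - ?c') - scal ((m^2 - 1) / 2) * (DD * SS - SS * DD)"
    by (rule poly_mapping_eqI; simp add: nc_simps; use h m in \<open>simp add: divide_simps\<close>; use h m in \<open>simp add: algebra_simps power2_eq_square\<close>)
  then show ?g6 using I(3)[OF I(2)[OF I(4)[OF r(4,5)]]] I(2-3)[OF I(4)[OF r(4,5)]] I(2-3)[OF \<open>?g1\<close>] I(4) by simp
  have "TT * TT - scal (h^2) * (NN * NN) - scal ((1 + m^2) / 2) * (DD * DD - scal (h^2) * (SS * SS)) - scal 4
      = scal 2 * (?c + ?c') - scal (h * (1 + m^2) / 2) * (DD * SS - SS * DD)"
    by (rule poly_mapping_eqI; simp add: nc_simps; use h m in \<open>simp add: divide_simps\<close>; use h m in \<open>simp add: algebra_simps power2_eq_square\<close>)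
  then show ?g7 using I(2-3)[OF I(1)[OF r(4,5)]] I(2-3)[OF \<open>?g1\<close>] I(4) by simp
qed

section \<open>Power series in \<open>h\<close>\<close>

text \<open>The ring \<open>\<complex>[[h]]\<close> inside \<open>\<complex>((h))\<close>. For its elements, \<open>fls_nth x 0\<close> is the residue modulo \<open>h\<close>.\<close>

definition O_int :: "complex fls set" where "O_int = range fps_to_fls"

lemma O_add [intro]: "x \<in> O_int \<Longrightarrow> y \<in> O_int \<Longrightarrow> x + y \<in> O_int"
  by (auto simp: O_int_def simp flip: fps_to_fls_plus)
lemma O_diff [intro]: "x \<in> O_int \<Longrightarrow> y \<in> O_int \<Longrightarrow> x - y \<in> O_int"
  by (auto simp: O_int_def simp flip: fps_to_fls_minus)
lemma O_uminus [intro]: "x \<in> O_int \<Longrightarrow> - x \<in> O_int"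
  by (auto simp: O_int_def simp flip: fps_to_fls_uminus)
lemma O_mult [intro]: "x \<in> O_int \<Longrightarrow> y \<in> O_int \<Longrightarrow> x * y \<in> O_int"
  by (auto simp: O_int_def simp flip: fls_times_fps_to_fls)
lemma O_const [intro]: "fls_const c \<in> O_int"
  unfolding O_int_def by (metis fps_const_to_fls rangeI)
lemma O_numeral [intro, simp]: "numeral n \<in> O_int"
  using O_const[of "numeral n"] by simp
lemma O_0 [intro, simp]: "0 \<in> O_int" and O_1 [intro, simp]: "1 \<in> O_int"
  using O_const[of 0] O_const[of 1] by simp_all
lemma O_hp [intro]: "hp \<in> O_int"
  unfolding O_int_def hp_def by (metis fps_X_to_fls rangeI)
lemma O_power [intro]: "x \<in> O_int \<Longrightarrow> x ^ n \<in> O_int"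
  by (induction n) auto

lemma nth_mult_O:
  assumes "x \<in> O_int" "y \<in> O_int"
  shows "fls_nth (x * y) 0 = fls_nth x 0 * fls_nth y 0"
proof -
  obtain f g where "x = fps_to_fls f" "y = fps_to_fls g" using assms by (auto simp: O_int_def)
  then show ?thesis by (simp add: fls_times_fps_to_fls[symmetric])
qed

lemma O_inverse: assumes "x \<in> O_int" "fls_nth x 0 \<noteq> 0" shows "inverse x \<in> O_int"
proof -
  obtain f where f: "x = fps_to_fls f" using assms by (auto simp: O_int_def)
  then have "fps_nth f 0 \<noteq> 0" using assms by simp
  then have "x * fps_to_fls (inverse f) = 1"
    by (simp add: f inverse_mult_eq_1' flip: fls_times_fps_to_fls)
  then have "inverse x = fps_to_fls (inverse f)" by (rule inverse_unique)
  then show ?thesis by (simp add: O_int_def)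
qed

lemma O_divide: "x \<in> O_int \<Longrightarrow> y \<in> O_int \<Longrightarrow> fls_nth y 0 \<noteq> 0 \<Longrightarrow> x / y \<in> O_int"
  by (simp add: divide_inverse O_mult O_inverse)

lemma O_residue:
  assumes "x \<in> O_int" obtains y where "y \<in> O_int" "x = fls_const (fls_nth x 0) + hp * y"
proof -
  obtain f where f: "x = fps_to_fls f" using assms by (auto simp: O_int_def)
  have "f = fps_const (fps_nth f 0) + fps_X * fps_shift 1 f"
    by (rule fps_ext) (auto simp: fps_X_mult_nth)
  then have "x = fls_const (fls_nth x 0) + hp * fps_to_fls (fps_shift 1 f)"
    unfolding f hp_def by (metis fls_times_fps_to_fls fps_X_to_fls fps_const_to_fls fps_to_fls_nth fps_to_fls_plus linorder_not_less nat_0 order_refl)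
  then show ?thesis using that by (auto simp: O_int_def)
qed

lemma O_nth_0_eq_0:
  assumes "x \<in> O_int" "fls_nth x 0 = 0" obtains y where "y \<in> O_int" "x = hp * y"
  using O_residue[OF assms(1)] assms(2) by (metis add_0 fls_const_0)

lemma mu_in_O [simp, intro]: "mu \<kappa> \<in> O_int"
  by (simp add: O_int_def mu_def)

lemma mu_nth_0 [simp]: "fls_nth (mu \<kappa>) 0 = 1"
  by (simp add: mu_def)

text \<open>The series \<open>(\<mu> - 1) / h\<close>, with residue \<open>1 / \<kappa>\<close>.\<close>

definition d_mu :: "real \<Rightarrow> complex fls" where "d_mu \<kappa> = (mu \<kappa> - 1) / hp"

lemma d_mu_eq: "d_mu \<kappa> = fps_to_fls (fps_shift 1 (fps_exp (complex_of_real (1 / \<kappa>))))"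
proof -
  have "fps_exp (complex_of_real (1 / \<kappa>)) = 1 + fps_X * fps_shift 1 (fps_exp (complex_of_real (1 / \<kappa>)))"
    by (rule fps_ext) (auto simp: fps_X_mult_nth)
  then have "mu \<kappa> = 1 + hp * fps_to_fls (fps_shift 1 (fps_exp (complex_of_real (1 / \<kappa>))))"
    unfolding mu_def hp_def by (metis fls_times_fps_to_fls fps_X_to_fls fps_one_to_fls fps_to_fls_plus)
  then show ?thesis by (simp add: d_mu_def)
qed

lemma d_mu_in_O [simp, intro]: "d_mu \<kappa> \<in> O_int"
  by (simp add: O_int_def d_mu_eq)

lemma d_mu_nth_0: "fls_nth (d_mu \<kappa>) 0 = complex_of_real (1 / \<kappa>)"
  by (simp add: d_mu_eq)

lemma hp_nth_0 [simp]: "fls_nth hp 0 = 0"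
  by (simp add: hp_def)

lemma nth_power_O: "x \<in> O_int \<Longrightarrow> fls_nth (x ^ n) 0 = fls_nth x 0 ^ n"
  by (induction n) (simp_all add: nth_mult_O O_power)

lemma nth_numeral_0 [simp]: "fls_nth (numeral n) 0 = numeral n"
  by (simp flip: fls_const_numeral)

lemma nth_inverse_O:
  assumes "x \<in> O_int" "fls_nth x 0 \<noteq> 0"
  shows "fls_nth (inverse x) 0 = inverse (fls_nth x 0)"
proof -
  have "x \<noteq> 0" using assms by auto
  then have "fls_nth (x * inverse x) 0 = 1" by simp
  then show ?thesis using assms by (metis O_inverse inverse_unique nth_mult_O)
qed

lemma nth_divide_O:
  assumes "x \<in> O_int" "y \<in> O_int" "fls_nth y 0 \<noteq> 0"
  shows "fls_nth (x / y) 0 = fls_nth x 0 / fls_nth y 0"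
  using assms by (simp add: divide_inverse nth_mult_O O_inverse nth_inverse_O)

lemmas O_intros = O_add O_diff O_uminus O_mult O_const O_numeral O_0 O_1 O_hp O_power O_divide mu_in_O d_mu_in_O
lemmas nth_simps = nth_mult_O nth_power_O nth_divide_O O_intros d_mu_nth_0

section \<open>The lattice \<open>\<L>\<close> and its relations modulo \<open>h\<close>\<close>

text \<open>The preimage of \<open>\<L>\<close> in the free algebra.\<close>

definition L_rep :: "real \<Rightarrow> free_alg set" where "L_rep \<kappa> = {x. su \<kappa> x \<in> L_alg \<kappa>}"

lemma L_rep_add: "x \<in> L_rep \<kappa> \<Longrightarrow> y \<in> L_rep \<kappa> \<Longrightarrow> x + y \<in> L_rep \<kappa>"
  using subringE(7)[OF subring_L_alg] by (force simp: L_rep_def su_add[symmetric])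
lemma L_rep_mult: "x \<in> L_rep \<kappa> \<Longrightarrow> y \<in> L_rep \<kappa> \<Longrightarrow> x * y \<in> L_rep \<kappa>"
  using subringE(6)[OF subring_L_alg] by (force simp: L_rep_def su_mult[symmetric])
lemma L_rep_uminus: "x \<in> L_rep \<kappa> \<Longrightarrow> - x \<in> L_rep \<kappa>"
  using subringE(5)[OF subring_L_alg] by (force simp: L_rep_def su_uminus[symmetric])
lemma L_rep_diff: "x \<in> L_rep \<kappa> \<Longrightarrow> y \<in> L_rep \<kappa> \<Longrightarrow> x - y \<in> L_rep \<kappa>"
  using L_rep_add[of x \<kappa> "- y"] L_rep_uminus[of y \<kappa>] by simp
lemma L_rep_scal: "c \<in> O_int \<Longrightarrow> scal c \<in> L_rep \<kappa>"
  unfolding L_rep_def L_alg_def by (auto intro!: generate_ring.incl simp: O_int_def)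
lemma L_rep_1: "1 \<in> L_rep \<kappa>" using L_rep_scal[of 1 \<kappa>] by simp
lemma L_rep_scal_mult: "c \<in> O_int \<Longrightarrow> x \<in> L_rep \<kappa> \<Longrightarrow> scal c * x \<in> L_rep \<kappa>"
  by (simp add: L_rep_mult L_rep_scal)
lemma L_rep_cong: "x \<in> L_rep \<kappa> \<Longrightarrow> y - x \<in> SU_ideal \<kappa> \<Longrightarrow> y \<in> L_rep \<kappa>"
  by (simp add: L_rep_def flip: su_eq_iff)
text \<open>Representatives of \<open>a\<close>, \<open>w\<close> and of their adjoints.\<close>

definition a_rep :: "real \<Rightarrow> free_alg" where
  "a_rep \<kappa> = scal (1 / 2) * (gen Sigma + gen Rho - scal (mu \<kappa>) * gen Rho' + gen Sigma')"
definition w_rep :: "real \<Rightarrow> free_alg" where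
  "w_rep \<kappa> = scal (1 / (2 * hp)) * (- gen Sigma - gen Rho - scal (mu \<kappa>) * gen Rho' + gen Sigma')"

lemma a_elt_eq: "a_elt \<kappa> = su \<kappa> (a_rep \<kappa>)" and w_elt_eq: "w_elt \<kappa> = su \<kappa> (w_rep \<kappa>)"
  by (simp_all add: a_elt_def a_rep_def w_elt_def w_rep_def hp_def)

definition a_rep' :: "real \<Rightarrow> free_alg" where "a_rep' \<kappa> = free_star (a_rep \<kappa>)"
definition w_rep' :: "real \<Rightarrow> free_alg" where "w_rep' \<kappa> = free_star (w_rep \<kappa>)"

lemma su_star_gens: "su_star (su \<kappa> (a_rep \<kappa>)) = su \<kappa> (a_rep' \<kappa>)" "su_star (su \<kappa> (w_rep \<kappa>)) = su \<kappa> (w_rep' \<kappa>)"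
  by (simp_all add: su_star_su a_rep'_def w_rep'_def)

lemma a_rep'_letters: "a_rep' \<kappa> = scal (1 / 2) * (gen Sigma' + gen Rho' - scal (mu \<kappa>) * gen Rho + gen Sigma)"
  and w_rep'_letters: "w_rep' \<kappa> = scal (1 / (2 * hp)) * (- gen Sigma' - gen Rho' - scal (mu \<kappa>) * gen Rho + gen Sigma)"
proof -
  have "free_star (- x) = - free_star x" for x using free_star_diff[of 0 x] by simp
  then show "a_rep' \<kappa> = scal (1 / 2) * (gen Sigma' + gen Rho' - scal (mu \<kappa>) * gen Rho + gen Sigma)"
   "w_rep' \<kappa> = scal (1 / (2 * hp)) * (- gen Sigma' - gen Rho' - scal (mu \<kappa>) * gen Rho + gen Sigma)"
    by (simp_all add: a_rep'_def w_rep'_def a_rep_def w_rep_def free_star_mult free_star_add free_star_diff free_star_gen free_star_scal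
       scal_gen ring_distribs flip: scal_central)
qed

text \<open>The coefficients on the right are power series, and the system can be solved for \<open>T\<close>, \<open>D\<close>, \<open>S\<close>, \<open>N\<close> over
  \<open>\<complex>[[h]]\<close>, because \<open>1 + \<mu>\<close> is a unit.\<close>

lemma a_rep_eq: "a_rep \<kappa> = scal (1/2) * TT + scal ((1 + mu \<kappa>) / 4) * DD - scal (hp^2 * d_mu \<kappa> / 4) * SS"
  and a_rep'_eq: "a_rep' \<kappa> = scal (1/2) * TT - scal ((1 + mu \<kappa>) / 4) * DD - scal (hp^2 * d_mu \<kappa> / 4) * SS"
  and w_rep_eq: "w_rep \<kappa> = scal (d_mu \<kappa> / 4) * DD - scal (1/2) * NN - scal ((1 + mu \<kappa>) / 4) * SS"
  and w_rep'_eq: "w_rep' \<kappa> = scal (1/2) * NN - scal (d_mu \<kappa> / 4) * DD - scal ((1 + mu \<kappa>) / 4) * SS"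
  unfolding a_rep'_letters w_rep'_letters a_rep_def w_rep_def gen_TDSN
  by (rule poly_mapping_eqI; simp add: nc_simps d_mu_def; simp add: field_simps power2_eq_square)+

lemma gens_in_L_rep: "a_rep \<kappa> \<in> L_rep \<kappa>" "a_rep' \<kappa> \<in> L_rep \<kappa>" "w_rep \<kappa> \<in> L_rep \<kappa>" "w_rep' \<kappa> \<in> L_rep \<kappa>"
  unfolding L_rep_def L_alg_def
  by (auto intro!: generate_ring.incl simp: a_elt_eq w_elt_eq su_star_gens)

lemma TDSN_in_L_rep: "TT \<in> L_rep \<kappa>" "DD \<in> L_rep \<kappa>" "SS \<in> L_rep \<kappa>" "NN \<in> L_rep \<kappa>"
proof -
  have c_inv: "2 / (1 + mu \<kappa>) * ((1 + mu \<kappa>) / 2) = 1" "- 2 / (1 + mu \<kappa>) * (- (1 + mu \<kappa>) / 2) = 1"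
  proof -
    have "2 / x * (x / 2) = 1 \<and> - 2 / x * (- x / 2) = 1" if "x \<noteq> 0" for x :: "complex fls"
      using that by simp
    then show "2 / (1 + mu \<kappa>) * ((1 + mu \<kappa>) / 2) = 1" "- 2 / (1 + mu \<kappa>) * (- (1 + mu \<kappa>) / 2) = 1"
      using mu_plus_1[of \<kappa>] by blast+
  qed
  have "a_rep \<kappa> - a_rep' \<kappa> = scal ((1 + mu \<kappa>) / 2) * DD"
   and "w_rep \<kappa> + w_rep' \<kappa> = scal (- (1 + mu \<kappa>) / 2) * SS"
    unfolding a_rep_eq a_rep'_eq w_rep_eq w_rep'_eq
    by (rule poly_mapping_eqI; simp add: nc_simps; simp add: field_simps)+
  then have D: "scal (2 / (1 + mu \<kappa>)) * (a_rep \<kappa> - a_rep' \<kappa>) = DD"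
   and S: "scal (- 2 / (1 + mu \<kappa>)) * (w_rep \<kappa> + w_rep' \<kappa>) = SS"
    using c_inv by (simp_all only: scal_mult_left scal_1 mult_1_left)
  have c: "2 / (1 + mu \<kappa>) \<in> O_int" "- 2 / (1 + mu \<kappa>) \<in> O_int"
    by (auto intro!: O_intros)
  show D': "DD \<in> L_rep \<kappa>" and S': "SS \<in> L_rep \<kappa>"
    using L_rep_scal_mult[OF c(1) L_rep_diff[OF gens_in_L_rep(1,2)[of \<kappa>]]] L_rep_scal_mult[OF c(2) L_rep_add[OF gens_in_L_rep(3,4)[of \<kappa>]]] D S by simp_all
  have T: "a_rep \<kappa> + a_rep' \<kappa> + scal (hp^2 * d_mu \<kappa> / 2) * SS = TT"
   and N: "w_rep' \<kappa> - w_rep \<kappa> + scal (d_mu \<kappa> / 2) * DD = NN"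
    unfolding a_rep_eq a_rep'_eq w_rep_eq w_rep'_eq
    by (rule poly_mapping_eqI; simp add: nc_simps; simp add: field_simps)+
  have c': "hp^2 * d_mu \<kappa> / 2 \<in> O_int" "d_mu \<kappa> / 2 \<in> O_int"
    by (auto intro!: O_intros)
  show "TT \<in> L_rep \<kappa>" and "NN \<in> L_rep \<kappa>"
    using L_rep_add[OF L_rep_add[OF gens_in_L_rep(1,2)] L_rep_scal_mult[OF c'(1) S']]
      L_rep_add[OF L_rep_diff[OF gens_in_L_rep(4,3)] L_rep_scal_mult[OF c'(2) D']] T N by simp_all
qed

lemmas L_rep_intros = L_rep_add L_rep_diff L_rep_uminus L_rep_scal L_rep_1 L_rep_mult TDSN_in_L_rep

text \<open>Modulo the relations, \<open>\<L>\<close> is generated by the power series and \<open>T\<close>, \<open>D\<close>, \<open>S\<close>, \<open>N\<close>.\<close>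

lemma L_rep_induct [consumes 1, case_names ideal scal T D S N add mult]:
  assumes x: "x \<in> L_rep \<kappa>"
    and ideal: "\<And>x. x \<in> SU_ideal \<kappa> \<Longrightarrow> P x"
    and scal: "\<And>c. c \<in> O_int \<Longrightarrow> P (scal c)"
    and gens: "P TT" "P DD" "P SS" "P NN"
    and add: "\<And>x y. P x \<Longrightarrow> P y \<Longrightarrow> P (x + y)"
    and mult: "\<And>x y. P x \<Longrightarrow> P y \<Longrightarrow> P (x * y)"
  shows "P x"
proof -
  have cong: "P y" if "P x" "su \<kappa> x = su \<kappa> y" for x y
    using add[OF that(1) ideal[of "y - x"]] that(2)[symmetric] by (simp add: su_eq_iff)
  have uminus: "P (- x)" if "P x" for x
    using mult[OF scal[of "-1"] that] by (auto simp: scal_uminus)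
  have diff: "P (x - y)" if "P x" "P y" for x y
    using add[OF that(1) uminus[OF that(2)]] by simp
  have c: "(1::complex fls) / 2 \<in> O_int" "(1 + mu \<kappa>) / 4 \<in> O_int" "hp^2 * d_mu \<kappa> / 4 \<in> O_int" "d_mu \<kappa> / 4 \<in> O_int"
    by (auto intro!: O_intros)
  have G: "P (a_rep \<kappa>)" "P (a_rep' \<kappa>)" "P (w_rep \<kappa>)" "P (w_rep' \<kappa>)"
    unfolding a_rep_eq a_rep'_eq w_rep_eq w_rep'_eq by (intro add diff mult scal gens c)+
  have "\<exists>x. z = su \<kappa> x \<and> P x" if "z \<in> L_alg \<kappa>" for z
    using that unfolding L_alg_def
  proof induction
    case one
    then show ?case using scal[of 1] by (auto simp: su_one)
  next
    case (incl z)
    then show ?case using G scal by (auto simp: a_elt_eq w_elt_eq su_star_gens O_int_def)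
  next
    case (a_inv z)
    then show ?case using uminus by (auto simp: su_uminus)
  next
    case (eng_add z1 z2)
    then show ?case using add by (auto simp: su_add)
  next
    case (eng_mult z1 z2)
    then show ?case using mult by (auto simp: su_mult)
  qed
  with x obtain y where "su \<kappa> x = su \<kappa> y" "P y" by (auto simp: L_rep_def)
  with cong[of y x] show ?thesis by simp
qed

text \<open>The preimage of \<open>h \<L>\<close> in the free algebra; see \<open>hL_rep_iff\<close>.\<close>

definition hL_rep :: "real \<Rightarrow> free_alg set" where
  "hL_rep \<kappa> = {x. \<exists>y\<in>L_rep \<kappa>. x - scal hp * y \<in> SU_ideal \<kappa>}"

lemma hL_rep_add: assumes "x \<in> hL_rep \<kappa>" "y \<in> hL_rep \<kappa>" shows "x + y \<in> hL_rep \<kappa>"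
proof -
  from assms obtain x' y' where *: "x' \<in> L_rep \<kappa>" "y' \<in> L_rep \<kappa>"
    "x - scal hp * x' \<in> SU_ideal \<kappa>" "y - scal hp * y' \<in> SU_ideal \<kappa>" by (auto simp: hL_rep_def)
  then have "(x + y) - scal hp * (x' + y') \<in> SU_ideal \<kappa>"
    using SU_ideal_add[OF *(3,4)] by (simp add: algebra_simps)
  with * show ?thesis by (auto simp: hL_rep_def intro: L_rep_add)
qed

lemma hL_rep_mult: assumes "x \<in> hL_rep \<kappa>" "y \<in> L_rep \<kappa>" shows "x * y \<in> hL_rep \<kappa>" "y * x \<in> hL_rep \<kappa>"
proof -
  from assms obtain x' where *: "x' \<in> L_rep \<kappa>" "x - scal hp * x' \<in> SU_ideal \<kappa>" by (auto simp: hL_rep_def)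
  have "y * (scal hp * x') = scal hp * (y * x')"
    by (metis mult.assoc scal_central)
  then have "x * y - scal hp * (x' * y) \<in> SU_ideal \<kappa>" "y * x - scal hp * (y * x') \<in> SU_ideal \<kappa>"
    using SU_ideal_mult[OF *(2), of y] by (simp_all add: algebra_simps)
  with * assms(2) show "x * y \<in> hL_rep \<kappa>" "y * x \<in> hL_rep \<kappa>" by (auto simp: hL_rep_def intro: L_rep_mult)
qed

lemma hL_rep_SU: "x \<in> SU_ideal \<kappa> \<Longrightarrow> x \<in> hL_rep \<kappa>"
  using L_rep_scal[of 0 \<kappa>] by (auto simp: hL_rep_def intro!: bexI[of _ 0])

lemma hL_rep_hp: "x \<in> L_rep \<kappa> \<Longrightarrow> scal hp * x \<in> hL_rep \<kappa>"
  by (auto simp: hL_rep_def SU_ideal_0 intro!: bexI[of _ x])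

lemma hL_rep_scal:
  assumes "c \<in> O_int" "fls_nth c 0 = 0" "x \<in> L_rep \<kappa>"
  shows "scal c * x \<in> hL_rep \<kappa>"
proof -
  obtain d where "d \<in> O_int" "c = hp * d" using O_nth_0_eq_0[OF assms(1,2)] .
  then show ?thesis using hL_rep_hp[OF L_rep_scal_mult[of d x \<kappa>]] assms(3)
    by (simp add: scal_mult_left)
qed

lemma hL_rep_L_rep: "x \<in> hL_rep \<kappa> \<Longrightarrow> x \<in> L_rep \<kappa>"
  by (auto simp: hL_rep_def intro: L_rep_cong[OF L_rep_scal_mult[OF O_hp]])

lemma hL_rep_uminus: "x \<in> hL_rep \<kappa> \<Longrightarrow> - x \<in> hL_rep \<kappa>"
  using hL_rep_mult(1)[of x \<kappa> "-1"] L_rep_uminus[OF L_rep_1] by simp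

lemma hL_rep_diff: "x \<in> hL_rep \<kappa> \<Longrightarrow> y \<in> hL_rep \<kappa> \<Longrightarrow> x - y \<in> hL_rep \<kappa>"
  using hL_rep_add[of x \<kappa> "- y"] hL_rep_uminus[of y \<kappa>] by simp

lemma hL_rep_scal_mult: "c \<in> O_int \<Longrightarrow> x \<in> hL_rep \<kappa> \<Longrightarrow> scal c * x \<in> hL_rep \<kappa>"
  by (simp add: hL_rep_mult L_rep_scal)

text \<open>The constant \<open>1 / \<kappa>\<close>.\<close>

definition inv_kappa :: "real \<Rightarrow> complex fls" where "inv_kappa \<kappa> = fls_const (complex_of_real (1 / \<kappa>))"

lemma inv_kappa_O [simp, intro]: "inv_kappa \<kappa> \<in> O_int" and inv_kappa_nth_0 [simp]: "fls_nth (inv_kappa \<kappa>) 0 = complex_of_real (1 / \<kappa>)"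
  by (auto simp: inv_kappa_def)

text \<open>The relations of the contracted algebra.\<close>

lemma hL_rep_rels:
  shows "DD * SS - SS * DD \<in> hL_rep \<kappa>"
    and "DD * TT - TT * DD \<in> hL_rep \<kappa>"
    and "SS * TT - TT * SS \<in> hL_rep \<kappa>"
    and "NN * DD - DD * NN - scal (inv_kappa \<kappa>) * (TT * DD) \<in> hL_rep \<kappa>"
    and "NN * SS - SS * NN - scal (inv_kappa \<kappa>) * (TT * SS) \<in> hL_rep \<kappa>"
    and "NN * TT - TT * NN - scal (inv_kappa \<kappa>) * (DD * DD) \<in> hL_rep \<kappa>"
    and "TT * TT - DD * DD - scal 4 \<in> hL_rep \<kappa>"
proof -
  note I = TDSN_rels[of \<kappa>, THEN hL_rep_SU, folded d_mu_def]
  have expand: "x \<in> hL_rep \<kappa>" if "x - y \<in> hL_rep \<kappa>" "y \<in> hL_rep \<kappa>" for x y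
    using hL_rep_add[OF that] by simp
  show DS: "DD * SS - SS * DD \<in> hL_rep \<kappa>" by (rule I(1))
  show DT: "DD * TT - TT * DD \<in> hL_rep \<kappa>"
    by (rule expand[OF I(2)]) (intro hL_rep_hp L_rep_intros mu_in_O d_mu_in_O)
  show ST: "SS * TT - TT * SS \<in> hL_rep \<kappa>"
    by (rule expand[OF I(3)]) (intro hL_rep_hp L_rep_intros mu_in_O d_mu_in_O)
  let ?c = "d_mu \<kappa> / (1 + mu \<kappa>)"
  have cO: "?c - inv_kappa \<kappa> / 2 \<in> O_int" "inv_kappa \<kappa> / 2 \<in> O_int" "fls_nth (?c - inv_kappa \<kappa> / 2) 0 = 0"
    by (simp_all add: nth_simps)
  have *: "NN * z - z * NN - scal (inv_kappa \<kappa>) * (TT * z) =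
      (NN * z - z * NN - scal ?c * (z * TT + TT * z)) + (scal (?c - inv_kappa \<kappa> / 2) * (z * TT + TT * z)
       + scal (inv_kappa \<kappa> / 2) * (z * TT - TT * z))" for z
    by (rule poly_mapping_eqI) (simp add: nc_simps algebra_simps)
  show "NN * DD - DD * NN - scal (inv_kappa \<kappa>) * (TT * DD) \<in> hL_rep \<kappa>"
    unfolding * by (intro hL_rep_add I(4) hL_rep_scal cO hL_rep_scal_mult DT L_rep_intros)
  show "NN * SS - SS * NN - scal (inv_kappa \<kappa>) * (TT * SS) \<in> hL_rep \<kappa>"
    unfolding * by (intro hL_rep_add I(5) hL_rep_scal cO hL_rep_scal_mult ST L_rep_intros)
  let ?d = "d_mu \<kappa> * (1 + mu \<kappa>) / 2"
  have "NN * TT - TT * NN - scal (inv_kappa \<kappa>) * (DD * DD) = (NN * TT - TT * NN - scal ?d * (DD * DD - scal (hp^2) * (SS * SS)))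
     + (scal (?d - inv_kappa \<kappa>) * (DD * DD) - scal (?d * hp^2) * (SS * SS))"
    by (rule poly_mapping_eqI) (simp add: nc_simps algebra_simps)
  moreover have "?d - inv_kappa \<kappa> \<in> O_int" "?d * hp^2 \<in> O_int" "fls_nth (?d - inv_kappa \<kappa>) 0 = 0" "fls_nth (?d * hp^2) 0 = 0"
    by (simp_all add: nth_simps)
  ultimately show "NN * TT - TT * NN - scal (inv_kappa \<kappa>) * (DD * DD) \<in> hL_rep \<kappa>"
    by (simp only:) (intro hL_rep_add hL_rep_diff I(6) hL_rep_scal L_rep_intros)
  let ?e = "(1 + mu \<kappa>^2) / 2"
  have "TT * TT - DD * DD - scal 4 = (TT * TT - scal (hp^2) * (NN * NN) - scal ?e * (DD * DD - scal (hp^2) * (SS * SS)) - scal 4)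
     + (scal (hp^2) * (NN * NN) + scal (?e - 1) * (DD * DD) - scal (?e * hp^2) * (SS * SS))"
    by (rule poly_mapping_eqI) (simp add: nc_simps algebra_simps)
  moreover have "?e - 1 \<in> O_int" "?e * hp^2 \<in> O_int" "hp^2 \<in> O_int" "fls_nth (?e - 1) 0 = 0" "fls_nth (?e * hp^2) 0 = 0" "fls_nth (hp^2) 0 = 0"
    by (simp_all add: nth_simps)
  ultimately show "TT * TT - DD * DD - scal 4 \<in> hL_rep \<kappa>"
    by (simp only:) (intro hL_rep_add hL_rep_diff I(7) hL_rep_scal L_rep_intros)
qed

section \<open>Two generating sets of the limit ideal\<close>

text \<open>Preimages in the free algebra of right ideals of \<open>\<L> / h \<L>\<close>. The set \<open>Q\<close> need not lie in the
  preimage of \<open>\<L>\<close>.\<close>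

locale lattice_right_ideal =
  fixes \<kappa> :: real and Q :: "free_alg set"
  assumes hL_rep_subset: "hL_rep \<kappa> \<subseteq> Q"
    and add: "x \<in> Q \<Longrightarrow> y \<in> Q \<Longrightarrow> x + y \<in> Q"
    and mult: "x \<in> Q \<Longrightarrow> y \<in> L_rep \<kappa> \<Longrightarrow> x * y \<in> Q"
begin

lemma hL_rep: "x \<in> hL_rep \<kappa> \<Longrightarrow> x \<in> Q"
  using hL_rep_subset by blast

lemma scal_mem: "c \<in> O_int \<Longrightarrow> x \<in> Q \<Longrightarrow> scal c * x \<in> Q"
  by (simp add: scal_central mult L_rep_scal)

lemma diff: "x \<in> Q \<Longrightarrow> y \<in> Q \<Longrightarrow> x - y \<in> Q"
  using add[of x "- y"] scal_mem[of "-1" y] by (auto simp: scal_uminus)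

lemma cong: "x - y \<in> hL_rep \<kappa> \<Longrightarrow> x \<in> Q \<longleftrightarrow> y \<in> Q"
  using add[of y "x - y"] diff[of x "x - y"] hL_rep by auto

lemma scal_iff:
  assumes "c \<noteq> 0" shows "scal (fls_const c) * x \<in> Q \<longleftrightarrow> x \<in> Q"
proof
  assume "scal (fls_const c) * x \<in> Q"
  from scal_mem[OF O_const this, of "1 / c"] assms show "x \<in> Q"
    by (simp add: scal_mult_left)
qed (simp add: scal_mem O_const)

lemma numeral_iff: "scal (numeral n) * x \<in> Q \<longleftrightarrow> x \<in> Q"
  using scal_iff[of "numeral n" x] by simp

end

text \<open>Up to the factors \<open>2\<close> and \<open>4\<close>, the elements of \<open>\<L>\<close> that agree with \<open>a\<close>, \<open>a\<^sup>*\<close>, \<open>w\<close>, \<open>w\<^sup>*\<close> modulo \<open>h\<close>.\<close>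

definition AA where "AA = TT + DD"
definition AA' where "AA' = TT - DD"
definition WW where "WW \<kappa> = scal (inv_kappa \<kappa>) * DD - scal 2 * NN - scal 2 * SS"
definition WW' where "WW' \<kappa> = scal 2 * NN - scal 2 * SS - scal (inv_kappa \<kappa>) * DD"

lemma hL_rep_gens:
  "scal 2 * a_rep \<kappa> - AA \<in> hL_rep \<kappa>" "scal 2 * a_rep' \<kappa> - AA' \<in> hL_rep \<kappa>"
  "scal 4 * w_rep \<kappa> - WW \<kappa> \<in> hL_rep \<kappa>" "scal 4 * w_rep' \<kappa> - WW' \<kappa> \<in> hL_rep \<kappa>"
proof -
  have O: "(mu \<kappa> - 1) / 2 \<in> O_int" "hp^2 * d_mu \<kappa> / 2 \<in> O_int" "d_mu \<kappa> - inv_kappa \<kappa> \<in> O_int" "1 - mu \<kappa> \<in> O_int" "mu \<kappa> - 1 \<in> O_int"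
    "fls_nth ((mu \<kappa> - 1) / 2) 0 = 0" "fls_nth (hp^2 * d_mu \<kappa> / 2) 0 = 0" "fls_nth (d_mu \<kappa> - inv_kappa \<kappa>) 0 = 0"
    "fls_nth (1 - mu \<kappa>) 0 = 0" "fls_nth (mu \<kappa> - 1) 0 = 0"
    by (simp_all add: nth_simps)
  note s = a_rep_eq a_rep'_eq w_rep_eq w_rep'_eq AA_def AA'_def WW_def WW'_def
  have "scal 2 * a_rep \<kappa> - AA = scal ((mu \<kappa> - 1) / 2) * DD - scal (hp^2 * d_mu \<kappa> / 2) * SS"
    "scal 2 * a_rep' \<kappa> - AA' = - (scal ((mu \<kappa> - 1) / 2) * DD) - scal (hp^2 * d_mu \<kappa> / 2) * SS"
    "scal 4 * w_rep \<kappa> - WW \<kappa> = scal (d_mu \<kappa> - inv_kappa \<kappa>) * DD - scal (mu \<kappa> - 1) * SS"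
    "scal 4 * w_rep' \<kappa> - WW' \<kappa> = - (scal (d_mu \<kappa> - inv_kappa \<kappa>) * DD) - scal (mu \<kappa> - 1) * SS"
    unfolding s by (rule poly_mapping_eqI; simp add: nc_simps; simp add: algebra_simps diff_divide_distrib add_divide_distrib)+
  moreover have "scal ((mu \<kappa> - 1) / 2) * DD - scal (hp^2 * d_mu \<kappa> / 2) * SS \<in> hL_rep \<kappa>"
    "- (scal ((mu \<kappa> - 1) / 2) * DD) - scal (hp^2 * d_mu \<kappa> / 2) * SS \<in> hL_rep \<kappa>"
    "scal (d_mu \<kappa> - inv_kappa \<kappa>) * DD - scal (mu \<kappa> - 1) * SS \<in> hL_rep \<kappa>"
    "- (scal (d_mu \<kappa> - inv_kappa \<kappa>) * DD) - scal (mu \<kappa> - 1) * SS \<in> hL_rep \<kappa>"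
    by (intro hL_rep_add hL_rep_diff hL_rep_uminus hL_rep_scal O L_rep_intros)+
  ultimately show "scal 2 * a_rep \<kappa> - AA \<in> hL_rep \<kappa>" "scal 2 * a_rep' \<kappa> - AA' \<in> hL_rep \<kappa>"
  "scal 4 * w_rep \<kappa> - WW \<kappa> \<in> hL_rep \<kappa>" "scal 4 * w_rep' \<kappa> - WW' \<kappa> \<in> hL_rep \<kappa>" by simp_all
qed

lemma AW_in_L_rep: "AA \<in> L_rep \<kappa>" "AA' \<in> L_rep \<kappa>" "WW \<kappa> \<in> L_rep \<kappa>" "WW' \<kappa> \<in> L_rep \<kappa>"
  unfolding AA_def AA'_def WW_def WW'_def by (intro L_rep_intros O_intros inv_kappa_O)+

lemma hL_rep_mult_cong:
  assumes "x - x' \<in> hL_rep \<kappa>" "y - y' \<in> hL_rep \<kappa>" "x' \<in> L_rep \<kappa>" "y \<in> L_rep \<kappa>"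
  shows "x * y - x' * y' \<in> hL_rep \<kappa>"
proof -
  have "x * y - x' * y' = (x - x') * y + x' * (y - y')" by (simp add: algebra_simps)
  then show ?thesis using hL_rep_add[OF hL_rep_mult(1)[OF assms(1,4)] hL_rep_mult(2)[OF assms(2,3)]] by simp
qed

text \<open>Representatives of the seven generators of the claim.\<close>

definition contraction_gens :: "real \<Rightarrow> free_alg set" where
  "contraction_gens \<kappa> = {a_rep \<kappa> + a_rep' \<kappa> - scal 2, (a_rep \<kappa> - 1) * w_rep \<kappa>, (a_rep' \<kappa> - 1) * w_rep \<kappa>,
     (a_rep \<kappa> - 1) * w_rep' \<kappa>, (a_rep' \<kappa> - 1) * w_rep' \<kappa>,
     w_rep \<kappa> * w_rep \<kappa> + scal (inv_kappa \<kappa>) * w_rep \<kappa>, w_rep' \<kappa> * w_rep' \<kappa> - scal (inv_kappa \<kappa>) * w_rep' \<kappa>}"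

text \<open>The simpler generators of the same right ideal.\<close>

definition simple_gens :: "real \<Rightarrow> free_alg set" where
  "simple_gens \<kappa> = {TT - scal 2, DD * SS, DD * NN, SS * NN, SS * SS + NN * NN - scal (2 * inv_kappa \<kappa>) * NN}"

context lattice_right_ideal begin

text \<open>Modulo \<open>h\<close>, the generators may be computed from \<open>AA\<close>, \<open>AA'\<close>, \<open>WW\<close>, \<open>WW'\<close>; the factors \<open>8\<close> and \<open>16\<close> clear
  the denominators.\<close>

lemma contraction_gens_iff_AW:
  "contraction_gens \<kappa> \<subseteq> Q \<longleftrightarrow> {TT - scal 2, (AA - scal 2) * WW \<kappa>, (AA' - scal 2) * WW \<kappa>,
     (AA - scal 2) * WW' \<kappa>, (AA' - scal 2) * WW' \<kappa>,
     WW \<kappa> * WW \<kappa> + scal (4 * inv_kappa \<kappa>) * WW \<kappa>, WW' \<kappa> * WW' \<kappa> - scal (4 * inv_kappa \<kappa>) * WW' \<kappa>} \<subseteq> Q"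
proof -
  note g = hL_rep_gens[of \<kappa>] and L = AW_in_L_rep[of \<kappa>] and G = gens_in_L_rep[of \<kappa>]
  have g2: "(scal 2 * a_rep \<kappa> - scal 2) - (AA - scal 2) \<in> hL_rep \<kappa>" "(scal 2 * a_rep' \<kappa> - scal 2) - (AA' - scal 2) \<in> hL_rep \<kappa>"
    using g(1,2) by simp_all
  have L2: "AA - scal 2 \<in> L_rep \<kappa>" "AA' - scal 2 \<in> L_rep \<kappa>" "scal 4 * w_rep \<kappa> \<in> L_rep \<kappa>" "scal 4 * w_rep' \<kappa> \<in> L_rep \<kappa>"
    by (intro L_rep_diff L L_rep_mult G L_rep_scal O_numeral)+
  have s: "x * scal c = scal c * x" for x c by (simp add: scal_central)
  have p: "x * (scal c * y) = scal c * (x * y)" for x y c by (metis mult.assoc scal_central)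
  have 1: "a_rep \<kappa> + a_rep' \<kappa> - scal 2 \<in> Q \<longleftrightarrow> TT - scal 2 \<in> Q"
  proof -
    have "scal 2 * (a_rep \<kappa> + a_rep' \<kappa> - scal 2) - scal 2 * (TT - scal 2) = (scal 2 * a_rep \<kappa> - AA) + (scal 2 * a_rep' \<kappa> - AA')"
      unfolding AA_def AA'_def by (rule poly_mapping_eqI) (simp add: nc_simps)
    then show ?thesis using hL_rep_add[OF g(1,2)] cong numeral_iff by metis
  qed
  have 2: "(x - 1) * y \<in> Q \<longleftrightarrow> (x' - scal 2) * y' \<in> Q"
    if "(scal 2 * x - scal 2) - (x' - scal 2) \<in> hL_rep \<kappa>" "scal 4 * y - y' \<in> hL_rep \<kappa>" "x' - scal 2 \<in> L_rep \<kappa>" "scal 4 * y \<in> L_rep \<kappa>" for x y x' y'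
  proof -
    have "(scal 2 * x - scal 2) * (scal 4 * y) = scal 8 * ((x - 1) * y)"
      by (simp add: algebra_simps scal_mult_left p[of x])
    then show ?thesis using cong[OF hL_rep_mult_cong[OF that]] numeral_iff by simp
  qed
  have 3: "w_rep \<kappa> * w_rep \<kappa> + scal (inv_kappa \<kappa>) * w_rep \<kappa> \<in> Q \<longleftrightarrow> WW \<kappa> * WW \<kappa> + scal (4 * inv_kappa \<kappa>) * WW \<kappa> \<in> Q"
  proof -
    have "scal 16 * (w_rep \<kappa> * w_rep \<kappa> + scal (inv_kappa \<kappa>) * w_rep \<kappa>) - (WW \<kappa> * WW \<kappa> + scal (4 * inv_kappa \<kappa>) * WW \<kappa>)
      = ((scal 4 * w_rep \<kappa>) * (scal 4 * w_rep \<kappa>) - WW \<kappa> * WW \<kappa>) + scal (4 * inv_kappa \<kappa>) * (scal 4 * w_rep \<kappa> - WW \<kappa>)"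
      by (simp add: algebra_simps scal_mult_left p[of "w_rep \<kappa>"])
    moreover have "\<dots> \<in> hL_rep \<kappa>"
      by (intro hL_rep_add hL_rep_mult_cong hL_rep_scal_mult g L L2 O_mult inv_kappa_O O_numeral)
    ultimately show ?thesis using cong numeral_iff by metis
  qed
  have 4: "w_rep' \<kappa> * w_rep' \<kappa> - scal (inv_kappa \<kappa>) * w_rep' \<kappa> \<in> Q \<longleftrightarrow> WW' \<kappa> * WW' \<kappa> - scal (4 * inv_kappa \<kappa>) * WW' \<kappa> \<in> Q"
  proof -
    have "scal 16 * (w_rep' \<kappa> * w_rep' \<kappa> - scal (inv_kappa \<kappa>) * w_rep' \<kappa>) - (WW' \<kappa> * WW' \<kappa> - scal (4 * inv_kappa \<kappa>) * WW' \<kappa>)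
      = ((scal 4 * w_rep' \<kappa>) * (scal 4 * w_rep' \<kappa>) - WW' \<kappa> * WW' \<kappa>) - scal (4 * inv_kappa \<kappa>) * (scal 4 * w_rep' \<kappa> - WW' \<kappa>)"
      by (simp add: algebra_simps scal_mult_left p[of "w_rep' \<kappa>"])
    moreover have "\<dots> \<in> hL_rep \<kappa>"
      by (intro hL_rep_diff hL_rep_mult_cong hL_rep_scal_mult g L L2 O_mult inv_kappa_O O_numeral)
    ultimately show ?thesis using cong numeral_iff by metis
  qed
  show ?thesis
    unfolding contraction_gens_def insert_subset
    using 1 2[OF g2(1) g(3) L2(1,3)] 2[OF g2(2) g(3) L2(2,3)] 2[OF g2(1) g(4) L2(1,4)] 2[OF g2(2) g(4) L2(2,4)] 3 4
    by simp
qed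

text \<open>The relations of the contracted algebra, written as elements that vanish modulo \<open>h\<close>, and two of the
  simple generators.\<close>

abbreviation "r1 \<equiv> DD * SS - SS * DD"
abbreviation "r2 \<equiv> DD * TT - TT * DD"
abbreviation "r3 \<equiv> SS * TT - TT * SS"
abbreviation "r4 \<equiv> NN * DD - DD * NN - scal (inv_kappa \<kappa>) * (TT * DD)"
abbreviation "r5 \<equiv> NN * SS - SS * NN - scal (inv_kappa \<kappa>) * (TT * SS)"
abbreviation "r6 \<equiv> NN * TT - TT * NN - scal (inv_kappa \<kappa>) * (DD * DD)"
abbreviation "r7 \<equiv> TT * TT - DD * DD - scal 4"
abbreviation "q1 \<equiv> TT - scal 2"
abbreviation "q5 \<equiv> SS * SS + NN * NN - scal (2 * inv_kappa \<kappa>) * NN"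

lemma DD_square:
  assumes "q1 \<in> Q" shows "DD * DD \<in> Q"
proof -
  have eq: "DD * DD = q1 * (TT + scal 2) - r7"
    by (rule poly_mapping_eqI) (simp add: nc_simps)
  show ?thesis
    by (subst eq) (intro diff mult assms hL_rep hL_rep_rels L_rep_intros O_numeral)
qed

lemmas Q_intros = add diff scal_mem mult hL_rep hL_rep_rels O_intros inv_kappa_O L_rep_intros

text \<open>Both sums and differences of the two quadratic generators are simple modulo the other generators and
  the relations.\<close>

lemma AW_identities:
  defines "k \<equiv> inv_kappa \<kappa>"
  shows "(AA - scal 2) * WW \<kappa> = q1 * WW \<kappa> + (scal k * (DD * DD) - scal 2 * (DD * NN) - scal 2 * (DD * SS))"
    "(AA' - scal 2) * WW \<kappa> = q1 * WW \<kappa> - (scal k * (DD * DD) - scal 2 * (DD * NN) - scal 2 * (DD * SS))"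
    "(AA - scal 2) * WW' \<kappa> = q1 * WW' \<kappa> + (scal 2 * (DD * NN) - scal 2 * (DD * SS) - scal k * (DD * DD))"
    "(AA' - scal 2) * WW' \<kappa> = q1 * WW' \<kappa> - (scal 2 * (DD * NN) - scal 2 * (DD * SS) - scal k * (DD * DD))"
    "(WW \<kappa> * WW \<kappa> + scal (4 * k) * WW \<kappa>) + (WW' \<kappa> * WW' \<kappa> - scal (4 * k) * WW' \<kappa>)
      = scal 8 * q5 - scal (8 * k) * (DD * NN) - scal (4 * k) * r4 - scal (4 * k^2) * (q1 * DD) + scal (2 * k^2) * (DD * DD)"
    "(WW \<kappa> * WW \<kappa> + scal (4 * k) * WW \<kappa>) - (WW' \<kappa> * WW' \<kappa> - scal (4 * k) * WW' \<kappa>)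
      = scal 16 * (SS * NN) + scal 8 * r5 + scal (8 * k) * (q1 * SS) - scal (8 * k) * (DD * SS) + scal (4 * k) * r1"
  unfolding k_def AA_def AA'_def WW_def WW'_def
  by (rule poly_mapping_eqI; simp add: nc_simps; simp add: algebra_simps power2_eq_square)+

lemma contraction_gens_iff: "contraction_gens \<kappa> \<subseteq> Q \<longleftrightarrow> simple_gens \<kappa> \<subseteq> Q"
proof
  assume "simple_gens \<kappa> \<subseteq> Q"
  then have q: "q1 \<in> Q" "DD * SS \<in> Q" "DD * NN \<in> Q" "SS * NN \<in> Q" "q5 \<in> Q"
    by (simp_all add: simple_gens_def)
  note q = q DD_square[OF q(1)]
  let ?X = "WW \<kappa> * WW \<kappa> + scal (4 * inv_kappa \<kappa>) * WW \<kappa>" and ?Y = "WW' \<kappa> * WW' \<kappa> - scal (4 * inv_kappa \<kappa>) * WW' \<kappa>"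
  have XY: "?X + ?Y \<in> Q" "?X - ?Y \<in> Q"
    unfolding AW_identities by (intro Q_intros q)+
  have "scal 2 * x = (x + y) + (x - y)" "scal 2 * y = (x + y) - (x - y)" for x y
    by (simp_all add: scal_numeral mult_2)
  then have "scal 2 * ?X \<in> Q" "scal 2 * ?Y \<in> Q"
    using add[OF XY] diff[OF XY] by metis+
  then have "?X \<in> Q" "?Y \<in> Q" by (simp_all add: numeral_iff)
  moreover have "(AA - scal 2) * WW \<kappa> \<in> Q" "(AA' - scal 2) * WW \<kappa> \<in> Q"
    "(AA - scal 2) * WW' \<kappa> \<in> Q" "(AA' - scal 2) * WW' \<kappa> \<in> Q"
    unfolding AW_identities by (intro Q_intros q AW_in_L_rep)+
  ultimately show "contraction_gens \<kappa> \<subseteq> Q"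
    using q(1) unfolding contraction_gens_iff_AW by simp
next
  assume "contraction_gens \<kappa> \<subseteq> Q"
  then have g: "q1 \<in> Q" "(AA - scal 2) * WW \<kappa> \<in> Q" "(AA - scal 2) * WW' \<kappa> \<in> Q"
    "WW \<kappa> * WW \<kappa> + scal (4 * inv_kappa \<kappa>) * WW \<kappa> \<in> Q" "WW' \<kappa> * WW' \<kappa> - scal (4 * inv_kappa \<kappa>) * WW' \<kappa> \<in> Q"
    unfolding contraction_gens_iff_AW by simp_all
  note q0 = DD_square[OF g(1)]
  have "scal 4 * (DD * SS) = scal (-1) * (q1 * (scal 4 * SS)) - ((AA - scal 2) * WW \<kappa> + (AA - scal 2) * WW' \<kappa>)"
    unfolding AW_identities unfolding WW_def WW'_def by (rule poly_mapping_eqI; simp add: nc_simps)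
  also have "\<dots> \<in> Q" by (intro Q_intros g)
  finally have DS: "DD * SS \<in> Q" by (simp add: numeral_iff)
  have "scal 4 * (DD * NN) = q1 * (scal (2 * inv_kappa \<kappa>) * DD - scal 4 * NN) + scal (2 * inv_kappa \<kappa>) * (DD * DD)
      - ((AA - scal 2) * WW \<kappa> - (AA - scal 2) * WW' \<kappa>)"
    unfolding AW_identities unfolding WW_def WW'_def by (rule poly_mapping_eqI; simp add: nc_simps)
  also have "\<dots> \<in> Q" by (intro Q_intros g q0)
  finally have DN: "DD * NN \<in> Q" by (simp add: numeral_iff)
  have gen: "a = (a - b - c - d + e) + (b + c + d - e)"
    and gen': "a = (a + b + c - d + e) - (b + c - d + e)" for a b c d e :: free_alg
    by simp_all
  have "scal 8 * q5 = ((WW \<kappa> * WW \<kappa> + scal (4 * inv_kappa \<kappa>) * WW \<kappa>) + (WW' \<kappa> * WW' \<kappa> - scal (4 * inv_kappa \<kappa>) * WW' \<kappa>))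
     + (scal (8 * inv_kappa \<kappa>) * (DD * NN) + scal (4 * inv_kappa \<kappa>) * r4 + scal (4 * inv_kappa \<kappa>^2) * (q1 * DD) - scal (2 * inv_kappa \<kappa>^2) * (DD * DD))"
    unfolding AW_identities by (rule gen)
  also have "\<dots> \<in> Q" by (rule add[OF add[OF g(4,5)]]) (intro Q_intros g q0 DN)
  finally have q5: "q5 \<in> Q" by (simp only: numeral_iff)
  have "scal 16 * (SS * NN) = ((WW \<kappa> * WW \<kappa> + scal (4 * inv_kappa \<kappa>) * WW \<kappa>) - (WW' \<kappa> * WW' \<kappa> - scal (4 * inv_kappa \<kappa>) * WW' \<kappa>))
     - (scal 8 * r5 + scal (8 * inv_kappa \<kappa>) * (q1 * SS) - scal (8 * inv_kappa \<kappa>) * (DD * SS) + scal (4 * inv_kappa \<kappa>) * r1)"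
    unfolding AW_identities by (rule gen')
  also have "\<dots> \<in> Q" by (rule diff[OF diff[OF g(4,5)]]) (intro Q_intros g DS)
  finally have "SS * NN \<in> Q" by (simp only: numeral_iff)
  with g(1) DS DN q5 show "simple_gens \<kappa> \<subseteq> Q" by (simp add: simple_gens_def)
qed

end

section \<open>Five elements span modulo the limit ideal\<close>

text \<open>Combinations of the five spanning elements \<open>1\<close>, \<open>D\<close>, \<open>S\<close>, \<open>N\<close>, \<open>S\<^sup>2\<close>.\<close>

definition lin_comb :: "complex fls \<Rightarrow> complex fls \<Rightarrow> complex fls \<Rightarrow> complex fls \<Rightarrow> complex fls \<Rightarrow> free_alg" where
  "lin_comb c0 c1 c2 c3 c4 = scal c0 + scal c1 * DD + scal c2 * SS + scal c3 * NN + scal c4 * (SS * SS)"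

lemma lin_comb_add:
  "lin_comb c0 c1 c2 c3 c4 + lin_comb d0 d1 d2 d3 d4 = lin_comb (c0 + d0) (c1 + d1) (c2 + d2) (c3 + d3) (c4 + d4)"
  by (simp add: lin_comb_def scal_add algebra_simps)

lemma lin_comb_scal:
  "scal c * lin_comb c0 c1 c2 c3 c4 = lin_comb (c * c0) (c * c1) (c * c2) (c * c3) (c * c4)"
  by (simp add: lin_comb_def scal_mult_left scal_mult distrib_left)

context lattice_right_ideal begin

text \<open>The elements that are \<open>\<complex>[[h]]\<close>-combinations of the five elements modulo \<open>Q\<close>.\<close>

definition span :: "free_alg set" where
  "span = {x. \<exists>c0\<in>O_int. \<exists>c1\<in>O_int. \<exists>c2\<in>O_int. \<exists>c3\<in>O_int. \<exists>c4\<in>O_int. x - lin_comb c0 c1 c2 c3 c4 \<in> Q}"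

lemma spanI:
  assumes "x - lin_comb c0 c1 c2 c3 c4 \<in> Q" "c0 \<in> O_int" "c1 \<in> O_int" "c2 \<in> O_int" "c3 \<in> O_int" "c4 \<in> O_int"
  shows "x \<in> span"
  using assms unfolding span_def by blast

lemma spanE:
  assumes "x \<in> span"
  obtains c0 c1 c2 c3 c4 where "x - lin_comb c0 c1 c2 c3 c4 \<in> Q" "c0 \<in> O_int" "c1 \<in> O_int" "c2 \<in> O_int" "c3 \<in> O_int" "c4 \<in> O_int"
  using assms unfolding span_def by blast

lemma span_add: assumes "x \<in> span" "y \<in> span" shows "x + y \<in> span"
proof -
  from assms obtain c0 c1 c2 c3 c4 d0 d1 d2 d3 d4 where
    c: "x - lin_comb c0 c1 c2 c3 c4 \<in> Q" "c0 \<in> O_int" "c1 \<in> O_int" "c2 \<in> O_int" "c3 \<in> O_int" "c4 \<in> O_int" and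
    d: "y - lin_comb d0 d1 d2 d3 d4 \<in> Q" "d0 \<in> O_int" "d1 \<in> O_int" "d2 \<in> O_int" "d3 \<in> O_int" "d4 \<in> O_int"
    by (elim spanE)
  have "(x + y) - (lin_comb c0 c1 c2 c3 c4 + lin_comb d0 d1 d2 d3 d4) \<in> Q"
    using add[OF c(1) d(1)] by (simp add: algebra_simps)
  then show ?thesis
    unfolding lin_comb_add by (rule spanI) (intro O_add c d)+
qed

lemma span_scal_mult: assumes "c \<in> O_int" "x \<in> span" shows "scal c * x \<in> span"
proof -
  from assms(2) obtain c0 c1 c2 c3 c4 where
    c: "x - lin_comb c0 c1 c2 c3 c4 \<in> Q" "c0 \<in> O_int" "c1 \<in> O_int" "c2 \<in> O_int" "c3 \<in> O_int" "c4 \<in> O_int"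
    by (elim spanE)
  have "scal c * x - scal c * lin_comb c0 c1 c2 c3 c4 \<in> Q"
    using scal_mem[OF assms(1) c(1)] by (simp add: right_diff_distrib)
  then show ?thesis
    unfolding lin_comb_scal by (rule spanI) (intro O_mult assms(1) c)+
qed

lemma span_diff: assumes "x \<in> span" "y \<in> span" shows "x - y \<in> span"
  using span_add[OF assms(1) span_scal_mult[OF _ assms(2), of "-1"]] by (auto simp: scal_uminus)

lemma zero_in_Q: "0 \<in> Q"
  by (rule hL_rep) (simp add: hL_rep_SU SU_ideal_0)

lemma span_Q: "x \<in> Q \<Longrightarrow> x \<in> span"
  by (rule spanI[of _ 0 0 0 0 0]) (simp_all add: lin_comb_def)

lemma span_basis: "c \<in> O_int \<Longrightarrow> scal c \<in> span" "DD \<in> span" "SS \<in> span" "NN \<in> span" "SS * SS \<in> span"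
proof -
  show "scal c \<in> span" if "c \<in> O_int" by (rule spanI[of _ c 0 0 0 0]) (simp_all add: lin_comb_def that zero_in_Q)
  show "DD \<in> span" by (rule spanI[of _ 0 1 0 0 0]) (simp_all add: lin_comb_def zero_in_Q)
  show "SS \<in> span" by (rule spanI[of _ 0 0 1 0 0]) (simp_all add: lin_comb_def zero_in_Q)
  show "NN \<in> span" by (rule spanI[of _ 0 0 0 1 0]) (simp_all add: lin_comb_def zero_in_Q)
  show "SS * SS \<in> span" by (rule spanI[of _ 0 0 0 0 1]) (simp_all add: lin_comb_def zero_in_Q)
qed

lemma span_mult_right:
  assumes g: "g \<in> L_rep \<kappa>" "g \<in> span" "DD * g \<in> span" "SS * g \<in> span" "NN * g \<in> span" "SS * SS * g \<in> span" and "x \<in> span"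
  shows "x * g \<in> span"
proof -
  from \<open>x \<in> span\<close> obtain c0 c1 c2 c3 c4 where
    c: "x - lin_comb c0 c1 c2 c3 c4 \<in> Q" "c0 \<in> O_int" "c1 \<in> O_int" "c2 \<in> O_int" "c3 \<in> O_int" "c4 \<in> O_int"
    by (elim spanE)
  have eq: "x * g = (x - lin_comb c0 c1 c2 c3 c4) * g + scal c0 * g + scal c1 * (DD * g) + scal c2 * (SS * g)
      + scal c3 * (NN * g) + scal c4 * (SS * SS * g)"
    by (simp add: lin_comb_def algebra_simps)
  show ?thesis
    unfolding eq by (intro span_add span_scal_mult g span_Q[OF mult[OF c(1) g(1)]] c(2-))
qed

text \<open>Products of a spanning element with \<open>T\<close>, \<open>D\<close>, \<open>S\<close> or \<open>N\<close>. As \<open>Q\<close> is only a right ideal, the factor on the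
  right has to be moved to the left past the others before a generator of \<open>Q\<close> appears.\<close>

lemma span_mult_basis:
  assumes "simple_gens \<kappa> \<subseteq> Q"
  shows "TT \<in> span" "DD * TT \<in> span" "SS * TT \<in> span" "NN * TT \<in> span" "SS * SS * TT \<in> span"
    "DD * DD \<in> span" "SS * DD \<in> span" "NN * DD \<in> span" "SS * SS * DD \<in> span"
    "DD * SS \<in> span" "NN * SS \<in> span" "SS * SS * SS \<in> span"
    "DD * NN \<in> span" "SS * NN \<in> span" "NN * NN \<in> span" "SS * SS * NN \<in> span"
proof -
  define k where "k = inv_kappa \<kappa>"
  note [simp] = power2_eq_square
  have q: "q1 \<in> Q" "DD * SS \<in> Q" "DD * NN \<in> Q" "SS * NN \<in> Q" "q5 \<in> Q"
    using assms by (simp_all add: simple_gens_def)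
  note q = q DD_square[OF q(1)]
  note R = hL_rep_rels[of \<kappa>]
  have kO: "k \<in> O_int" "2 * k \<in> O_int" "k^2 \<in> O_int" by (auto simp: k_def)
  note r = hL_rep_mult[OF R(1) TDSN_in_L_rep(3)] hL_rep_mult[OF R(3) TDSN_in_L_rep(3)] hL_rep_mult[OF R(5) TDSN_in_L_rep(4)]
    hL_rep_mult[OF R(6) TDSN_in_L_rep(3)] hL_rep_mult[OF R(5) TDSN_in_L_rep(3)]
  note Qi = add diff scal_mem q mult[OF q(1)] mult[OF q(2)] mult[OF q(3)] mult[OF q(4)] mult[OF q(5)] mult[OF q(6)] R[THEN hL_rep] r[THEN hL_rep] L_rep_intros kO
  note si = span_add span_diff span_scal_mult span_basis O_numeral kO
  have spl: "x \<in> span" if "x = y + z" "y \<in> Q" "z \<in> span" for x y z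
    using that span_add span_Q by blast
  show "TT \<in> span"
    by (rule spl[of _ q1 "scal 2"]) (simp, intro Qi, intro si)
  show "DD * TT \<in> span"
    by (rule spl[of _ "r2 + q1 * DD" "scal 2 * DD"], rule poly_mapping_eqI, simp add: nc_simps) (intro Qi, intro si)
  show "SS * TT \<in> span"
    by (rule spl[of _ "r3 + q1 * SS" "scal 2 * SS"], rule poly_mapping_eqI, simp add: nc_simps) (intro Qi, intro si)
  show "NN * TT \<in> span"
    by (rule spl[of _ "r6 + q1 * NN + scal k * (DD * DD)" "scal 2 * NN"], rule poly_mapping_eqI, simp add: nc_simps k_def) (intro Qi, intro si)
  show "SS * SS * TT \<in> span"
    by (rule spl[of _ "SS * r3 + r3 * SS + q1 * (SS * SS)" "scal 2 * (SS * SS)"], rule poly_mapping_eqI, simp add: nc_simps) (intro Qi, intro si)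
  show "DD * DD \<in> span" "DD * SS \<in> span" "DD * NN \<in> span" "SS * NN \<in> span" by (intro span_Q q)+
  show "SS * DD \<in> span"
    by (rule spl[of _ "DD * SS - r1" "scal 0"], rule poly_mapping_eqI, simp) (intro Qi, intro si O_0)
  show "NN * DD \<in> span"
    by (rule spl[of _ "r4 + DD * NN + scal k * (q1 * DD)" "scal (2 * k) * DD"], rule poly_mapping_eqI, simp add: nc_simps k_def mult.commute) (intro Qi, intro si)
  show "SS * SS * DD \<in> span"
    by (rule spl[of _ "DD * SS * SS - r1 * SS - SS * r1" "scal 0"], rule poly_mapping_eqI, simp add: nc_simps) (intro Qi, intro si O_0)
  show "NN * SS \<in> span"
    by (rule spl[of _ "r5 + SS * NN + scal k * (q1 * SS)" "scal (2 * k) * SS"], rule poly_mapping_eqI, simp add: nc_simps k_def mult.commute) (intro Qi, intro si)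
  show "NN * NN \<in> span"
    by (rule spl[of _ "q5" "scal (2 * k) * NN - SS * SS"], rule poly_mapping_eqI, simp add: nc_simps k_def) (intro Qi, intro si)
  show "SS * SS * NN \<in> span"
    by (rule spl[of _ "SS * NN * SS - SS * r5 - scal k * (r3 * SS) - scal k * (q1 * (SS * SS))" "scal (- (2 * k)) * (SS * SS)"],
      (rule poly_mapping_eqI, simp add: nc_simps k_def; simp add: algebra_simps)[1]) (intro Qi, intro si O_uminus)
  \<comment> \<open>Multiply \<open>S\<^sup>2 + N\<^sup>2 - 2 N / \<kappa>\<close> by \<open>S\<close>: modulo \<open>Q\<close>, the terms \<open>N\<^sup>2 S\<close> and \<open>2 N S / \<kappa>\<close> cancel.\<close>
  show "SS * SS * SS \<in> span"
    by (rule spl[of _ "q5 * SS - (NN * r5 + r5 * NN + SS * NN * NN + scal k * (q1 * (SS * NN)) + scal (2 * k) * (SS * NN)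
        + scal k * (r6 * SS) + scal k * (q1 * (NN * SS)) + scal (k^2) * (DD * DD * SS))" "scal 0"],
      (rule poly_mapping_eqI, simp add: nc_simps k_def; simp add: algebra_simps)[1]) (intro Qi, intro si O_0)
qed

text \<open>The span contains \<open>1\<close> and is stable under right multiplication by \<open>\<L>\<close>.\<close>

lemma L_rep_subset_span:
  assumes "simple_gens \<kappa> \<subseteq> Q" "x \<in> L_rep \<kappa>"
  shows "x \<in> span"
proof -
  note b = span_mult_basis[OF assms(1)]
  have "\<forall>y\<in>span. y * x \<in> span"
    using assms(2)
  proof (induction rule: L_rep_induct[case_names ideal scal T D S N add mult])
    case (ideal x)
    then show ?case by (auto intro!: span_Q hL_rep hL_rep_SU SU_ideal_mult)
  next
    case (scal c)
    then show ?case using span_scal_mult[of c] by (simp only: scal_central[of c]) blast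
  next
    case T
    show ?case by (rule ballI, rule span_mult_right) (rule b span_basis(2-) TDSN_in_L_rep | assumption)+
  next
    case D
    show ?case by (rule ballI, rule span_mult_right) (rule b span_basis(2-) TDSN_in_L_rep | assumption)+
  next
    case S
    show ?case by (rule ballI, rule span_mult_right) (rule b span_basis(2-) TDSN_in_L_rep | assumption)+
  next
    case N
    show ?case by (rule ballI, rule span_mult_right) (rule b span_basis(2-) TDSN_in_L_rep | assumption)+
  next
    case (add x y)
    then show ?case by (simp add: distrib_left span_add)
  next
    case (mult x y)
    then show ?case by (simp flip: mult.assoc)
  qed
  then show ?thesis using span_basis(1)[of 1] by fastforce
qed
end

section \<open>The annihilator of the generating vector modulo \<open>h\<close>\<close>

text \<open>The eigenvalue of \<open>N\<close> at the coordinate \<open>IW\<close>, a power series with residue \<open>2 / \<kappa>\<close>.\<close>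

definition e_mu :: "real \<Rightarrow> complex fls" where "e_mu \<kappa> = (mu \<kappa> - 1 / mu \<kappa>) / hp"

lemma e_mu_eq: "e_mu \<kappa> = d_mu \<kappa> * (1 + 1 / mu \<kappa>)"
  using mu_nonzero[of \<kappa>] by (simp add: e_mu_def d_mu_def field_simps)

lemma e_mu_O [simp]: "e_mu \<kappa> \<in> O_int" and e_mu_nth_0: "fls_nth (e_mu \<kappa>) 0 = 2 * complex_of_real (1 / \<kappa>)"
  by (simp_all add: e_mu_eq nth_simps)

text \<open>The generating vector. The coordinate \<open>IZ\<close> is determined by the requirement that the generators of
  \<open>R\<^sub>+\<close> kill it; it is a power series because \<open>e_mu\<close> is a unit for \<open>\<kappa> \<noteq> 0\<close>.\<close>

definition v0 :: "real \<Rightarrow> complex fls vec5" where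
  "v0 \<kappa> i = (case i of IW \<Rightarrow> 1 | IE \<Rightarrow> 1 | IZ \<Rightarrow> - (1 + mu \<kappa>^2) / (2 * e_mu \<kappa>^2) | _ \<Rightarrow> 0)"

text \<open>The lattice \<open>\<complex>[[h]]\<^sup>5\<close>.\<close>

definition int_vec :: "complex fls vec5 set" where "int_vec = {u. \<forall>i. u i \<in> O_int}"

lemma v0_simps: "v0 \<kappa> IW = 1" "v0 \<kappa> ID = 0" "v0 \<kappa> IS = 0" "v0 \<kappa> IE = 1" "v0 \<kappa> IZ = - (1 + mu \<kappa>^2) / (2 * e_mu \<kappa>^2)"
  by (simp_all add: v0_def)

lemmas act_TDSN = act_TT act_DD act_SS act_NN[folded e_mu_def]

lemma act_TDSN_mult:
  "act \<kappa> (TT * q) u i = act \<kappa> q (act \<kappa> TT u) i" "act \<kappa> (DD * q) u i = act \<kappa> q (act \<kappa> DD u) i"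
  "act \<kappa> (SS * q) u i = act \<kappa> q (act \<kappa> SS u) i" "act \<kappa> (NN * q) u i = act \<kappa> q (act \<kappa> NN u) i"
  by (simp_all add: act_mult)

text \<open>The lattice is stable under \<open>\<L>\<close>.\<close>

lemma act_int_vec:
  assumes "x \<in> L_rep \<kappa>"
  shows "u \<in> int_vec \<Longrightarrow> act \<kappa> x u \<in> int_vec"
  using assms
proof (induction arbitrary: u rule: L_rep_induct)
  case (ideal x)
  then show ?case by (simp add: int_vec_def act_SU_ideal)
next
  case (add x y)
  then show ?case by (auto simp: int_vec_def act_add)
next
  case (mult x y)
  then show ?case by (simp add: act_mult[abs_def])
next
  case T
  have "mu \<kappa> + 1 / mu \<kappa> \<in> O_int" by (simp add: nth_simps)
  with T show ?case by (auto simp: int_vec_def act_TDSN split: idx.split intro!: O_diff O_mult)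
next
  case D
  then show ?case by (auto simp: int_vec_def act_TDSN split: idx.split intro!: O_uminus O_mult)
next
  case N
  then show ?case by (auto simp: int_vec_def act_TDSN split: idx.split intro!: O_uminus O_mult)
qed (auto simp: int_vec_def act_TDSN act_scal split: idx.split)

lemma O_hp_multiple: "u \<in> O_int \<Longrightarrow> fls_nth (hp * u) 0 = 0"
  by (simp add: nth_simps)

text \<open>The elements \<open>x\<close> of \<open>\<L>\<close> with \<open>v0 x \<in> h \<complex>[[h]]\<^sup>5\<close>.\<close>

definition lim_ker :: "real \<Rightarrow> free_alg set" where
  "lim_ker \<kappa> = {x \<in> L_rep \<kappa>. \<forall>i. fls_nth (act \<kappa> x (v0 \<kappa>) i) 0 = 0}"

context
  fixes \<kappa> :: real
  assumes kappa: "\<kappa> \<noteq> 0"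
begin

lemma e_mu_nonzero: "e_mu \<kappa> \<noteq> 0"
  using e_mu_nth_0[of \<kappa>] kappa by auto

lemma v0_int: "v0 \<kappa> \<in> int_vec"
  using kappa by (auto simp: int_vec_def v0_def nth_simps e_mu_nth_0 split: idx.split)

lemma v0_IZ_nth: "fls_nth (v0 \<kappa> IZ) 0 = - complex_of_real (\<kappa>^2) / 4"
  using kappa by (simp add: v0_simps nth_simps e_mu_nth_0 power_divide field_simps)

lemma lim_ker_right_ideal: "lattice_right_ideal \<kappa> (lim_ker \<kappa>)"
proof
  show "hL_rep \<kappa> \<subseteq> lim_ker \<kappa>"
  proof
    fix x assume x: "x \<in> hL_rep \<kappa>"
    then obtain y where y: "y \<in> L_rep \<kappa>" "x - scal hp * y \<in> SU_ideal \<kappa>" by (auto simp: hL_rep_def)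
    have "act \<kappa> x (v0 \<kappa>) i = hp * act \<kappa> y (v0 \<kappa>) i" for i
      using act_SU_ideal[OF y(2), of "v0 \<kappa>" i] by (simp add: act_diff act_scal_mult)
    moreover have "act \<kappa> y (v0 \<kappa>) i \<in> O_int" for i
      using act_int_vec[OF y(1) v0_int] by (simp add: int_vec_def)
    ultimately show "x \<in> lim_ker \<kappa>" using hL_rep_L_rep[OF x] by (simp add: lim_ker_def O_hp_multiple)
  qed
  show "x + y \<in> lim_ker \<kappa>" if "x \<in> lim_ker \<kappa>" "y \<in> lim_ker \<kappa>" for x y
    using that by (simp add: lim_ker_def act_add L_rep_add)
  show "x * y \<in> lim_ker \<kappa>" if x: "x \<in> lim_ker \<kappa>" and y: "y \<in> L_rep \<kappa>" for x y
  proof -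
    have "\<forall>i. \<exists>d\<in>O_int. act \<kappa> x (v0 \<kappa>) i = hp * d"
    proof
      fix i
      have "act \<kappa> x (v0 \<kappa>) i \<in> O_int" "fls_nth (act \<kappa> x (v0 \<kappa>) i) 0 = 0"
        using act_int_vec[of x \<kappa> "v0 \<kappa>"] v0_int x by (auto simp: int_vec_def lim_ker_def)
      then show "\<exists>d\<in>O_int. act \<kappa> x (v0 \<kappa>) i = hp * d" using O_nth_0_eq_0 by metis
    qed
    then obtain u where u: "\<And>i. u i \<in> O_int" "\<And>i. act \<kappa> x (v0 \<kappa>) i = hp * u i" by metis
    have "act \<kappa> (x * y) (v0 \<kappa>) i = hp * act \<kappa> y u i" for i
      unfolding act_mult u(2)[abs_def] by (rule act_vec_scale)
    moreover have "act \<kappa> y u i \<in> O_int" for i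
      using act_int_vec[OF y, of u] u(1) by (simp add: int_vec_def)
    ultimately show ?thesis using x y by (simp add: lim_ker_def L_rep_mult O_hp_multiple)
  qed
qed

lemma simple_gens_lim_ker: "simple_gens \<kappa> \<subseteq> lim_ker \<kappa>"
proof -
  have L: "simple_gens \<kappa> \<subseteq> L_rep \<kappa>"
    unfolding simple_gens_def by (intro insert_subsetI empty_subsetI L_rep_intros O_intros inv_kappa_O)
  have "\<forall>x\<in>simple_gens \<kappa>. fls_nth (act \<kappa> x (v0 \<kappa>) i) 0 = 0" for i
    using v0_int kappa unfolding simple_gens_def int_vec_def
    by (cases i; simp add: act_add act_diff act_scal act_scal_mult act_TDSN_mult act_TDSN nth_simps e_mu_nth_0 v0_IZ_nth v0_simps(1-4);
        simp add: field_simps power2_eq_square)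
  with L show ?thesis by (auto simp: lim_ker_def)
qed

text \<open>The five spanning elements move \<open>v0\<close> to vectors that are linearly independent modulo \<open>h\<close>.\<close>

lemma lin_comb_lim_ker:
  assumes "lin_comb c0 c1 c2 c3 c4 \<in> lim_ker \<kappa>"
    and O: "c0 \<in> O_int" "c1 \<in> O_int" "c2 \<in> O_int" "c3 \<in> O_int" "c4 \<in> O_int"
  shows "fls_nth c0 0 = 0" "fls_nth c1 0 = 0" "fls_nth c2 0 = 0" "fls_nth c3 0 = 0" "fls_nth c4 0 = 0"
proof -
  have a: "fls_nth (act \<kappa> (lin_comb c0 c1 c2 c3 c4) (v0 \<kappa>) i) 0 = 0" for i
    using assms(1) by (simp add: lim_ker_def)
  have "v0 \<kappa> IZ \<in> O_int" using v0_int by (simp add: int_vec_def)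
  note s = lin_comb_def act_add act_diff act_scal act_scal_mult act_TDSN_mult act_TDSN nth_simps e_mu_nth_0 v0_simps(1-4) this
  show 0: "fls_nth c0 0 = 0" and "fls_nth c1 0 = 0" and "fls_nth c2 0 = 0"
    using a[of IE] a[of ID] a[of IS] O by (simp_all add: s)
  show 3: "fls_nth c3 0 = 0" using a[of IW] 0 O kappa by (simp add: s)
  show "fls_nth c4 0 = 0" using a[of IZ] 0 3 O kappa by (simp add: s)
qed

lemma lin_comb_hL_rep:
  assumes "c0 \<in> O_int" "c1 \<in> O_int" "c2 \<in> O_int" "c3 \<in> O_int" "c4 \<in> O_int"
    "fls_nth c0 0 = 0" "fls_nth c1 0 = 0" "fls_nth c2 0 = 0" "fls_nth c3 0 = 0" "fls_nth c4 0 = 0"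
  shows "lin_comb c0 c1 c2 c3 c4 \<in> hL_rep \<kappa>"
  unfolding lin_comb_def using hL_rep_scal[of c0 1 \<kappa>] assms
  by (intro hL_rep_add hL_rep_scal L_rep_intros) (auto simp: L_rep_1)

text \<open>Apply the spanning property to \<open>Q \<inter> lim_ker\<close>: the combination that represents an element of
  \<open>lim_ker\<close> lies in \<open>lim_ker\<close> itself, so its coefficients vanish modulo \<open>h\<close>.\<close>

lemma lim_ker_minimal:
  assumes "lattice_right_ideal \<kappa> Q" "simple_gens \<kappa> \<subseteq> Q"
  shows "lim_ker \<kappa> \<subseteq> Q"
proof
  fix x assume x: "x \<in> lim_ker \<kappa>"
  interpret Q: lattice_right_ideal \<kappa> Q by fact
  interpret K: lattice_right_ideal \<kappa> "lim_ker \<kappa>" by (rule lim_ker_right_ideal)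
  interpret QK: lattice_right_ideal \<kappa> "Q \<inter> lim_ker \<kappa>"
    by unfold_locales (use Q.hL_rep_subset K.hL_rep_subset Q.add K.add Q.mult K.mult in auto)
  have "x \<in> QK.span"
    by (rule QK.L_rep_subset_span) (use assms(2) simple_gens_lim_ker x in \<open>auto simp: lim_ker_def\<close>)
  then obtain c0 c1 c2 c3 c4 where c: "x - lin_comb c0 c1 c2 c3 c4 \<in> Q \<inter> lim_ker \<kappa>"
    "c0 \<in> O_int" "c1 \<in> O_int" "c2 \<in> O_int" "c3 \<in> O_int" "c4 \<in> O_int"
    by (rule QK.spanE)
  have "lin_comb c0 c1 c2 c3 c4 \<in> lim_ker \<kappa>"
    using K.diff[OF x, of "x - lin_comb c0 c1 c2 c3 c4"] c(1) by simp
  from lin_comb_hL_rep[OF c(2-) lin_comb_lim_ker[OF this c(2-)]] have "lin_comb c0 c1 c2 c3 c4 \<in> Q"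
    by (rule Q.hL_rep)
  with Q.add[OF _ this, of "x - lin_comb c0 c1 c2 c3 c4"] c(1) show "x \<in> Q" by simp
qed

text \<open>The lattice is \<open>v0 \<L>\<close>.\<close>

lemma int_vec_image:
  assumes "u \<in> int_vec"
  obtains y where "y \<in> L_rep \<kappa>" "act \<kappa> y (v0 \<kappa>) = u"
proof -
  \<comment> \<open>The solution of the triangular system for the coefficients of \<open>1\<close>, \<open>D\<close>, \<open>S\<close>, \<open>N\<close>, \<open>S\<^sup>2\<close>. The series \<open>e_mu\<close> is a unit.\<close>
  define c3 where "c3 = (u IW - u IE) / e_mu \<kappa>"
  define c4 where "c4 = (u IZ - u IE * v0 \<kappa> IZ + c3 * e_mu \<kappa> * v0 \<kappa> IZ) / 2"
  define y where "y = lin_comb (u IE) (u ID) (u IS) c3 c4"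
  have u: "u i \<in> O_int" for i using assms by (simp add: int_vec_def)
  have v: "v0 \<kappa> IZ \<in> O_int" using v0_int by (simp add: int_vec_def)
  have c3: "c3 \<in> O_int" using kappa by (simp add: c3_def nth_simps e_mu_nth_0 u)
  have c4: "c4 \<in> O_int" by (simp add: c4_def nth_simps u v c3)
  have "y \<in> L_rep \<kappa>" unfolding y_def lin_comb_def by (intro L_rep_intros u c3 c4)
  moreover have "act \<kappa> y (v0 \<kappa>) i = u i" for i
  proof (cases i)
    case IW
    then show ?thesis using e_mu_nonzero
      by (simp add: y_def lin_comb_def act_add act_scal act_scal_mult act_TDSN_mult act_TDSN v0_simps(1-4) c3_def)
  next
    case IZ
    have "c4 * 2 = u IZ - u IE * v0 \<kappa> IZ + c3 * e_mu \<kappa> * v0 \<kappa> IZ" by (simp add: c4_def)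
    then show ?thesis using IZ
      by (simp add: y_def lin_comb_def act_add act_scal act_scal_mult act_TDSN_mult act_TDSN v0_simps(1-4) algebra_simps)
  qed (simp_all add: y_def lin_comb_def act_add act_scal act_scal_mult act_TDSN_mult act_TDSN v0_simps(1-4))
  ultimately show ?thesis using that by blast
qed

end

section \<open>The right ideal \<open>R\<^sub>+\<close> as an annihilator\<close>

lemma right_ideal_Inter:
  assumes R: "ring R" and "F \<noteq> {}" and "\<And>I. I \<in> F \<Longrightarrow> right_ideal I R"
  shows "right_ideal (\<Inter>F) R"
proof -
  interpret ring R by fact
  have "subgroup (\<Inter>F) (add_monoid R)"
    using assms(2,3) by (intro add.subgroups_Inter) (auto simp: right_ideal_def additive_subgroup_def)
  then show ?thesis
    using assms(2,3) by (auto simp: right_ideal_def additive_subgroup_def)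
qed

lemma right_ideal_gen:
  assumes R: "ring R" and S: "S \<subseteq> carrier R"
  shows right_ideal_right_ideal_gen: "right_ideal (right_ideal_gen R S) R"
    and right_ideal_gen_superset: "S \<subseteq> right_ideal_gen R S"
proof -
  interpret ring R by fact
  have "right_ideal (carrier R) R"
    using add.subgroup_self by (auto simp: right_ideal_def additive_subgroup_def)
  then show "right_ideal (right_ideal_gen R S) R"
    unfolding right_ideal_gen_def using S by (intro right_ideal_Inter[OF R]) auto
qed (auto simp: right_ideal_gen_def)

lemma right_ideal_gen_minimal: "right_ideal I R \<Longrightarrow> S \<subseteq> I \<Longrightarrow> right_ideal_gen R S \<subseteq> I"
  by (auto simp: right_ideal_gen_def)

text \<open>The generators of \<open>R\<^sub>+\<close>, expanded into monomials.\<close>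

definition R_plus_gens :: "real \<Rightarrow> free_alg set" where
  "R_plus_gens \<kappa> = (let m = mu \<kappa>; c = (1 + m ^ 4) / m; s = gen Sigma; s' = gen Sigma'; r = gen Rho; r' = gen Rho' in
   {r * r, r * s - r * s', s * s + scal (m^2) * (s' * s') + scal ((1 + m^2)^2) * (r * r') - scal (1 + m^2),
    r' * r', r' * s - r' * s',
    scal (m^2) * (s * r) + s' * r - scal c * r, scal (m^2) * (s * r') + s' * r' - scal c * r',
    scal (m^2) * (s * s) - scal (m^2) * (s * s') + s' * s - s' * s' - scal c * s + scal c * s',
    scal (m^4) * (s * s) + scal (m^2) * (s * s' + s' * s) + s' * s' - scal ((c + 1 + m^2) * m^2) * s
     - scal (c + 1 + m^2) * s' + scal (c * (1 + m^2))})"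

lemma R_plus_eq: "R_plus \<kappa> = right_ideal_gen (SU \<kappa>) (su \<kappa> ` R_plus_gens \<kappa>)"
proof -
  have 1: "1 + scal x = scal (1 + x)" for x by (simp add: scal_add)
  show ?thesis
    unfolding R_plus_def R_plus_gens_def Let_def scal_power 1
    by (rule arg_cong[where f = "\<lambda>G. right_ideal_gen (SU \<kappa>) (su \<kappa> ` G)"], intro arg_cong2[where f = insert] refl;
        rule poly_mapping_eqI; simp add: power2_eq_square[of "gen _"] nc_simps;
        simp add: algebra_simps flip: power_add)
qed

text \<open>The preimage of \<open>R\<^sub>+\<close> in the free algebra.\<close>

definition R_plus_rep :: "real \<Rightarrow> free_alg set" where "R_plus_rep \<kappa> = {x. su \<kappa> x \<in> R_plus \<kappa>}"

lemma R_plus_right_ideal: "right_ideal (R_plus \<kappa>) (SU \<kappa>)"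
  unfolding R_plus_eq by (rule right_ideal_right_ideal_gen[OF ring_SU]) (auto simp: su_closed)

lemma R_plus_gens_rep: "R_plus_gens \<kappa> \<subseteq> R_plus_rep \<kappa>"
proof -
  have "su \<kappa> ` R_plus_gens \<kappa> \<subseteq> carrier (SU \<kappa>)" by (auto simp: su_closed)
  from right_ideal_gen_superset[OF ring_SU this] show ?thesis by (auto simp: R_plus_rep_def R_plus_eq)
qed

lemma R_plus_rep_add: "x \<in> R_plus_rep \<kappa> \<Longrightarrow> y \<in> R_plus_rep \<kappa> \<Longrightarrow> x + y \<in> R_plus_rep \<kappa>"
  using R_plus_right_ideal[of \<kappa>] additive_subgroup.a_closed[of "R_plus \<kappa>" "SU \<kappa>"]
  by (force simp: R_plus_rep_def right_ideal_def simp flip: su_add)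

lemma R_plus_rep_mult: "x \<in> R_plus_rep \<kappa> \<Longrightarrow> x * y \<in> R_plus_rep \<kappa>"
  using R_plus_right_ideal[of \<kappa>] by (force simp: R_plus_rep_def right_ideal_def su_closed simp flip: su_mult)

lemma R_plus_rep_SU: "x \<in> SU_ideal \<kappa> \<Longrightarrow> x \<in> R_plus_rep \<kappa>"
  using R_plus_right_ideal[of \<kappa>] additive_subgroup.zero_closed[of "R_plus \<kappa>" "SU \<kappa>"] su_eq_iff[of \<kappa> x 0]
  by (simp add: R_plus_rep_def right_ideal_def su_zero)

lemma R_plus_rep_scal: "x \<in> R_plus_rep \<kappa> \<Longrightarrow> scal c * x \<in> R_plus_rep \<kappa>"
  using R_plus_rep_mult[of x \<kappa> "scal c"] by (simp add: scal_central)

text \<open>The generators of \<open>R\<^sub>+\<close> kill the vector \<open>v0\<close>. Here \<open>n\<close> stands for \<open>1 / m\<close>, \<open>e\<close> for \<open>e_mu\<close>, and \<open>b\<close> for the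
  coordinate \<open>IZ\<close> of \<open>v0\<close>.\<close>

lemma gens_kill_generic:
  fixes m n h b e :: "'a::field_char_0"
  assumes mn: "m * n = 1" and b: "2 * e^2 * b = - (1 + m^2)" and e: "e * h = m - n"
    and v: "v IW = 1" "v ID = 0" "v IS = 0" "v IE = 1" "v IZ = b"
  defines "L \<equiv> letter_act m h" and "c \<equiv> (1 + m ^ 4) / m"
  shows "L Rho (L Rho v) i = 0" "L Sigma (L Rho v) i = L Sigma' (L Rho v) i"
    "L Sigma (L Sigma v) i + m^2 * L Sigma' (L Sigma' v) i + (1 + m^2)^2 * L Rho' (L Rho v) i - (1 + m^2) * v i = 0"
    "L Rho' (L Rho' v) i = 0" "L Sigma (L Rho' v) i = L Sigma' (L Rho' v) i"
    "m^2 * L Rho (L Sigma v) i + L Rho (L Sigma' v) i - c * L Rho v i = 0"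
    "m^2 * L Rho' (L Sigma v) i + L Rho' (L Sigma' v) i - c * L Rho' v i = 0"
    "m^2 * L Sigma (L Sigma v) i - m^2 * L Sigma' (L Sigma v) i + L Sigma (L Sigma' v) i - L Sigma' (L Sigma' v) i - c * L Sigma v i + c * L Sigma' v i = 0"
    "m^4 * L Sigma (L Sigma v) i + m^2 * (L Sigma' (L Sigma v) i + L Sigma (L Sigma' v) i) + L Sigma' (L Sigma' v) i
       - (c + 1 + m^2) * m^2 * L Sigma v i - (c + 1 + m^2) * L Sigma' v i + c * (1 + m^2) * v i = 0"
proof -
  define k where "k = h^2 * m / 2"
  have m0: "m \<noteq> 0" using mn by auto
  have n: "x / m = n * x" for x using mn m0 by (simp add: field_simps)
  have k: "h^2 * m * x / 2 = k * x" "h^2 * m / 2 = k" for x by (simp_all add: k_def)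
  have c: "c = n + m^3" using mn unfolding c_def n by (simp add: power4_eq_xxxx power3_eq_cube algebra_simps)
  \<comment> \<open>The only relation between \<open>b\<close> and \<open>h\<close> that the computation uses.\<close>
  have rel: "(m - n)^2 * b = - (m + n) * k"
  proof -
    have "2 * ((m - n)^2 * b) = h^2 * (2 * e^2 * b)" by (simp add: e[symmetric] power_mult_distrib)
    also have "\<dots> = - (1 + m^2) * h^2" unfolding b by simp
    also have "\<dots> = 2 * (- (m + n) * k)" unfolding k_def using mn by (simp add: power2_eq_square algebra_simps)
    finally show ?thesis by (simp only: mult_cancel_left) simp
  qed
  have hh: "h^2 = 2 * n * k" using mn by (simp add: k_def mult.commute)
  have mn': "m * (n * x) = x" for x using mn by (simp flip: mult.assoc)
  have rel1: "b * (m * m) = 2 * b - b * (n * n) - k * m - k * n"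
    using rel mn by (simp add: power2_eq_square algebra_simps)
  have rel2: "b * (m * (m * x)) = 2 * (b * x) - b * (n * (n * x)) - k * (m * x) - k * (n * x)" for x
    using arg_cong[OF rel1, of "\<lambda>y. y * x"] by (simp add: algebra_simps)
  note A = power2_eq_square power3_eq_cube power4_eq_xxxx algebra_simps mn mn' rel1 rel2
  define s s' r r' where "s = L Sigma v" and "s' = L Sigma' v" and "r = L Rho v" and "r' = L Rho' v"
  have s: "s IW = m" "s ID = 0" "s IS = 0" "s IE = 1" "s IZ = n * b - k"
    and s': "s' IW = n" "s' ID = 0" "s' IS = 0" "s' IE = 1" "s' IZ = m * b - k"
    and r: "r IW = 0" "r ID = 1 / 2" "r IS = h / 2" "r IE = 0" "r IZ = 0"
    and r': "r' IW = 0" "r' ID = - 1 / 2" "r' IS = h / 2" "r' IE = 0" "r' IZ = 0"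
    by (simp_all add: s_def s'_def r_def r'_def L_def v n k_def letter_act.simps)
  note S = letter_act.simps s s' r r' v n k
  note fold = s_def[symmetric] s'_def[symmetric] r_def[symmetric] r'_def[symmetric]
  show "L Rho (L Rho v) i = 0" "L Sigma (L Rho v) i = L Sigma' (L Rho v) i"
     "L Rho' (L Rho' v) i = 0" "L Sigma (L Rho' v) i = L Sigma' (L Rho' v) i"
    unfolding fold by (cases i; simp add: L_def S power2_eq_square)+
  show "m^2 * L Rho (L Sigma v) i + L Rho (L Sigma' v) i - c * L Rho v i = 0"
    "m^2 * L Rho' (L Sigma v) i + L Rho' (L Sigma' v) i - c * L Rho' v i = 0"
    unfolding fold c unfolding L_def using mn by (cases i; simp add: S power3_eq_cube power2_eq_square algebra_simps; algebra?)+
  have q: "letter_act m h Rho' r IZ = 2 * n * k"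
    unfolding hh[symmetric] by (simp add: S power2_eq_square)
  show "L Sigma (L Sigma v) i + m^2 * L Sigma' (L Sigma' v) i + (1 + m^2)^2 * L Rho' (L Rho v) i - (1 + m^2) * v i = 0"
  proof (cases "i = IZ")
    case True
    have "n * (n * b - k) - k * m + m^2 * (m * (m * b - k) - k * n) + (1 + m^2)^2 * (2 * n * k) - (1 + m^2) * b = 0"
      by (simp add: A)
    then show ?thesis unfolding fold True unfolding L_def q by (simp add: S)
  next
    case False
    then show ?thesis unfolding fold unfolding L_def by (cases i; simp add: S; simp add: A)
  qed
  show "m^2 * L Sigma (L Sigma v) i - m^2 * L Sigma' (L Sigma v) i + L Sigma (L Sigma' v) i - L Sigma' (L Sigma' v) i - c * L Sigma v i + c * L Sigma' v i = 0"
  proof (cases "i = IZ")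
    case True
    have "m^2 * (n * (n * b - k) - k * m) - m^2 * (m * (n * b - k) - k * m) + (n * (m * b - k) - k * n) - (m * (m * b - k) - k * n) - (n + m^3) * (n * b - k) + (n + m^3) * (m * b - k) = 0"
      by (simp add: A)
    then show ?thesis unfolding fold c True unfolding L_def by (simp add: S)
  next
    case False
    then show ?thesis unfolding fold c unfolding L_def by (cases i; simp add: S; simp add: A)
  qed
  show "m^4 * L Sigma (L Sigma v) i + m^2 * (L Sigma' (L Sigma v) i + L Sigma (L Sigma' v) i) + L Sigma' (L Sigma' v) i
       - (c + 1 + m^2) * m^2 * L Sigma v i - (c + 1 + m^2) * L Sigma' v i + c * (1 + m^2) * v i = 0"
  proof (cases "i = IZ")
    case True
    have "m^4 * (n * (n * b - k) - k * m) + m^2 * ((m * (n * b - k) - k * m) + (n * (m * b - k) - k * n)) + (m * (m * b - k) - k * n)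
       - (n + m^3 + 1 + m^2) * m^2 * (n * b - k) - (n + m^3 + 1 + m^2) * (m * b - k) + (n + m^3) * (1 + m^2) * b = 0"
      by (simp add: A)
    then show ?thesis unfolding fold c True unfolding L_def by (simp add: S)
  next
    case False
    then show ?thesis unfolding fold c unfolding L_def by (cases i; simp add: S; simp add: A)
  qed
qed

lemma R_plus_gens_kill:
  assumes kappa: "\<kappa> \<noteq> 0" and "x \<in> R_plus_gens \<kappa>"
  shows "act \<kappa> x (v0 \<kappa>) i = 0"
proof -
  define m where "m = mu \<kappa>"
  have 1: "m * (1 / m) = 1" using mu_nonzero by (simp add: m_def)
  have 2: "2 * e_mu \<kappa>^2 * v0 \<kappa> IZ = - (1 + m^2)"
    using e_mu_nonzero[OF kappa] by (simp add: v0_simps m_def)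
  have 3: "e_mu \<kappa> * hp = m - 1 / m" by (simp add: e_mu_def m_def)
  note g = gens_kill_generic[OF 1 2 3, where v = "v0 \<kappa>", OF v0_simps(1-4) refl]
  show ?thesis
    using assms(2) unfolding R_plus_gens_def Let_def m_def[symmetric]
    by (elim insertE emptyE; simp only: act_zero act_add act_diff act_uminus act_one act_scal act_scal_mult
        act_gen act_gen_mult m_def[symmetric]; (simp only: g diff_self)?)
qed

lemma R_plus_rep_kills:
  assumes kappa: "\<kappa> \<noteq> 0" and "x \<in> R_plus_rep \<kappa>"
  shows "act \<kappa> x (v0 \<kappa>) i = 0"
proof -
  let ?I = "su \<kappa> ` {x. \<forall>i. act \<kappa> x (v0 \<kappa>) i = 0}"
  have "additive_subgroup ?I (SU \<kappa>)"
  proof (unfold additive_subgroup_def, rule group.subgroupI)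
    show "group (add_monoid (SU \<kappa>))"
      using abelian_group.a_group[OF ring.is_abelian_group[OF ring_SU]] .
    show "?I \<noteq> {}" using act_zero by blast
    fix p assume "p \<in> ?I"
    then obtain x where x: "p = su \<kappa> x" "\<forall>i. act \<kappa> x (v0 \<kappa>) i = 0" by blast
    then have "\<forall>i. act \<kappa> (- x) (v0 \<kappa>) i = 0" by (simp add: act_uminus)
    then show "inv\<^bsub>add_monoid (SU \<kappa>)\<^esub> p \<in> ?I"
      using x(1) su_uminus[of \<kappa> x] by (simp add: a_inv_def)
    fix q assume "q \<in> ?I"
    then obtain y where y: "q = su \<kappa> y" "\<forall>i. act \<kappa> y (v0 \<kappa>) i = 0" by blast
    have "\<forall>i. act \<kappa> (x + y) (v0 \<kappa>) i = 0" using x y by (simp add: act_add)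
    then show "p \<otimes>\<^bsub>add_monoid (SU \<kappa>)\<^esub> q \<in> ?I"
      using x(1) y(1) by (simp add: su_add)
  qed (auto simp: su_closed)
  then have "right_ideal ?I (SU \<kappa>)"
    by (auto simp: right_ideal_def carrier_SU su_mult act_mult_eq_0)
  moreover have "su \<kappa> ` R_plus_gens \<kappa> \<subseteq> ?I"
    using R_plus_gens_kill[OF kappa] by auto
  ultimately have "R_plus \<kappa> \<subseteq> ?I" unfolding R_plus_eq by (rule right_ideal_gen_minimal)
  with assms(2) obtain y where y: "su \<kappa> x = su \<kappa> y" "\<forall>i. act \<kappa> y (v0 \<kappa>) i = 0" by (auto simp: R_plus_rep_def)
  then have "act \<kappa> (x - y) (v0 \<kappa>) i = 0" using act_SU_ideal by (simp add: su_eq_iff)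
  with y(2) show ?thesis by (simp add: act_diff)
qed

text \<open>Polynomials of degree at most one in the letters.\<close>

definition affine :: "complex fls \<Rightarrow> complex fls \<Rightarrow> complex fls \<Rightarrow> complex fls \<Rightarrow> complex fls \<Rightarrow> free_alg" where
  "affine c0 c1 c2 c3 c4 = scal c0 + scal c1 * gen Sigma + scal c2 * gen Sigma' + scal c3 * gen Rho + scal c4 * gen Rho'"

text \<open>The elements that are of degree at most one modulo \<open>R\<^sub>+\<close>.\<close>

definition letter_span :: "real \<Rightarrow> free_alg set" where
  "letter_span \<kappa> = {x. \<exists>c0 c1 c2 c3 c4. x - affine c0 c1 c2 c3 c4 \<in> R_plus_rep \<kappa>}"

lemma affine_add: "affine c0 c1 c2 c3 c4 + affine d0 d1 d2 d3 d4 = affine (c0 + d0) (c1 + d1) (c2 + d2) (c3 + d3) (c4 + d4)"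
  by (simp add: affine_def scal_add algebra_simps)

lemma affine_scal: "scal c * affine c0 c1 c2 c3 c4 = affine (c * c0) (c * c1) (c * c2) (c * c3) (c * c4)"
  by (simp add: affine_def scal_mult_left scal_mult distrib_left)

lemma letter_span_add: assumes "x \<in> letter_span \<kappa>" "y \<in> letter_span \<kappa>" shows "x + y \<in> letter_span \<kappa>"
proof -
  from assms obtain c0 c1 c2 c3 c4 d0 d1 d2 d3 d4 where
    "x - affine c0 c1 c2 c3 c4 \<in> R_plus_rep \<kappa>" "y - affine d0 d1 d2 d3 d4 \<in> R_plus_rep \<kappa>"
    unfolding letter_span_def by blast
  from R_plus_rep_add[OF this] have "(x + y) - (affine c0 c1 c2 c3 c4 + affine d0 d1 d2 d3 d4) \<in> R_plus_rep \<kappa>"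
    by (simp add: algebra_simps)
  then show ?thesis unfolding affine_add letter_span_def by blast
qed

lemma letter_span_scal_mult: assumes "x \<in> letter_span \<kappa>" shows "scal c * x \<in> letter_span \<kappa>"
proof -
  from assms obtain c0 c1 c2 c3 c4 where "x - affine c0 c1 c2 c3 c4 \<in> R_plus_rep \<kappa>"
    unfolding letter_span_def by blast
  from R_plus_rep_scal[OF this, of c] have "scal c * x - scal c * affine c0 c1 c2 c3 c4 \<in> R_plus_rep \<kappa>"
    by (simp add: right_diff_distrib)
  then show ?thesis unfolding affine_scal letter_span_def by blast
qed

lemma letter_span_diff: "x \<in> letter_span \<kappa> \<Longrightarrow> y \<in> letter_span \<kappa> \<Longrightarrow> x - y \<in> letter_span \<kappa>"
  using letter_span_add[of x \<kappa> "scal (-1) * y"] letter_span_scal_mult[of y \<kappa> "-1"] by (simp add: scal_uminus)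

lemma letter_span_R_plus_rep: "x \<in> R_plus_rep \<kappa> \<Longrightarrow> x \<in> letter_span \<kappa>"
  unfolding letter_span_def by (intro CollectI exI[of _ 0]) (simp add: affine_def)

lemma letter_span_scal: "scal c \<in> letter_span \<kappa>"
  unfolding letter_span_def
  by (intro CollectI exI[of _ c] exI[of _ 0]) (simp add: affine_def R_plus_rep_SU SU_ideal_0)

lemma letter_span_gen: "gen x \<in> letter_span \<kappa>"
proof -
  have "\<exists>c1 c2 c3 c4. gen x = affine 0 c1 c2 c3 c4"
  proof (cases x)
    case Sigma
    then show ?thesis by (intro exI[of _ 1] exI[of _ 0]) (simp add: affine_def)
  next
    case Sigma'
    then have "gen x = affine 0 0 1 0 0" by (simp add: affine_def)
    then show ?thesis by blast
  next
    case Rho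
    then have "gen x = affine 0 0 0 1 0" by (simp add: affine_def)
    then show ?thesis by blast
  next
    case Rho'
    then have "gen x = affine 0 0 0 0 1" by (simp add: affine_def)
    then show ?thesis by blast
  qed
  then show ?thesis unfolding letter_span_def
    by (metis (mono_tags, lifting) CollectI R_plus_rep_SU SU_ideal_0 cancel_comm_monoid_add_class.diff_cancel)
qed

lemma letter_span_cancel:
  assumes "c \<noteq> 0" "scal c * x \<in> letter_span \<kappa>" shows "x \<in> letter_span \<kappa>"
  using letter_span_scal_mult[OF assms(2), of "1 / c"] assms(1) by (simp add: scal_mult_left)

text \<open>Modulo \<open>R\<^sub>+\<close>, all sixteen quadratic monomials reduce to degree at most one. The relations and the
  generators are linear equations for these monomials; the determinants that have to be inverted are
  power series in \<open>h\<close> with nonzero residue.\<close>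

lemma letter_span_quadratic: "gen x * gen y \<in> letter_span \<kappa>"
proof -
  define m where "m = mu \<kappa>"
  define c where "c = (1 + m ^ 4) / m"
  let ?s = "gen Sigma" and ?s' = "gen Sigma'" and ?r = "gen Rho" and ?r' = "gen Rho'"
  have m: "m \<noteq> 0" using mu_nonzero by (simp add: m_def)
  have nz: "1 + m ^ 4 \<noteq> 0" "1 + m^2 \<noteq> 0" "1 + m ^ 8 + m^2 * (1 + m^2)^2 \<noteq> 0"
  proof -
    have nz: "x \<noteq> 0" if "fls_nth x 0 \<noteq> 0" for x :: "complex fls" using that by auto
    show "1 + m ^ 4 \<noteq> 0" "1 + m^2 \<noteq> 0" "1 + m ^ 8 + m^2 * (1 + m^2)^2 \<noteq> 0"
      by (rule nz, simp add: m_def nth_simps)+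
  qed
  have c0: "c \<noteq> 0" using m nz by (simp add: c_def)
  note P = R_plus_gens_rep[of \<kappa>, unfolded R_plus_gens_def Let_def insert_subset, folded m_def, folded c_def]
  have g: "?r * ?r \<in> letter_span \<kappa>" "?r * ?s - ?r * ?s' \<in> letter_span \<kappa>"
    "?s * ?s + scal (m^2) * (?s' * ?s') + scal ((1 + m^2)^2) * (?r * ?r') - scal (1 + m^2) \<in> letter_span \<kappa>"
    "?r' * ?r' \<in> letter_span \<kappa>" "?r' * ?s - ?r' * ?s' \<in> letter_span \<kappa>"
    "scal (m^2) * (?s * ?r) + ?s' * ?r - scal c * ?r \<in> letter_span \<kappa>" "scal (m^2) * (?s * ?r') + ?s' * ?r' - scal c * ?r' \<in> letter_span \<kappa>"
    "scal (m^2) * (?s * ?s) - scal (m^2) * (?s * ?s') + ?s' * ?s - ?s' * ?s' - scal c * ?s + scal c * ?s' \<in> letter_span \<kappa>"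
    "scal (m^4) * (?s * ?s) + scal (m^2) * (?s * ?s' + ?s' * ?s) + ?s' * ?s' - scal ((c + 1 + m^2) * m^2) * ?s
     - scal (c + 1 + m^2) * ?s' + scal (c * (1 + m^2)) \<in> letter_span \<kappa>"
    using P by (auto intro: letter_span_R_plus_rep)
  have J: "x \<in> letter_span \<kappa>" if "x \<in> SU_ideal \<kappa>" for x using that by (simp add: letter_span_R_plus_rep R_plus_rep_SU)
  note i = SU_rels(2,3)[of \<kappa>, THEN J, folded m_def] SU_rels'[of \<kappa>, THEN J, folded m_def]
  note si = letter_span_add letter_span_diff letter_span_scal_mult letter_span_scal letter_span_gen
  let ?a = "scal m * ((?r - ?r') * ?s) - ?s * (?r - ?r')" and ?b = "scal m * ((?r + ?r') * ?s) - ?s * (?r + ?r')"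
  let ?a' = "scal m * (?s' * (?r - ?r')) - (?r - ?r') * ?s'" and ?b' = "scal m * (?s' * (?r + ?r')) - (?r + ?r') * ?s'"
  have "scal m * (?r * ?s) - ?s * ?r = scal (1/2) * (?b + ?a)" "scal m * (?r' * ?s) - ?s * ?r' = scal (1/2) * (?b - ?a)"
   "scal m * (?s' * ?r) - ?r * ?s' = scal (1/2) * (?b' + ?a')" "scal m * (?s' * ?r') - ?r' * ?s' = scal (1/2) * (?b' - ?a')"
    by (rule poly_mapping_eqI; simp add: nc_simps; simp add: algebra_simps)+
  then have j: "scal m * (?r * ?s) - ?s * ?r \<in> letter_span \<kappa>" "scal m * (?r' * ?s) - ?s * ?r' \<in> letter_span \<kappa>"
    "scal m * (?s' * ?r) - ?r * ?s' \<in> letter_span \<kappa>" "scal m * (?s' * ?r') - ?r' * ?s' \<in> letter_span \<kappa>"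
    by (simp_all only:) (intro letter_span_scal_mult letter_span_add letter_span_diff i)+
  \<comment> \<open>The generator \<open>t \<rho>\<close> determines \<open>\<rho> \<sigma>\<close>, because \<open>\<sigma> \<rho>\<close>, \<open>\<sigma>\<^sup>* \<rho>\<close> and \<open>\<rho> \<sigma>\<^sup>*\<close> are multiples of it modulo \<open>R\<^sub>+\<close>.\<close>
  have rs: "\<rho> * ?s \<in> letter_span \<kappa> \<and> \<rho> * ?s' \<in> letter_span \<kappa> \<and> ?s * \<rho> \<in> letter_span \<kappa> \<and> ?s' * \<rho> \<in> letter_span \<kappa>"
    if 1: "\<rho> * ?s - \<rho> * ?s' \<in> letter_span \<kappa>" and 2: "scal (m^2) * (?s * \<rho>) + ?s' * \<rho> - scal c * \<rho> \<in> letter_span \<kappa>"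
      and 3: "scal m * (\<rho> * ?s) - ?s * \<rho> \<in> letter_span \<kappa>" and 4: "scal m * (?s' * \<rho>) - \<rho> * ?s' \<in> letter_span \<kappa>" and 5: "\<rho> \<in> letter_span \<kappa>" for \<rho>
  proof -
    have "scal c * (\<rho> * ?s) = (scal (m^2) * (?s * \<rho>) + ?s' * \<rho> - scal c * \<rho>) + scal c * \<rho>
       + scal (m^2) * (scal m * (\<rho> * ?s) - ?s * \<rho>) - scal (1 / m) * (scal m * (?s' * \<rho>) - \<rho> * ?s') + scal (1 / m) * (\<rho> * ?s - \<rho> * ?s')"
      by (rule poly_mapping_eqI; simp add: nc_simps c_def; use m in \<open>simp add: field_simps power4_eq_xxxx power2_eq_square\<close>)
    also have "\<dots> \<in> letter_span \<kappa>" by (intro letter_span_add[of _ _ "scal (1 / m) * _"] letter_span_diff letter_span_add[OF letter_span_add[OF 2 letter_span_scal_mult[OF 5]]] letter_span_scal_mult 1 3 4)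
    finally have a: "\<rho> * ?s \<in> letter_span \<kappa>" by (rule letter_span_cancel[OF c0])
    have b: "\<rho> * ?s' \<in> letter_span \<kappa>" using letter_span_diff[OF a 1] by simp
    have "?s * \<rho> \<in> letter_span \<kappa>" using letter_span_diff[OF letter_span_scal_mult[OF a, of m] 3] by simp
    moreover have "scal m * (?s' * \<rho>) \<in> letter_span \<kappa>" using letter_span_add[OF 4 b] by simp
    ultimately show ?thesis using a b letter_span_cancel[OF m] by blast
  qed
  note r1 = rs[OF g(2) g(6) j(1) j(3) letter_span_gen] and r2 = rs[OF g(5) g(7) j(2) j(4) letter_span_gen]
  note k = SU_rels(4,5)[of \<kappa>, THEN J, folded m_def]
  let ?k = "?s * ?s' + scal (m^2) * (?r * ?r') - 1" and ?k' = "?s' * ?s + ?r * ?r' - 1"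
  let ?g3 = "?s * ?s + scal (m^2) * (?s' * ?s') + scal ((1 + m^2)^2) * (?r * ?r') - scal (1 + m^2)"
  let ?g8 = "scal (m^2) * (?s * ?s) - scal (m^2) * (?s * ?s') + ?s' * ?s - ?s' * ?s' - scal c * ?s + scal c * ?s'"
  let ?g9 = "scal (m^4) * (?s * ?s) + scal (m^2) * (?s * ?s' + ?s' * ?s) + ?s' * ?s' - scal ((c + 1 + m^2) * m^2) * ?s
     - scal (c + 1 + m^2) * ?s' + scal (c * (1 + m^2))"
  \<comment> \<open>Three linear equations for \<open>\<sigma>\<^sup>2\<close>, \<open>(\<sigma>\<^sup>*)\<^sup>2\<close> and \<open>\<rho> \<rho>\<^sup>*\<close> remain; the other products are eliminated by the sphere relations.\<close>
  have "scal (m^2) * (?s * ?s) - ?s' * ?s' + scal (m^4 - 1) * (?r * ?r')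
     = ?g8 + (scal (m^2) * ?k - ?k' + scal (m^2 - 1) + scal c * ?s - scal c * ?s')"
    by (rule poly_mapping_eqI; simp add: nc_simps; simp add: algebra_simps flip: power_add)
  also have "\<dots> \<in> letter_span \<kappa>" by (intro letter_span_add[OF g(8)] si k)
  finally have E1: "scal (m^2) * (?s * ?s) - ?s' * ?s' + scal (m^4 - 1) * (?r * ?r') \<in> letter_span \<kappa>" .
  have "scal (m^4) * (?s * ?s) + ?s' * ?s' - scal (m^2 * (1 + m^2)) * (?r * ?r')
     = ?g9 + (scal ((c + 1 + m^2) * m^2) * ?s + scal (c + 1 + m^2) * ?s' - scal (c * (1 + m^2) + 2 * m^2) - scal (m^2) * (?k + ?k'))"
    by (rule poly_mapping_eqI; simp add: nc_simps; simp add: algebra_simps flip: power_add)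
  also have "\<dots> \<in> letter_span \<kappa>" by (intro letter_span_add[OF g(9)] si k)
  finally have E3: "scal (m^4) * (?s * ?s) + ?s' * ?s' - scal (m^2 * (1 + m^2)) * (?r * ?r') \<in> letter_span \<kappa>" .
  have "scal (1 + m^2) * (scal (m^2) * (?s * ?s) - ?r * ?r') =
     (scal (m^2) * (?s * ?s) - ?s' * ?s' + scal (m^4 - 1) * (?r * ?r')) + (scal (m^4) * (?s * ?s) + ?s' * ?s' - scal (m^2 * (1 + m^2)) * (?r * ?r'))"
    by (rule poly_mapping_eqI; simp add: nc_simps; simp add: algebra_simps flip: power_add)
  with letter_span_add[OF E1 E3] have V: "scal (m^2) * (?s * ?s) - ?r * ?r' \<in> letter_span \<kappa>"
    by (metis letter_span_cancel[OF nz(2)])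
  have W: "?s' * ?s' - scal (m^4) * (?r * ?r') \<in> letter_span \<kappa>"
  proof -
    have "?s' * ?s' - scal (m^4) * (?r * ?r') = (scal (m^2) * (?s * ?s) - ?r * ?r') - (scal (m^2) * (?s * ?s) - ?s' * ?s' + scal (m^4 - 1) * (?r * ?r'))"
      by (rule poly_mapping_eqI; simp add: nc_simps; simp add: algebra_simps)
    then show ?thesis using letter_span_diff[OF V E1] by (simp only:)
  qed
  have "scal (1 + m ^ 8 + m^2 * (1 + m^2)^2) * (?r * ?r')
     = scal (m^2) * (?g3 + scal (1 + m^2)) - (scal (m^2) * (?s * ?s) - ?r * ?r') - scal (m^4) * (?s' * ?s' - scal (m^4) * (?r * ?r'))"
    by (rule poly_mapping_eqI; simp add: nc_simps; simp add: algebra_simps flip: power_add)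
  also have "\<dots> \<in> letter_span \<kappa>"
    by (rule letter_span_diff[OF letter_span_diff[OF letter_span_scal_mult[OF letter_span_add[OF g(3) letter_span_scal]] V] letter_span_scal_mult[OF W]])
  finally have C: "?r * ?r' \<in> letter_span \<kappa>" by (rule letter_span_cancel[OF nz(3)])
  have A: "?s * ?s \<in> letter_span \<kappa>" using letter_span_add[OF V C] letter_span_cancel[of "m^2"] m by simp
  have B: "?s' * ?s' \<in> letter_span \<kappa>" using letter_span_add[OF W letter_span_scal_mult[OF C, of "m^4"]] by simp
  have D: "?s * ?s' \<in> letter_span \<kappa>" using letter_span_add[OF letter_span_diff[OF k(1) letter_span_scal_mult[OF C, of "m^2"]] letter_span_scal[of 1]] by simp
  have E: "?s' * ?s \<in> letter_span \<kappa>" using letter_span_add[OF letter_span_diff[OF k(2) C] letter_span_scal[of 1]] by simp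
  have F: "?r' * ?r \<in> letter_span \<kappa>" using letter_span_diff[OF C J[OF SU_rels(1)]] by simp
  show ?thesis using r1 r2 A B C D E F g(1,4) by (cases x; cases y) auto
qed

lemma letter_span_UNIV: "x \<in> letter_span \<kappa>"
proof -
  have step: "x * gen y \<in> letter_span \<kappa>" if x: "x \<in> letter_span \<kappa>" for x y
  proof -
    from x obtain c0 c1 c2 c3 c4 where c: "x - affine c0 c1 c2 c3 c4 \<in> R_plus_rep \<kappa>"
      unfolding letter_span_def by blast
    have eq: "x * gen y = (x - affine c0 c1 c2 c3 c4) * gen y + scal c0 * gen y + scal c1 * (gen Sigma * gen y)
      + scal c2 * (gen Sigma' * gen y) + scal c3 * (gen Rho * gen y) + scal c4 * (gen Rho' * gen y)"
      by (simp add: affine_def algebra_simps)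
    show ?thesis unfolding eq
      by (intro letter_span_add letter_span_scal_mult letter_span_quadratic letter_span_gen letter_span_R_plus_rep[OF R_plus_rep_mult[OF c]])
  qed
  have word: "Poly_Mapping.single (Word xs) 1 \<in> letter_span \<kappa>" for xs
  proof (induction xs rule: rev_induct)
    case Nil
    then show ?case using letter_span_scal[of 1 \<kappa>] by (simp add: scal_def zero_word_def)
  next
    case (snoc y xs)
    have "Poly_Mapping.single (Word (xs @ [y])) 1 = Poly_Mapping.single (Word xs) (1::complex fls) * gen y"
      by (simp add: gen_def mult_single plus_word_def)
    with step[OF snoc] show ?case by simp
  qed
  have "Poly_Mapping.single w c \<in> letter_span \<kappa>" for w c
  proof -
    have "Poly_Mapping.single w c = scal c * Poly_Mapping.single (Word (letters w)) 1"
      by (simp add: scal_def mult_single plus_word_def zero_word_def)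
    then show ?thesis using letter_span_scal_mult[OF word[of "letters w"], of c] by (simp only:)
  qed
  then have "(\<Sum>w\<in>K. Poly_Mapping.single w (f w)) \<in> letter_span \<kappa>" for f K
    using letter_span_scal[of 0 \<kappa>] by (induction K rule: infinite_finite_induct) (auto intro: letter_span_add)
  then show ?thesis
    using poly_mapping_sum_single[of x] by metis
qed

text \<open>Independence of the images of \<open>v0\<close> under \<open>1\<close>, \<open>\<sigma>\<close>, \<open>\<sigma>\<^sup>*\<close>: the three equations are the coordinates \<open>IE\<close>,
  \<open>IW\<close>, \<open>IZ\<close> of a vanishing combination.\<close>

lemma affine_kernel:
  fixes m n h e b c0 c1 c2 :: "'a::field_char_0"
  assumes m: "m * n = 1" "m \<noteq> 1" "1 + m \<noteq> 0" "1 + m + m^2 \<noteq> 0" and b: "2 * e^2 * b = - (1 + m^2)" and eh: "e * h = m - n" "e \<noteq> 0"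
    and eqs: "c0 + c1 + c2 = 0" "c0 + m * c1 + n * c2 = 0" "b * c0 + (n * b - h^2 * m / 2) * c1 + (m * b - h^2 * m / 2) * c2 = 0"
  shows "c0 = 0" "c1 = 0" "c2 = 0"
proof -
  have mn: "m * (n * x) = x" for x using m(1) by (simp flip: mult.assoc)
  note A = power2_eq_square algebra_simps m(1) mn
  \<comment> \<open>The first two equations express \<open>c0\<close> and \<open>c2\<close> by \<open>c1\<close>; the third then has an invertible coefficient.\<close>
  have "(m - 1) * (m * c1 - c2) = m * (c0 + m * c1 + n * c2) - m * (c0 + c1 + c2)"
    by (simp add: A)
  then have c2: "c2 = m * c1" using eqs m(2) by simp
  then have c0: "c0 = - (1 + m) * c1" using eqs(1) by (simp add: algebra_simps eq_neg_iff_add_eq_0)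
  have "0 = 2 * e^2 * (b * c0 + (n * b - h^2 * m / 2) * c1 + (m * b - h^2 * m / 2) * c2)"
    unfolding eqs by simp
  also have "\<dots> = (2 * e^2 * b) * (c0 + n * c1 + m * c2) - (e * h)^2 * m * (c1 + c2)"
    by (simp add: algebra_simps power_mult_distrib power2_eq_square)
  also have "\<dots> = - ((1 + m^2) * (n - 1 - m + m^2) + (m - n)^2 * m * (1 + m)) * c1"
    unfolding b eh c2 c0 by (simp add: algebra_simps power2_eq_square)
  also have "\<dots> = - (2 * n * (m - 1)^2 * (1 + m) * (1 + m + m^2)) * c1"
  proof -
    have 1: "n - 1 - m + m^2 = n * (m - 1)^2 * (1 + m)"
      by (simp add: A)
    have 2: "m - n = n * (m - 1) * (1 + m)"
      by (simp add: A)
    have 3: "(m - n)^2 * m = n * (m - 1)^2 * (1 + m)^2"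
      unfolding 2 by (simp add: A)
    show ?thesis unfolding 1 3 by (simp add: power2_eq_square algebra_simps)
  qed
  finally show c1: "c1 = 0" using m by auto
  show "c2 = 0" "c0 = 0" using c1 c2 c0 by simp_all
qed

text \<open>The annihilator of \<open>v0\<close> is \<open>R\<^sub>+\<close>.\<close>

lemma R_plus_rep_iff:
  assumes kappa: "\<kappa> \<noteq> 0"
  shows "x \<in> R_plus_rep \<kappa> \<longleftrightarrow> (\<forall>i. act \<kappa> x (v0 \<kappa>) i = 0)"
proof
  assume "\<forall>i. act \<kappa> x (v0 \<kappa>) i = 0"
  obtain c0 c1 c2 c3 c4 where c: "x - affine c0 c1 c2 c3 c4 \<in> R_plus_rep \<kappa>"
    using letter_span_UNIV[of x \<kappa>] unfolding letter_span_def by blast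
  have zero: "act \<kappa> (affine c0 c1 c2 c3 c4) (v0 \<kappa>) i = 0" for i
    using R_plus_rep_kills[OF kappa c, of i] \<open>\<forall>i. act \<kappa> x (v0 \<kappa>) i = 0\<close> by (simp add: act_diff)
  define m where "m = mu \<kappa>"
  define b where "b = v0 \<kappa> IZ"
  have v: "v0 \<kappa> IW = 1" "v0 \<kappa> ID = 0" "v0 \<kappa> IS = 0" "v0 \<kappa> IE = 1" "v0 \<kappa> IZ = b"
    by (simp_all add: v0_simps(1-4) b_def)
  note s = affine_def act_add act_scal act_scal_mult act_gen letter_act.simps v m_def[symmetric]
  have e: "e_mu \<kappa> \<noteq> 0" by (rule e_mu_nonzero[OF kappa])
  have m0: "m \<noteq> 0" using mu_nonzero by (simp add: m_def)
  have m1: "m \<noteq> 1" using e by (auto simp: e_mu_def m_def)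
  have nz: "x \<noteq> 0" if "fls_nth x 0 \<noteq> 0" for x :: "complex fls" using that by auto
  have mm: "1 + m \<noteq> 0" "1 + m + m^2 \<noteq> 0" by (rule nz, simp add: m_def nth_simps)+
  have c34: "c3 = 0" "c4 = 0"
  proof -
    have "c3 - c4 = 0" using zero[of ID] by (simp add: s)
    moreover have "hp / 2 * (c3 + c4) = 0" using zero[of IS] by (simp add: s algebra_simps add_divide_distrib)
    ultimately show "c3 = 0" "c4 = 0" by simp_all
  qed
  have "c0 + c1 + c2 = 0" using zero[of IE] by (simp add: s c34)
  moreover have "c0 + m * c1 + 1 / m * c2 = 0" using zero[of IW] by (simp add: s c34 mult.commute)
  moreover have "b * c0 + (1 / m * b - hp^2 * m / 2) * c1 + (m * b - hp^2 * m / 2) * c2 = 0"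
    using zero[of IZ] by (simp add: s c34 mult.commute)
  moreover have "m * (1 / m) = 1" using m0 by simp
  moreover have "2 * e_mu \<kappa>^2 * b = - (1 + m^2)" using e by (simp add: b_def v0_simps(5) m_def)
  moreover have "e_mu \<kappa> * hp = m - 1 / m" by (simp add: e_mu_def m_def)
  ultimately have "c0 = 0" "c1 = 0" "c2 = 0"
    using affine_kernel[of m "1 / m" "e_mu \<kappa>" b hp c0 c1 c2] m1 mm e by blast+
  with c c34 show "x \<in> R_plus_rep \<kappa>" by (simp add: affine_def)
qed (simp add: R_plus_rep_kills[OF kappa])

section \<open>Passage to the contracted algebra\<close>

lemma hL_rep_iff: "x \<in> hL_rep \<kappa> \<longleftrightarrow> su \<kappa> x \<in> hL \<kappa>"
proof
  assume "x \<in> hL_rep \<kappa>"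
  then obtain y where y: "y \<in> L_rep \<kappa>" "x - scal hp * y \<in> SU_ideal \<kappa>" by (auto simp: hL_rep_def)
  then have "su \<kappa> x = su \<kappa> (scal fls_X) \<otimes>\<^bsub>SU \<kappa>\<^esub> su \<kappa> y"
    by (simp add: su_mult su_eq_iff hp_def)
  with y(1) show "su \<kappa> x \<in> hL \<kappa>" by (auto simp: hL_def L_rep_def)
next
  assume "su \<kappa> x \<in> hL \<kappa>"
  then obtain y where y: "y \<in> L_alg \<kappa>" "su \<kappa> x = su \<kappa> (scal fls_X) \<otimes>\<^bsub>SU \<kappa>\<^esub> y" by (auto simp: hL_def)
  moreover have "y \<in> range (su \<kappa>)"
    using y(1) subringE(1)[OF subring_L_alg[of \<kappa>]] by (auto simp: carrier_SU)
  ultimately obtain z where "z \<in> L_rep \<kappa>" "su \<kappa> x = su \<kappa> (scal hp * z)"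
    by (auto simp: su_mult L_rep_def hp_def)
  then show "x \<in> hL_rep \<kappa>" by (auto simp: hL_rep_def su_eq_iff)
qed

lemma L_alg_eq: "L_alg \<kappa> = su \<kappa> ` L_rep \<kappa>"
  using subringE(1)[OF subring_L_alg[of \<kappa>]] by (auto simp: L_rep_def carrier_SU)

text \<open>The limit of the class of an element of the free algebra.\<close>

definition lim_rep :: "real \<Rightarrow> free_alg \<Rightarrow> free_alg set set" where
  "lim_rep \<kappa> x = lim_map \<kappa> (su \<kappa> x)"

lemma su_in_L_ring: "x \<in> L_rep \<kappa> \<Longrightarrow> su \<kappa> x \<in> carrier (L_ring \<kappa>)"
  by (simp add: L_ring_def L_rep_def)

lemma carrier_E: "carrier (E_tilde \<kappa>) = lim_rep \<kappa> ` L_rep \<kappa>"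
  by (auto simp: E_tilde_def FactRing_def A_RCOSETS_def' L_ring_def L_alg_eq lim_rep_def lim_map_def)

lemma ring_E: "ring (E_tilde \<kappa>)"
  unfolding E_tilde_def by (rule ideal.quotient_is_ring[OF ideal_hL])

lemma lim_rep_mult: "x \<in> L_rep \<kappa> \<Longrightarrow> y \<in> L_rep \<kappa> \<Longrightarrow> lim_rep \<kappa> x \<otimes>\<^bsub>E_tilde \<kappa>\<^esub> lim_rep \<kappa> y = lim_rep \<kappa> (x * y)"
  using ideal.rcoset_mult_add[OF ideal_hL su_in_L_ring su_in_L_ring, of x \<kappa> y]
  by (simp add: E_tilde_def FactRing_def lim_rep_def lim_map_def L_ring_def su_mult)

lemma lim_rep_add: "x \<in> L_rep \<kappa> \<Longrightarrow> y \<in> L_rep \<kappa> \<Longrightarrow> lim_rep \<kappa> x \<oplus>\<^bsub>E_tilde \<kappa>\<^esub> lim_rep \<kappa> y = lim_rep \<kappa> (x + y)"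
  using abelian_subgroup.a_rcos_sum[OF abelian_subgroupI3[OF ideal.axioms(1)[OF ideal_hL] ring.is_abelian_group[OF ring_L_ring]] su_in_L_ring su_in_L_ring, of x \<kappa> y]
  by (simp add: E_tilde_def FactRing_def lim_rep_def lim_map_def L_ring_def su_add)

lemma lim_rep_one: "\<one>\<^bsub>E_tilde \<kappa>\<^esub> = lim_rep \<kappa> 1"
  by (simp add: E_tilde_def FactRing_def lim_rep_def lim_map_def L_ring_def su_one)

lemma lim_rep_zero: "\<zero>\<^bsub>E_tilde \<kappa>\<^esub> = lim_rep \<kappa> 0"
proof -
  interpret ring "E_tilde \<kappa>" by (rule ring_E)
  have 0: "0 \<in> L_rep \<kappa>" using L_rep_scal[of 0] by simp
  then have "lim_rep \<kappa> 0 \<in> carrier (E_tilde \<kappa>)" by (simp add: carrier_E)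
  with lim_rep_add[OF 0 0] show ?thesis by (metis add.r_cancel_one' add_0 )
qed

lemma lim_rep_uminus: "x \<in> L_rep \<kappa> \<Longrightarrow> \<ominus>\<^bsub>E_tilde \<kappa>\<^esub> lim_rep \<kappa> x = lim_rep \<kappa> (- x)"
  by (rule abelian_group.minus_equality[OF ring.is_abelian_group[OF ring_E]])
     (simp_all add: carrier_E lim_rep_add lim_rep_zero L_rep_uminus)

lemma lim_rep_diff: "x \<in> L_rep \<kappa> \<Longrightarrow> y \<in> L_rep \<kappa> \<Longrightarrow> lim_rep \<kappa> x \<ominus>\<^bsub>E_tilde \<kappa>\<^esub> lim_rep \<kappa> y = lim_rep \<kappa> (x - y)"
  by (simp add: a_minus_def lim_rep_uminus lim_rep_add L_rep_uminus)

lemma lim_rep_eq_iff: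
  assumes "x \<in> L_rep \<kappa>" "y \<in> L_rep \<kappa>"
  shows "lim_rep \<kappa> x = lim_rep \<kappa> y \<longleftrightarrow> x - y \<in> hL_rep \<kappa>"
proof -
  interpret L: ring "L_ring \<kappa>" by (rule ring_L_ring)
  have "\<ominus>\<^bsub>L_ring \<kappa>\<^esub> su \<kappa> y = su \<kappa> (- y)"
    using assms L_rep_uminus[of y \<kappa>] by (intro L.minus_equality) (simp_all add: L_ring_def L_rep_def su_add su_zero)
  then have "su \<kappa> x \<ominus>\<^bsub>L_ring \<kappa>\<^esub> su \<kappa> y = su \<kappa> (x - y)"
    by (simp add: a_minus_def) (simp add: L_ring_def su_add)
  then show ?thesis
    using L.quotient_eq_iff_same_a_r_cos[OF ideal_hL su_in_L_ring su_in_L_ring, OF assms]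
    by (simp add: lim_rep_def lim_map_def hL_rep_iff)
qed

lemma right_ideal_image:
  assumes "lattice_right_ideal \<kappa> Q" "Q \<subseteq> L_rep \<kappa>"
  shows "right_ideal (lim_rep \<kappa> ` Q) (E_tilde \<kappa>)"
proof -
  interpret Q: lattice_right_ideal \<kappa> Q by fact
  have L: "x \<in> L_rep \<kappa>" if "x \<in> Q" for x using that assms(2) by blast
  have neg: "- x \<in> Q" if "x \<in> Q" for x using Q.diff[OF Q.zero_in_Q that] by simp
  have "additive_subgroup (lim_rep \<kappa> ` Q) (E_tilde \<kappa>)"
  proof (unfold additive_subgroup_def, rule group.subgroupI)
    show "group (add_monoid (E_tilde \<kappa>))"
      using abelian_group.a_group[OF ring.is_abelian_group[OF ring_E]] .
    show "lim_rep \<kappa> ` Q \<noteq> {}" using Q.zero_in_Q by blast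
    fix p assume "p \<in> lim_rep \<kappa> ` Q"
    then obtain x where x: "p = lim_rep \<kappa> x" "x \<in> Q" by blast
    then show "inv\<^bsub>add_monoid (E_tilde \<kappa>)\<^esub> p \<in> lim_rep \<kappa> ` Q"
      using neg lim_rep_uminus[of x \<kappa>] L by (simp add: a_inv_def)
    fix q assume "q \<in> lim_rep \<kappa> ` Q"
    then obtain y where "q = lim_rep \<kappa> y" "y \<in> Q" by blast
    with x show "p \<otimes>\<^bsub>add_monoid (E_tilde \<kappa>)\<^esub> q \<in> lim_rep \<kappa> ` Q"
      by (simp add: lim_rep_add L Q.add)
  qed (auto simp: carrier_E L)
  then show ?thesis
    by (auto simp: right_ideal_def carrier_E lim_rep_mult L Q.mult)
qed

lemma right_ideal_preimage:
  assumes "right_ideal I (E_tilde \<kappa>)"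
  shows "lattice_right_ideal \<kappa> {x \<in> L_rep \<kappa>. lim_rep \<kappa> x \<in> I}"
proof -
  interpret additive_subgroup I "E_tilde \<kappa>" using assms by (simp add: right_ideal_def)
  have 0: "0 \<in> L_rep \<kappa>" using L_rep_scal[of 0] by simp
  show ?thesis
  proof
    show "hL_rep \<kappa> \<subseteq> {x \<in> L_rep \<kappa>. lim_rep \<kappa> x \<in> I}"
    proof
      fix x assume x: "x \<in> hL_rep \<kappa>"
      then have "lim_rep \<kappa> x = lim_rep \<kappa> 0" by (simp add: lim_rep_eq_iff hL_rep_L_rep 0)
      with x show "x \<in> {x \<in> L_rep \<kappa>. lim_rep \<kappa> x \<in> I}"
        using zero_closed by (simp add: lim_rep_zero hL_rep_L_rep)
    qed
    show "x + y \<in> {x \<in> L_rep \<kappa>. lim_rep \<kappa> x \<in> I}" if "x \<in> {x \<in> L_rep \<kappa>. lim_rep \<kappa> x \<in> I}" "y \<in> {x \<in> L_rep \<kappa>. lim_rep \<kappa> x \<in> I}" for x y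
      using that a_closed[of "lim_rep \<kappa> x" "lim_rep \<kappa> y"] by (simp add: lim_rep_add L_rep_add)
    show "x * y \<in> {x \<in> L_rep \<kappa>. lim_rep \<kappa> x \<in> I}" if "x \<in> {x \<in> L_rep \<kappa>. lim_rep \<kappa> x \<in> I}" "y \<in> L_rep \<kappa>" for x y
      using that assms by (auto simp: right_ideal_def carrier_E L_rep_mult simp flip: lim_rep_mult)
  qed
qed

text \<open>An element \<open>x\<close> with \<open>v0 x = h u\<close>, \<open>u\<close> integral, is corrected by \<open>h y\<close>, where \<open>v0 y = u\<close> and \<open>y\<close> is in \<open>\<L>\<close>. The
  difference kills \<open>v0\<close>, so it lies in \<open>R\<^sub>+\<close>.\<close>

lemma contraction_R_plus:
  assumes kappa: "\<kappa> \<noteq> 0"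
  shows "contraction \<kappa> (R_plus \<kappa>) = lim_rep \<kappa> ` lim_ker \<kappa>"
proof -
  have "R_plus \<kappa> \<inter> L_alg \<kappa> = su \<kappa> ` (R_plus_rep \<kappa> \<inter> L_rep \<kappa>)"
    by (auto simp: L_alg_eq R_plus_rep_def)
  then have eq: "contraction \<kappa> (R_plus \<kappa>) = lim_rep \<kappa> ` (R_plus_rep \<kappa> \<inter> L_rep \<kappa>)"
    by (simp add: contraction_def lim_rep_def image_image)
  have "lim_rep \<kappa> x \<in> lim_rep \<kappa> ` (R_plus_rep \<kappa> \<inter> L_rep \<kappa>)" if x: "x \<in> lim_ker \<kappa>" for x
  proof -
    have "\<forall>i. \<exists>d\<in>O_int. act \<kappa> x (v0 \<kappa>) i = hp * d"
    proof
      fix i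
      have "act \<kappa> x (v0 \<kappa>) i \<in> O_int" "fls_nth (act \<kappa> x (v0 \<kappa>) i) 0 = 0"
        using act_int_vec[of x \<kappa> "v0 \<kappa>"] v0_int[OF kappa] x by (auto simp: int_vec_def lim_ker_def)
      then show "\<exists>d\<in>O_int. act \<kappa> x (v0 \<kappa>) i = hp * d" using O_nth_0_eq_0 by metis
    qed
    then obtain u where u: "\<And>i. u i \<in> O_int" "\<And>i. act \<kappa> x (v0 \<kappa>) i = hp * u i" by metis
    obtain y where y: "y \<in> L_rep \<kappa>" "act \<kappa> y (v0 \<kappa>) = u"
      using int_vec_image[OF kappa, of u] u(1) by (auto simp: int_vec_def)
    let ?z = "x - scal hp * y"
    have L: "x \<in> L_rep \<kappa>" "?z \<in> L_rep \<kappa>" using x y(1) by (auto simp: lim_ker_def intro!: L_rep_diff L_rep_scal_mult)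
    have "?z \<in> R_plus_rep \<kappa>" unfolding R_plus_rep_iff[OF kappa] by (simp add: act_diff act_scal_mult u(2) y(2))
    moreover have "lim_rep \<kappa> x = lim_rep \<kappa> ?z"
      unfolding lim_rep_eq_iff[OF L] using hL_rep_hp[OF y(1)] by simp
    ultimately show ?thesis using L by blast
  qed
  moreover have "R_plus_rep \<kappa> \<inter> L_rep \<kappa> \<subseteq> lim_ker \<kappa>" by (auto simp: R_plus_rep_iff[OF kappa] lim_ker_def)
  ultimately show ?thesis unfolding eq by blast
qed

lemma right_ideal_gen_eq_lim_ker:
  assumes kappa: "\<kappa> \<noteq> 0"
  shows "right_ideal_gen (E_tilde \<kappa>) (lim_rep \<kappa> ` contraction_gens \<kappa>) = lim_rep \<kappa> ` lim_ker \<kappa>"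
proof
  interpret K: lattice_right_ideal \<kappa> "lim_ker \<kappa>" by (rule lim_ker_right_ideal[OF kappa])
  have KL: "lim_ker \<kappa> \<subseteq> L_rep \<kappa>" by (auto simp: lim_ker_def)
  have gens: "contraction_gens \<kappa> \<subseteq> lim_ker \<kappa>"
    using K.contraction_gens_iff simple_gens_lim_ker[OF kappa] by blast
  show "right_ideal_gen (E_tilde \<kappa>) (lim_rep \<kappa> ` contraction_gens \<kappa>) \<subseteq> lim_rep \<kappa> ` lim_ker \<kappa>"
    by (rule right_ideal_gen_minimal[OF right_ideal_image[OF K.lattice_right_ideal_axioms KL] image_mono[OF gens]])
  have "lim_rep \<kappa> ` contraction_gens \<kappa> \<subseteq> carrier (E_tilde \<kappa>)" using gens KL by (auto simp: carrier_E)
  note J = right_ideal_gen[OF ring_E this]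
  let ?Q = "{x \<in> L_rep \<kappa>. lim_rep \<kappa> x \<in> right_ideal_gen (E_tilde \<kappa>) (lim_rep \<kappa> ` contraction_gens \<kappa>)}"
  interpret Q: lattice_right_ideal \<kappa> ?Q by (rule right_ideal_preimage[OF J(1)])
  have "contraction_gens \<kappa> \<subseteq> ?Q" using J(2) gens KL by blast
  then have "lim_ker \<kappa> \<subseteq> ?Q"
    using lim_ker_minimal[OF kappa Q.lattice_right_ideal_axioms] Q.contraction_gens_iff by blast
  then show "lim_rep \<kappa> ` lim_ker \<kappa> \<subseteq> right_ideal_gen (E_tilde \<kappa>) (lim_rep \<kappa> ` contraction_gens \<kappa>)" by blast
qed

theorem theorem3:
  fixes \<kappa> :: real
  assumes "\<kappa> \<noteq> 0"
  shows "let E = E_tilde \<kappa>;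
             I = \<one>\<^bsub>E\<^esub>;
             a = lim_map \<kappa> (a_elt \<kappa>); a' = lim_map \<kappa> (su_star (a_elt \<kappa>));
             w = lim_map \<kappa> (w_elt \<kappa>); w' = lim_map \<kappa> (su_star (w_elt \<kappa>))
         in contraction \<kappa> (R_plus \<kappa>) = right_ideal_gen E
              {a \<oplus>\<^bsub>E\<^esub> a' \<ominus>\<^bsub>E\<^esub> E_scal \<kappa> 2 \<otimes>\<^bsub>E\<^esub> I,
               (a \<ominus>\<^bsub>E\<^esub> I) \<otimes>\<^bsub>E\<^esub> w,
               (a' \<ominus>\<^bsub>E\<^esub> I) \<otimes>\<^bsub>E\<^esub> w,
               (a \<ominus>\<^bsub>E\<^esub> I) \<otimes>\<^bsub>E\<^esub> w',
               (a' \<ominus>\<^bsub>E\<^esub> I) \<otimes>\<^bsub>E\<^esub> w',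
               w \<otimes>\<^bsub>E\<^esub> w \<oplus>\<^bsub>E\<^esub> E_scal \<kappa> (complex_of_real (1 / \<kappa>)) \<otimes>\<^bsub>E\<^esub> w,
               w' \<otimes>\<^bsub>E\<^esub> w' \<ominus>\<^bsub>E\<^esub> E_scal \<kappa> (complex_of_real (1 / \<kappa>)) \<otimes>\<^bsub>E\<^esub> w'}"
proof -
  have gens: "lim_map \<kappa> (a_elt \<kappa>) = lim_rep \<kappa> (a_rep \<kappa>)" "lim_map \<kappa> (su_star (a_elt \<kappa>)) = lim_rep \<kappa> (a_rep' \<kappa>)"
    "lim_map \<kappa> (w_elt \<kappa>) = lim_rep \<kappa> (w_rep \<kappa>)" "lim_map \<kappa> (su_star (w_elt \<kappa>)) = lim_rep \<kappa> (w_rep' \<kappa>)"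
    by (simp_all add: lim_rep_def a_elt_eq w_elt_eq su_star_gens)
  have scal: "E_scal \<kappa> 2 = lim_rep \<kappa> (scal 2)" "E_scal \<kappa> (complex_of_real (1 / \<kappa>)) = lim_rep \<kappa> (scal (inv_kappa \<kappa>))"
    by (simp_all add: E_scal_def lim_rep_def inv_kappa_def)
  note L = gens_in_L_rep L_rep_1 L_rep_scal[OF O_numeral] L_rep_scal[OF inv_kappa_O]
  show ?thesis
    unfolding Let_def gens scal contraction_R_plus[OF assms] lim_rep_one
    by (simp add: lim_rep_add lim_rep_diff lim_rep_mult L L_rep_add L_rep_diff L_rep_mult
        right_ideal_gen_eq_lim_ker[OF assms, symmetric] contraction_gens_def)
qed
end
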